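(* Let $G$ be a DAG on $\{1,\dots,K\}$ satisfying the no-collider condition: for every $k\in\{1,\dots,K\}$ the parent set $\mathrm{pa}(k)$ is fully connected. Fix $L>0$ and let $\mathcal{Q}$ be the set of all $\mu\in\mathcal{P}_G$ such that for all $2\le k\le K$ and all $x_{\mathrm{pa}(k)},\tilde x_{\mathrm{pa}(k)}\in\mathcal{X}_{\mathrm{pa}(k)}$, $$\mathcal{W}\big(\mu(dx_k\mid x_{\mathrm{pa}(k)}),\mu(dx_k\mid\tilde x_{\mathrm{pa}(k)})\big)\le L\,\|x_{\mathrm{pa}(k)}-\tilde x_{\mathrm{pa}(k)}\|.$$ Then there exists a constant $C$ depending only on $G$, $L$ and $d_{\rm loc}$ such that for every sample size $n\ge 1$ $$V_{\mathcal{Q}}(n)\le C\,\max\{\log(n),1\}\,n^{-1/d_{\rm loc}}.$$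
   Context: Setting: $G$ is a directed acyclic graph with nodes $\{1,\dots,K\}$, topologically sorted (every edge $i\to j$ has $i<j$); $\mathrm{pa}(k)$ is the set of parents of $k$. A set $J$ of nodes is fully connected if there is an edge $k\to\ell$ for all $k,\ell\in J$ with $k<\ell$. $\mathcal{X}=[0,1]^d=\mathcal{X}_1\times\dots\times\mathcal{X}_K$ with $\mathcal{X}_k=[0,1]^{d_k}$, $\sum_k d_k=d$, $\mathcal{X}_I=\prod_{i\in I}\mathcal{X}_i$, $x_I=(x_i)_{i\in I}$. $\|\cdot\|$ is the sup-norm. $\mathcal{P}_G$ is the set of Borel probability measures $\mu$ on $\mathcal{X}$ with $\mu(dx)=\prod_{k=1}^K\mu(dx_k\mid x_{\mathrm{pa}(k)})$, where $\mu(dx_k\mid x_{\mathrm{pa}(k)})$ is the regular conditional distribution of the $k$-th variable given its parents (the $k$-th marginal if $\mathrm{pa}(k)=\emptyset$). Lipschitz conditions on kernels mean that the regular conditional distributions admit versions satisfying them; conditions with $\mathrm{pa}(k)=\emptyset$ are void. $\mathcal{W}$ is the first-order Wasserstein distance w.r.t. $\|\cdot\|$. $d_{\mathrm{pa}(k)}=\sum_{\ell\in\mathrm{pa}(k)}d_\ell$ and $d_{\rm loc}=\max_{1\le k\le K}(\max\{2,d_k\}+d_{\mathrm{pa}(k)})$. For $\mathcal{Q}\subseteq\mathcal{P}(\mathcal{X})$, $V_{\mathcal{Q}}(n)=\inf_{E_n}\sup_{\mu\in\mathcal{Q}}\int\mathcal{W}(\mu,E_n)\,d\mu^{\otimes n}$,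 the infimum over all measurable estimators $E_n:\mathcal{X}^n\to\mathcal{P}(\mathcal{X})$. *)

theory Defs
  imports "HOL-Probability.Probability"
begin

section \<open>Graphs\<close>

text \<open>A graph on the nodes \<open>{1..K}\<close> is given by its set of edges. Requiring \<open>i < j\<close> for
  every edge says that the graph is topologically sorted, which entails that it is acyclic.\<close>

definition sorted_dag :: "nat \<Rightarrow> (nat \<times> nat) set \<Rightarrow> bool" where
  "sorted_dag K E \<longleftrightarrow> (\<forall>(i, j)\<in>E. 1 \<le> i \<and> i < j \<and> j \<le> K)"

definition parents :: "(nat \<times> nat) set \<Rightarrow> nat \<Rightarrow> nat set" where
  "parents E k = {i. (i, k) \<in> E}"

definition fully_connected :: "(nat \<times> nat) set \<Rightarrow> nat set \<Rightarrow> bool" where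
  "fully_connected E J \<longleftrightarrow> (\<forall>k\<in>J. \<forall>l\<in>J. k < l \<longrightarrow> (k, l) \<in> E)"

definition no_collider :: "nat \<Rightarrow> (nat \<times> nat) set \<Rightarrow> bool" where
  "no_collider K E \<longleftrightarrow> (\<forall>k\<in>{1..K}. fully_connected E (parents E k))"

definition d_loc :: "nat \<Rightarrow> (nat \<times> nat) set \<Rightarrow> (nat \<Rightarrow> nat) \<Rightarrow> nat" where
  "d_loc K E d = Max ((\<lambda>k. max 2 (d k) + (\<Sum>l\<in>parents E k. d l)) ` {1..K})"


section \<open>The state spaces and the sup-norm distance\<close>

text \<open>The cube \<open>[0,1]\<^sup>m\<close> consists of extensional functions on \<open>{..<m}\<close>, and \<open>state_space d I\<close> is
  the product of the cubes \<open>[0,1]\<^bsup>d i\<^esup>\<close> over \<open>i \<in> I\<close>; the restriction of \<open>x\<close> to \<open>I\<close> is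
  \<open>restrict x I\<close>. As all index sets are finite, the product sigma-algebras are the Borel
  sigma-algebras. If \<open>I\<close> is empty, the space has exactly one point.\<close>

definition cube :: "nat \<Rightarrow> (nat \<Rightarrow> real) measure" where
  "cube m = Pi\<^sub>M {..<m} (\<lambda>_. restrict_space borel {0..1})"

definition state_space :: "(nat \<Rightarrow> nat) \<Rightarrow> nat set \<Rightarrow> (nat \<Rightarrow> nat \<Rightarrow> real) measure" where
  "state_space d I = Pi\<^sub>M I (\<lambda>i. cube (d i))"

text \<open>The inserted \<open>0\<close> only matters for empty index sets.\<close>

definition cube_dist :: "nat \<Rightarrow> (nat \<Rightarrow> real) \<Rightarrow> (nat \<Rightarrow> real) \<Rightarrow> real" where
  "cube_dist m x y = Max (insert 0 ((\<lambda>j. \<bar>x j - y j\<bar>) ` {..<m}))"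

definition state_dist ::
    "(nat \<Rightarrow> nat) \<Rightarrow> nat set \<Rightarrow> (nat \<Rightarrow> nat \<Rightarrow> real) \<Rightarrow> (nat \<Rightarrow> nat \<Rightarrow> real) \<Rightarrow> real" where
  "state_dist d I x y = Max (insert 0 ((\<lambda>i. cube_dist (d i) (x i) (y i)) ` I))"


section \<open>Wasserstein distance and minimax risk\<close>

definition couplings :: "'a measure \<Rightarrow> 'b measure \<Rightarrow> ('a \<times> 'b) measure set" where
  "couplings \<mu> \<nu> =
     {\<pi>. sets \<pi> = sets (\<mu> \<Otimes>\<^sub>M \<nu>) \<and> distr \<pi> \<mu> fst = \<mu> \<and> distr \<pi> \<nu> snd = \<nu>}"

definition wasserstein :: "('a \<Rightarrow> 'a \<Rightarrow> real) \<Rightarrow> 'a measure \<Rightarrow> 'a measure \<Rightarrow> ennreal" where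
  "wasserstein \<delta> \<mu> \<nu> = (\<Sqinter>\<pi>\<in>couplings \<mu> \<nu>. \<integral>\<^sup>+ z. ennreal (\<delta> (fst z) (snd z)) \<partial>\<pi>)"

text \<open>Here \<open>M\<close> only serves as a measurable space. Estimators are measurable for the
  sigma-algebra on probability measures generated by the evaluations \<open>\<nu> \<mapsto> \<nu>(A)\<close>; on the cube it
  is the Borel sigma-algebra of weak convergence and of the Wasserstein distance.\<close>

definition minimax_risk ::
    "('a \<Rightarrow> 'a \<Rightarrow> real) \<Rightarrow> 'a measure \<Rightarrow> 'a measure set \<Rightarrow> nat \<Rightarrow> ennreal" where
  "minimax_risk \<delta> M Q n =
     (\<Sqinter>est \<in> Pi\<^sub>M {..<n} (\<lambda>_. M) \<rightarrow>\<^sub>M prob_algebra M.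
        \<Squnion>\<mu>\<in>Q. \<integral>\<^sup>+ x. wasserstein \<delta> \<mu> (est x) \<partial>Pi\<^sub>M {..<n} (\<lambda>_. \<mu>))"


section \<open>Graph-compatible measures\<close>

text \<open>\<open>\<kappa>\<close> is a version of the regular conditional distribution under \<open>\<mu>\<close> of the \<open>k\<close>-th variable
  given the variables in \<open>P\<close>. If \<open>P\<close> is empty, this forces \<open>\<kappa>\<close>, which then has only one argument,
  to be the \<open>k\<close>-th marginal.\<close>

definition is_cond_distr ::
    "nat \<Rightarrow> (nat \<Rightarrow> nat) \<Rightarrow> (nat \<Rightarrow> nat \<Rightarrow> real) measure \<Rightarrow> nat \<Rightarrow> nat set \<Rightarrow>
     ((nat \<Rightarrow> nat \<Rightarrow> real) \<Rightarrow> (nat \<Rightarrow> real) measure) \<Rightarrow> bool" where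
  "is_cond_distr K d \<mu> k P \<kappa> \<longleftrightarrow>
     \<kappa> \<in> state_space d P \<rightarrow>\<^sub>M prob_algebra (cube (d k)) \<and>
     (\<forall>A\<in>sets (state_space d P). \<forall>B\<in>sets (cube (d k)).
        emeasure \<mu> {x \<in> space (state_space d {1..K}). restrict x P \<in> A \<and> x k \<in> B} =
        (\<integral>\<^sup>+ y\<in>A. emeasure (\<kappa> y) B \<partial>distr \<mu> (state_space d P) (\<lambda>x. restrict x P)))"

text \<open>\<open>kernel_product E d \<kappa> m\<close> is the measure \<open>\<Prod>\<^bsub>k \<le> m\<^esub> \<kappa>\<^sub>k(dx\<^sub>k | x\<^bsub>pa(k)\<^esub>)\<close> on
  \<open>state_space d {1..m}\<close>: the \<open>k\<close>-th coordinate is drawn from the \<open>k\<close>-th kernel given the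
  coordinates drawn before.\<close>

primrec kernel_product ::
    "(nat \<times> nat) set \<Rightarrow> (nat \<Rightarrow> nat) \<Rightarrow>
     (nat \<Rightarrow> (nat \<Rightarrow> nat \<Rightarrow> real) \<Rightarrow> (nat \<Rightarrow> real) measure) \<Rightarrow> nat \<Rightarrow>
     (nat \<Rightarrow> nat \<Rightarrow> real) measure" where
  "kernel_product E d \<kappa> 0 = return (state_space d {}) (\<lambda>_. undefined)"
| "kernel_product E d \<kappa> (Suc m) =
     kernel_product E d \<kappa> m \<bind>
       (\<lambda>x. distr (\<kappa> (Suc m) (restrict x (parents E (Suc m)))) (state_space d {1..Suc m})
              (\<lambda>y. x(Suc m := y)))"

text \<open>Any two versions of a conditional distribution agree almost surely, so the product below
  does not depend on the choice of the versions \<open>\<kappa> k\<close>.\<close>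

definition graph_measures ::
    "nat \<Rightarrow> (nat \<times> nat) set \<Rightarrow> (nat \<Rightarrow> nat) \<Rightarrow> (nat \<Rightarrow> nat \<Rightarrow> real) measure set" where
  "graph_measures K E d =
     {\<mu> \<in> space (prob_algebra (state_space d {1..K})).
        \<exists>\<kappa>. (\<forall>k\<in>{1..K}. is_cond_distr K d \<mu> k (parents E k) (\<kappa> k)) \<and>
            \<mu> = kernel_product E d \<kappa> K}"

definition lipschitz_graph_measures ::
    "nat \<Rightarrow> (nat \<times> nat) set \<Rightarrow> (nat \<Rightarrow> nat) \<Rightarrow> real \<Rightarrow> (nat \<Rightarrow> nat \<Rightarrow> real) measure set" where
  "lipschitz_graph_measures K E d L =
     {\<mu> \<in> graph_measures K E d.
        \<forall>k\<in>{2..K}. \<exists>\<kappa>. is_cond_distr K d \<mu> k (parents E k) \<kappa> \<and>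
          (\<forall>x\<in>space (state_space d (parents E k)). \<forall>x'\<in>space (state_space d (parents E k)).
             wasserstein (cube_dist (d k)) (\<kappa> x) (\<kappa> x')
               \<le> ennreal (L * state_dist d (parents E k) x x'))}"

end

theory Submission imports Defs begin

text \<open>Fix \<open>J\<close> with \<open>2\<^bsup>JD\<^esup> \<le> n < 2\<^bsup>(J+1)D\<^esup>\<close>, round the sample to the grid of width
  \<open>2\<^bsup>-J\<^esup>\<close>, and let the estimator be the product of the empirical conditional distributions of the
  rounded sample. Since there are no colliders, its marginal on every parent set is the empirical one.

  By Kantorovich duality on the grid, the Wasserstein error is controlled by integrals of Lipschitz
  functions \<open>f\<close>. Integrating out the nodes \<open>K, K-1, \<dots>\<close> with the true kernels turns \<open>f\<close> into functions that
  remain Lipschitz, so the error telescopes into one discrepancy per node between an empirical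
  and a true conditional distribution, averaged over the empirical distribution of the parents. Expanding
  the Lipschitz function over dyadic scales bounds this discrepancy by absolute values of centred
  empirical sums, uniformly in \<open>f\<close>. A second moment bound shows that every one of the \<open>J + 1\<close> scales contributes
  at most a multiple of \<open>2\<^bsup>-J\<^esup>\<close>; the maximum with \<open>2\<close> in \<open>d_loc\<close> makes this possible for one-dimensional
  nodes, and the number of scales is the logarithmic factor.\<close>

section \<open>Kantorovich duality\<close>

text \<open>The dual potential on the grid depends on the sample, so a moment bound for one fixed
  function is not enough: the error must be bounded for all Lipschitz functions at once. Chaining
  achieves this, since the function enters only through coefficients of size at most
  \<open>2 / 2 ^ j\<close> times its Lipschitz constant, and the remaining centred sums are free of
  it. Conditional averages divide by cell counts, which may be small. The plug-in law of the parents
  is the empirical one, so each cell is also weighted by its count, and the quotient cancels. Every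
  sample point is centred by the kernel at its own unrounded parents. This makes the mean exactly
  zero; the Lipschitz condition only pays for moving these kernels to the common grid point. For the
  rate, \<open>N\<close> cells at node scale \<open>j\<close> contribute about
  \<open>N * 2 ^ J / 4 ^ j\<close> besides the variance term. Counting at least two dimensions per
  node makes the bound on \<open>N / 4 ^ j\<close> nondecreasing in \<open>j\<close>, so the finest
  scale is the worst one, and there the choice of \<open>J\<close> gives the order
  \<open>n / 2 ^ J\<close>.\<close>

lemma transport_compact:
  fixes S :: "'a set" and p q :: "'a \<Rightarrow> real"
  assumes fin: "finite S"
  shows "compact {\<pi> :: 'a \<times> 'a \<Rightarrow> real. (\<forall>z. \<pi> z \<in> (if z \<in> S \<times> S then {0..1} else {0})) \<and>
     (\<forall>x\<in>S. (\<Sum>y\<in>S. \<pi> (x, y)) = p x) \<and> (\<forall>y\<in>S. (\<Sum>x\<in>S. \<pi> (x, y)) = q y)}" (is "compact ?T")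
proof -
  \<comment> \<open>Plans are stored as functions on all pairs that vanish off
    \<open>S \<times> S\<close>. They form a closed subset of a product of compact intervals, so
    Tychonoff's theorem applies.\<close>
  let ?B = "PiE (UNIV :: ('a \<times> 'a) set) (\<lambda>z. if z \<in> S \<times> S then {0..1::real} else {0})"
  have c: "continuous_on UNIV (\<lambda>\<pi> :: 'a \<times> 'a \<Rightarrow> real. \<pi> z)" for z
    by (rule continuous_on_product_coordinates)
  have "compactin (product_topology (\<lambda>_. euclidean) UNIV) ?B"
    unfolding compactin_PiE by (auto simp: compactin_euclidean_iff)
  hence B: "compact ?B"
    by (simp add: euclidean_product_topology compactin_euclidean_iff)
  have cl: "closed ((\<Inter>x\<in>S. {\<pi> :: 'a \<times> 'a \<Rightarrow> real. (\<Sum>y\<in>S. \<pi> (x, y)) = p x}) \<inter>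
      (\<Inter>y\<in>S. {\<pi>. (\<Sum>x\<in>S. \<pi> (x, y)) = q y}))"
    by (intro closed_Int closed_INT ballI closed_Collect_eq continuous_intros c)
  have "?T = ?B \<inter> ((\<Inter>x\<in>S. {\<pi>. (\<Sum>y\<in>S. \<pi> (x, y)) = p x}) \<inter> (\<Inter>y\<in>S. {\<pi>. (\<Sum>x\<in>S. \<pi> (x, y)) = q y}))"
    by (auto simp: PiE_def Pi_def)
  thus ?thesis using compact_Int_closed[OF B cl] by simp
qed

text \<open>A continuous cost attains its minimum on the compact set of plans. The product plan
  shows that this set is nonempty, and capping the entries at 1 excludes no plan because an entry is
  at most its row sum \<open>p x\<close>.\<close>

lemma optimal_transport_exists:
  fixes S :: "'a set" and p q :: "'a \<Rightarrow> real" and c :: "'a \<Rightarrow> 'a \<Rightarrow> real"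
  assumes fin: "finite S"
    and p: "\<And>x. x \<in> S \<Longrightarrow> 0 \<le> p x" "sum p S = 1" and q: "\<And>x. x \<in> S \<Longrightarrow> 0 \<le> q x" "sum q S = 1"
  obtains \<pi> where "\<And>x y. x \<in> S \<Longrightarrow> y \<in> S \<Longrightarrow> 0 \<le> \<pi> x y"
    "\<And>x. x \<in> S \<Longrightarrow> (\<Sum>y\<in>S. \<pi> x y) = p x" "\<And>y. y \<in> S \<Longrightarrow> (\<Sum>x\<in>S. \<pi> x y) = q y"
    "\<And>\<rho>. (\<And>x y. x \<in> S \<Longrightarrow> y \<in> S \<Longrightarrow> 0 \<le> \<rho> x y) \<Longrightarrow>
       (\<And>x. x \<in> S \<Longrightarrow> (\<Sum>y\<in>S. \<rho> x y) = p x) \<Longrightarrow> (\<And>y. y \<in> S \<Longrightarrow> (\<Sum>x\<in>S. \<rho> x y) = q y) \<Longrightarrow>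
       (\<Sum>x\<in>S. \<Sum>y\<in>S. \<pi> x y * c x y) \<le> (\<Sum>x\<in>S. \<Sum>y\<in>S. \<rho> x y * c x y)"
proof -
  let ?T = "{\<pi> :: 'a \<times> 'a \<Rightarrow> real. (\<forall>z. \<pi> z \<in> (if z \<in> S \<times> S then {0..1} else {0})) \<and>
     (\<forall>x\<in>S. (\<Sum>y\<in>S. \<pi> (x, y)) = p x) \<and> (\<forall>y\<in>S. (\<Sum>x\<in>S. \<pi> (x, y)) = q y)}"
  have le1: "p x \<le> 1" if "x \<in> S" for x
    using member_le_sum[of x S p] fin p that by auto
  have mem: "(\<lambda>(x, y). if x \<in> S \<and> y \<in> S then \<rho> x y else 0) \<in> ?T"
    if r: "\<And>x y. x \<in> S \<Longrightarrow> y \<in> S \<Longrightarrow> 0 \<le> \<rho> x y"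
       "\<And>x. x \<in> S \<Longrightarrow> (\<Sum>y\<in>S. \<rho> x y) = p x" "\<And>y. y \<in> S \<Longrightarrow> (\<Sum>x\<in>S. \<rho> x y) = q y" for \<rho>
  proof -
    have "\<rho> x y \<le> 1" if "x \<in> S" "y \<in> S" for x y
      using member_le_sum[of y S "\<rho> x"] fin r(1)[of x] r(2)[of x] le1[of x] that by force
    thus ?thesis using r by auto
  qed
  have "(\<lambda>(x, y). if x \<in> S \<and> y \<in> S then p x * q y else 0) \<in> ?T"
    using p q by (intro mem) (auto simp flip: sum_distrib_left sum_distrib_right)
  hence ne: "?T \<noteq> {}" by blast
  have "continuous_on ?T (\<lambda>\<pi>. \<Sum>x\<in>S. \<Sum>y\<in>S. \<pi> (x, y) * c x y)"
    by (intro continuous_intros continuous_on_subset[OF continuous_on_product_coordinates]) auto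
  from continuous_attains_inf[OF transport_compact[OF fin] ne this] obtain \<pi> where
    \<pi>: "\<pi> \<in> ?T" and min: "\<forall>\<rho>\<in>?T. (\<Sum>x\<in>S. \<Sum>y\<in>S. \<pi> (x, y) * c x y) \<le> (\<Sum>x\<in>S. \<Sum>y\<in>S. \<rho> (x, y) * c x y)"
    by blast
  show thesis
  proof (rule that[of "\<lambda>x y. \<pi> (x, y)"])
    fix x y assume "x \<in> S" "y \<in> S"
    hence "\<pi> (x, y) \<in> {0..1}"
      using \<pi> by (metis (mono_tags, lifting) SigmaI mem_Collect_eq)
    thus "0 \<le> \<pi> (x, y)" by simp
  next
    fix \<rho> :: "'a \<Rightarrow> 'a \<Rightarrow> real"
    assume "\<And>x y. x \<in> S \<Longrightarrow> y \<in> S \<Longrightarrow> 0 \<le> \<rho> x y"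
       "\<And>x. x \<in> S \<Longrightarrow> (\<Sum>y\<in>S. \<rho> x y) = p x" "\<And>y. y \<in> S \<Longrightarrow> (\<Sum>x\<in>S. \<rho> x y) = q y"
    from bspec[OF min mem[OF this]]
    show "(\<Sum>x\<in>S. \<Sum>y\<in>S. \<pi> (x, y) * c x y) \<le> (\<Sum>x\<in>S. \<Sum>y\<in>S. \<rho> x y * c x y)"
      by simp
  qed (use \<pi> in auto)
qed


text \<open>The potential of a point \<open>u\<close> is the least cost of a perturbation of the optimal plan that
  moves a unit of mass from the row of a reference point to the row of \<open>u\<close>. Only entries in
  the support of the plan may decrease.\<close>

theorem finite_kantorovich_duality:
  fixes S :: "'a set" and p q :: "'a \<Rightarrow> real" and \<delta> :: "'a \<Rightarrow> 'a \<Rightarrow> real"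
  assumes fin: "finite S"
    and p: "\<And>x. x \<in> S \<Longrightarrow> 0 \<le> p x" "sum p S = 1" and q: "\<And>x. x \<in> S \<Longrightarrow> 0 \<le> q x" "sum q S = 1"
    and \<delta>0: "\<And>x. x \<in> S \<Longrightarrow> \<delta> x x = 0"
    and \<delta>sym: "\<And>x y. x \<in> S \<Longrightarrow> y \<in> S \<Longrightarrow> \<delta> x y = \<delta> y x"
    and tri: "\<And>x y z. x \<in> S \<Longrightarrow> y \<in> S \<Longrightarrow> z \<in> S \<Longrightarrow> \<delta> x z \<le> \<delta> x y + \<delta> y z"
  obtains \<pi> f where "\<And>x y. x \<in> S \<Longrightarrow> y \<in> S \<Longrightarrow> 0 \<le> \<pi> x y"
    "\<And>x. x \<in> S \<Longrightarrow> (\<Sum>y\<in>S. \<pi> x y) = p x" "\<And>y. y \<in> S \<Longrightarrow> (\<Sum>x\<in>S. \<pi> x y) = q y"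
    "\<And>x y. x \<in> S \<Longrightarrow> y \<in> S \<Longrightarrow> \<bar>f x - f y\<bar> \<le> \<delta> x y"
    "(\<Sum>x\<in>S. \<Sum>y\<in>S. \<pi> x y * \<delta> x y) = (\<Sum>x\<in>S. f x * (p x - q x))"
proof -
  obtain \<pi> where \<pi>0: "\<And>x y. x \<in> S \<Longrightarrow> y \<in> S \<Longrightarrow> 0 \<le> \<pi> x y"
    and row: "\<And>x. x \<in> S \<Longrightarrow> (\<Sum>y\<in>S. \<pi> x y) = p x"
    and col: "\<And>y. y \<in> S \<Longrightarrow> (\<Sum>x\<in>S. \<pi> x y) = q y"
    and min: "\<And>\<rho>. (\<And>x y. x \<in> S \<Longrightarrow> y \<in> S \<Longrightarrow> 0 \<le> \<rho> x y) \<Longrightarrow>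
       (\<And>x. x \<in> S \<Longrightarrow> (\<Sum>y\<in>S. \<rho> x y) = p x) \<Longrightarrow> (\<And>y. y \<in> S \<Longrightarrow> (\<Sum>x\<in>S. \<rho> x y) = q y) \<Longrightarrow>
       (\<Sum>x\<in>S. \<Sum>y\<in>S. \<pi> x y * \<delta> x y) \<le> (\<Sum>x\<in>S. \<Sum>y\<in>S. \<rho> x y * \<delta> x y)"
    using optimal_transport_exists[OF fin p q, where c = \<delta>] by blast
  define cost where "cost \<theta> = (\<Sum>x\<in>S. \<Sum>y\<in>S. \<theta> x y * \<delta> x y)" for \<theta> :: "'a \<Rightarrow> 'a \<Rightarrow> real"
  \<comment> \<open>The reference row gets positive mass, so that a row of mass zero, which
    \<open>shift\<close> treats separately, is never the reference row.\<close>
  have "\<exists>v0\<in>S. 0 < p v0"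
  proof (rule ccontr)
    assume "\<not> ?thesis"
    hence "sum p S = 0" using p(1) by (intro sum.neutral) force
    thus False using p(2) by simp
  qed
  then obtain v0 where v0: "v0 \<in> S" "0 < p v0" by blast
  define R where "R u \<theta> \<longleftrightarrow> (\<forall>x\<in>S. \<forall>y\<in>S. \<pi> x y = 0 \<longrightarrow> 0 \<le> \<theta> x y) \<and>
      (\<forall>y\<in>S. (\<Sum>x\<in>S. \<theta> x y) = 0) \<and>
      (\<forall>x\<in>S. (\<Sum>y\<in>S. \<theta> x y) = of_bool (x = u) - of_bool (x = v0))"
    for u :: 'a and \<theta> :: "'a \<Rightarrow> 'a \<Rightarrow> real"
  have supp: "\<exists>y\<in>S. 0 < \<pi> x y" if "x \<in> S" "0 < p x" for x
  proof (rule ccontr)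
    assume "\<not> ?thesis"
    hence "(\<Sum>y\<in>S. \<pi> x y) = 0" using \<pi>0 that by (intro sum.neutral) force
    thus False using row that by simp
  qed
  \<comment> \<open>Raising the entry \<open>(u', y)\<close> and lowering \<open>(u, y)\<close> by
    one keeps the column sums. Lowering is allowed because \<open>\<pi> u y\<close> is
    positive.\<close>
  have move: "R u' (\<lambda>a b. \<theta> a b + of_bool (a = u' \<and> b = y) - of_bool (a = u \<and> b = y))"
    and cost_move: "cost (\<lambda>a b. \<theta> a b + of_bool (a = u' \<and> b = y) - of_bool (a = u \<and> b = y)) =
       cost \<theta> + \<delta> u' y - \<delta> u y"
    if R: "R u \<theta>" and u: "u \<in> S" "u' \<in> S" "y \<in> S" "0 < \<pi> u y" for u u' y \<theta>
  proof -
    have s1: "(\<Sum>b\<in>S. of_bool (a = w \<and> b = y) * g b) = of_bool (a = w) * g y" for a w and g :: "'a \<Rightarrow> real"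
      using fin u(3) by (simp add: of_bool_def if_distrib[of "\<lambda>t. t * _"] sum.delta cong: if_cong conj_cong)
    have s2: "(\<Sum>a\<in>S. of_bool (a = w \<and> b = y) :: real) = of_bool (b = y)" if "w \<in> S" for b w
      using fin that by (simp add: of_bool_def sum.delta cong: if_cong conj_cong)
    have s3: "(\<Sum>a\<in>S. of_bool (a = w) * g a) = g w" if "w \<in> S" for w and g :: "'a \<Rightarrow> real"
      using fin that by (simp add: of_bool_def if_distrib[of "\<lambda>t. t * _"] sum.delta cong: if_cong)
    show "R u' (\<lambda>a b. \<theta> a b + of_bool (a = u' \<and> b = y) - of_bool (a = u \<and> b = y))"
      using R u s1[of _ _ "\<lambda>_. 1"] s2 s3[of y "\<lambda>_. 1"]
      unfolding R_def by (auto simp: sum.distrib sum_subtractf)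
    show "cost (\<lambda>a b. \<theta> a b + of_bool (a = u' \<and> b = y) - of_bool (a = u \<and> b = y)) =
       cost \<theta> + \<delta> u' y - \<delta> u y"
    proof -
      have "(\<Sum>a\<in>S. \<Sum>b\<in>S. of_bool (a = w \<and> b = y) * \<delta> a b) = \<delta> w y" if "w \<in> S" for w
        by (simp only: s1 s3[OF that])
      thus ?thesis
        using u unfolding cost_def by (simp add: ring_distribs sum.distrib sum_subtractf)
    qed
  qed
  have shift: "\<exists>\<theta>'. R u' \<theta>' \<and> cost \<theta>' \<le> cost \<theta> + \<delta> u u'"
    if R: "R u \<theta>" and u: "u \<in> S" "u' \<in> S" for u u' \<theta>
  proof (cases "0 < p u")
    case True
    with supp u obtain y where y: "y \<in> S" "0 < \<pi> u y" by blast
    have "\<delta> u' y - \<delta> u y \<le> \<delta> u u'"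
      using tri[of u' u y] \<delta>sym[of u u'] u y by simp
    thus ?thesis using move[OF R u y] cost_move[OF R u y] by fastforce
  next
    \<comment> \<open>A row without mass has no support entry to lower. But there
      \<open>\<theta> u\<close> is nonnegative with total 1, so the whole row is transferred to row
      \<open>u'\<close>, at a cost of at most \<open>\<delta> u u'\<close>.\<close>
    case False
    hence "p u = 0" using p(1) u by force
    hence z: "\<pi> u y = 0" if "y \<in> S" for y
      using row[OF u(1)] sum_nonneg_eq_0_iff[OF fin, of "\<pi> u"] \<pi>0[OF u(1)] that by auto
    have uv: "u \<noteq> v0" using False v0 by auto
    show ?thesis
    proof (cases "u' = u")
      case True thus ?thesis using R \<delta>0 u by auto
    next
      case neq: False
      let ?\<theta> = "\<lambda>a b. \<theta> a b + of_bool (a = u') * \<theta> u b - of_bool (a = u) * \<theta> u b"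
      have nn: "0 \<le> \<theta> u y" if "y \<in> S" for y using R z that u unfolding R_def by auto
      have s3: "(\<Sum>a\<in>S. of_bool (a = w) * g a) = g w" if "w \<in> S" for w and g :: "'a \<Rightarrow> real"
        using fin that by (simp add: of_bool_def if_distrib[of "\<lambda>t. t * _"] sum.delta cong: if_cong)
      have one: "(\<Sum>y\<in>S. \<theta> u y) = 1" using R u uv unfolding R_def by simp
      have "R u' ?\<theta>"
        unfolding R_def
      proof (intro conjI ballI impI)
        fix x y assume "x \<in> S" "y \<in> S" "\<pi> x y = 0"
        hence "0 \<le> \<theta> x y" using R unfolding R_def by auto
        thus "0 \<le> ?\<theta> x y" using nn[OF \<open>y \<in> S\<close>] by (cases "x = u") auto
      next
        fix y assume "y \<in> S"
        thus "(\<Sum>x\<in>S. ?\<theta> x y) = 0"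
          using R u s3[of _ "\<lambda>_. \<theta> u y"] unfolding R_def by (simp add: sum.distrib sum_subtractf)
      next
        fix x assume "x \<in> S"
        thus "(\<Sum>y\<in>S. ?\<theta> x y) = of_bool (x = u') - of_bool (x = v0)"
          using R one unfolding R_def
          by (auto simp: sum.distrib sum_subtractf simp flip: sum_distrib_left)
      qed
      moreover have "cost ?\<theta> \<le> cost \<theta> + \<delta> u u'"
      proof -
        have "cost ?\<theta> = cost \<theta> + ((\<Sum>a\<in>S. of_bool (a = u') * (\<Sum>b\<in>S. \<theta> u b * \<delta> a b))
            - (\<Sum>a\<in>S. of_bool (a = u) * (\<Sum>b\<in>S. \<theta> u b * \<delta> a b)))"
          unfolding cost_def by (simp add: algebra_simps sum.distrib sum_subtractf sum_distrib_left)
        also have "\<dots> = cost \<theta> + (\<Sum>b\<in>S. \<theta> u b * (\<delta> u' b - \<delta> u b))"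
          using u by (simp only: s3) (simp add: right_diff_distrib sum_subtractf)
        also have "(\<Sum>b\<in>S. \<theta> u b * (\<delta> u' b - \<delta> u b)) \<le> (\<Sum>b\<in>S. \<theta> u b * \<delta> u u')"
        proof (intro sum_mono mult_left_mono nn)
          fix b assume "b \<in> S"
          thus "\<delta> u' b - \<delta> u b \<le> \<delta> u u'" using tri[of u' u b] \<delta>sym[of u u'] u by simp
        qed
        finally show ?thesis using one by (simp flip: sum_distrib_right)
      qed
      ultimately show ?thesis by blast
    qed
  qed
  \<comment> \<open>A perturbation for \<open>v0\<close> itself keeps all row and column sums. For
    small \<open>\<epsilon>\<close> the sum of \<open>\<pi>\<close> and \<open>\<epsilon>\<close>
    times \<open>\<theta>\<close> is again a plan, so optimality forces a nonnegative cost.\<close>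
  have pos: "0 \<le> cost \<theta>" if R: "R v0 \<theta>" for \<theta>
  proof -
    define \<epsilon> where "\<epsilon> = Min (insert 1 ((\<lambda>z. \<pi> (fst z) (snd z) / (1 + \<bar>\<theta> (fst z) (snd z)\<bar>)) `
       {z \<in> S \<times> S. 0 < \<pi> (fst z) (snd z)}))"
    have \<epsilon>: "0 < \<epsilon>" unfolding \<epsilon>_def using fin by (subst Min_gr_iff) auto
    have "0 \<le> \<pi> x y + \<epsilon> * \<theta> x y" if xy: "x \<in> S" "y \<in> S" for x y
    proof (cases "\<pi> x y = 0")
      case True thus ?thesis using R xy \<epsilon> unfolding R_def by simp
    next
      case False
      hence \<pi>: "0 < \<pi> x y" using \<pi>0[OF xy] by simp
      hence "\<epsilon> \<le> \<pi> x y / (1 + \<bar>\<theta> x y\<bar>)"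
        unfolding \<epsilon>_def using fin xy by (intro Min_le) (auto intro!: image_eqI[of _ _ "(x, y)"])
      hence "\<epsilon> * (1 + \<bar>\<theta> x y\<bar>) \<le> \<pi> x y" by (simp add: pos_le_divide_eq add_pos_nonneg)
      moreover have "- (\<epsilon> * \<bar>\<theta> x y\<bar>) \<le> \<epsilon> * \<theta> x y"
        using \<epsilon> mult_left_mono[of "- \<bar>\<theta> x y\<bar>" "\<theta> x y" \<epsilon>] by simp
      ultimately show ?thesis using \<epsilon> by (simp add: distrib_left)
    qed
    hence "cost \<pi> \<le> cost (\<lambda>x y. \<pi> x y + \<epsilon> * \<theta> x y)"
      unfolding cost_def using R row col
      by (intro min) (auto simp: R_def sum.distrib simp flip: sum_distrib_left)
    also have "\<dots> = cost \<pi> + \<epsilon> * cost \<theta>"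
      unfolding cost_def by (simp add: algebra_simps sum.distrib sum_distrib_left)
    finally show ?thesis using \<epsilon> by (simp add: zero_le_mult_iff)
  qed
  define f where "f u = Inf (cost ` {\<theta>. R u \<theta>})" for u
  have ne: "\<exists>\<theta>. R u \<theta>" if "u \<in> S" for u
  proof -
    have "R v0 (\<lambda>_ _. 0)" unfolding R_def by auto
    from shift[OF this v0(1) that] show ?thesis by blast
  qed
  \<comment> \<open>The infimum is finite: leading a perturbation for \<open>u\<close> back to
    \<open>v0\<close> costs at most \<open>\<delta> u v0\<close>, and the result has nonnegative
    cost by \<open>pos\<close>.\<close>
  have bdd: "bdd_below (cost ` {\<theta>. R u \<theta>})" if u: "u \<in> S" for u
  proof (rule bdd_belowI2[where m = "- \<delta> u v0"])
    fix \<theta> assume "\<theta> \<in> {\<theta>. R u \<theta>}"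
    then obtain \<theta>' where "R v0 \<theta>'" "cost \<theta>' \<le> cost \<theta> + \<delta> u v0"
      using shift[of u \<theta> v0] u v0 by blast
    thus "- \<delta> u v0 \<le> cost \<theta>" using pos by fastforce
  qed
  have f_le: "f u' \<le> f u + c"
    if u: "u \<in> S" "u' \<in> S" and ex: "\<And>\<theta>. R u \<theta> \<Longrightarrow> \<exists>\<theta>'. R u' \<theta>' \<and> cost \<theta>' \<le> cost \<theta> + c" for u u' c
  proof -
    have "f u' - c \<le> f u"
      unfolding f_def[of u]
    proof (rule cINF_greatest)
      show "{\<theta>. R u \<theta>} \<noteq> {}" using ne u by blast
      fix \<theta> assume "\<theta> \<in> {\<theta>. R u \<theta>}"
      then obtain \<theta>' where "R u' \<theta>'" "cost \<theta>' \<le> cost \<theta> + c" using ex by blast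
      moreover from this have "f u' \<le> cost \<theta>'"
        unfolding f_def using bdd[OF u(2)] by (intro cINF_lower) auto
      ultimately show "f u' - c \<le> cost \<theta>" by simp
    qed
    thus ?thesis by simp
  qed
  have Lip: "f u' \<le> f u + \<delta> u u'" if u: "u \<in> S" "u' \<in> S" for u u'
    using f_le[OF u] shift u by blast
  \<comment> \<open>Complementary slackness: at a support entry \<open>(x, y)\<close>, moving mass
    to the diagonal entry \<open>(y, y)\<close> saves exactly \<open>\<delta> x y\<close>. Together
    with the Lipschitz bound this gives equality.\<close>
  have slack: "f x - f y = \<delta> x y" if "x \<in> S" "y \<in> S" "0 < \<pi> x y" for x y
  proof -
    have "f y \<le> f x + - \<delta> x y"
    proof (rule f_le)
      fix \<theta> assume R: "R x \<theta>"
      show "\<exists>\<theta>'. R y \<theta>' \<and> cost \<theta>' \<le> cost \<theta> + - \<delta> x y"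
        using move[OF R that(1,2,2,3)] cost_move[OF R that(1,2,2,3)] \<delta>0 that by auto
    qed (use that in auto)
    thus ?thesis using Lip[of y x] \<delta>sym[of x y] that by simp
  qed
  show thesis
  proof (rule that[OF \<pi>0 row col, where f = f])
    show "\<bar>f x - f y\<bar> \<le> \<delta> x y" if "x \<in> S" "y \<in> S" for x y
      using Lip[of x y] Lip[of y x] \<delta>sym[of x y] that by simp
    have "(\<Sum>x\<in>S. \<Sum>y\<in>S. \<pi> x y * \<delta> x y) = (\<Sum>x\<in>S. \<Sum>y\<in>S. \<pi> x y * (f x - f y))"
      by (intro sum.cong refl) (use slack \<pi>0 in \<open>force simp: less_le\<close>)
    also have "\<dots> = (\<Sum>x\<in>S. f x * (\<Sum>y\<in>S. \<pi> x y)) - (\<Sum>x\<in>S. \<Sum>y\<in>S. f y * \<pi> x y)"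
      by (simp add: algebra_simps sum_subtractf sum_distrib_left)
    also have "(\<Sum>x\<in>S. \<Sum>y\<in>S. f y * \<pi> x y) = (\<Sum>y\<in>S. f y * (\<Sum>x\<in>S. \<pi> x y))"
      by (subst sum.swap) (simp add: sum_distrib_left)
    finally show "(\<Sum>x\<in>S. \<Sum>y\<in>S. \<pi> x y * \<delta> x y) = (\<Sum>x\<in>S. f x * (p x - q x))"
      using row col by (simp add: algebra_simps sum_subtractf)
  qed
qed

section \<open>The plug-in estimator\<close>

text \<open>The graphical plug-in estimator, seen as a linear functional: node after node, the next
  coordinate is drawn from those sample points that agree with the coordinates drawn before on
  the parents.\<close>

definition matches :: "nat \<Rightarrow> (nat \<Rightarrow> nat \<Rightarrow> 'b) \<Rightarrow> nat set \<Rightarrow> (nat \<Rightarrow> 'b) \<Rightarrow> nat set" where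
  "matches n z P s = {i\<in>{..<n}. \<forall>l\<in>P. z i l = s l}"

primrec plugin :: "(nat \<times> nat) set \<Rightarrow> nat \<Rightarrow> (nat \<Rightarrow> nat \<Rightarrow> 'b) \<Rightarrow> nat \<Rightarrow> ((nat \<Rightarrow> 'b) \<Rightarrow> real) \<Rightarrow> real" where
  "plugin E n z 0 \<phi> = \<phi> (\<lambda>_. undefined)"
| "plugin E n z (Suc m) \<phi> = plugin E n z m (\<lambda>s.
     (\<Sum>i\<in>matches n z (parents E (Suc m)) s. \<phi> (s(Suc m := z i (Suc m))))
       / card (matches n z (parents E (Suc m)) s))"

text \<open>The states that the sampling procedure can reach. Elsewhere there may be no matching
  sample point, and the quotient in \<open>plugin\<close> degenerates to 0/0; comparisons of
  integrands are therefore required on this set only.\<close>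

primrec plugin_support :: "(nat \<times> nat) set \<Rightarrow> nat \<Rightarrow> (nat \<Rightarrow> nat \<Rightarrow> 'b) \<Rightarrow> nat \<Rightarrow> (nat \<Rightarrow> 'b) set" where
  "plugin_support E n z 0 = {\<lambda>_. undefined}"
| "plugin_support E n z (Suc m) =
     {s(Suc m := z i (Suc m)) | s i. s \<in> plugin_support E n z m \<and> i \<in> matches n z (parents E (Suc m)) s}"

lemma finite_matches [simp]: "finite (matches n z P s)"
  by (simp add: matches_def)

lemma matches_cong: "(\<And>l. l \<in> P \<Longrightarrow> s l = s' l) \<Longrightarrow> matches n z P s = matches n z P s'"
  by (auto simp: matches_def)

lemma plugin_mono:
  "(\<And>s. s \<in> plugin_support E n z m \<Longrightarrow> \<phi> s \<le> \<psi> s) \<Longrightarrow> plugin E n z m \<phi> \<le> plugin E n z m \<psi>"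
proof (induction m arbitrary: \<phi> \<psi>)
  case (Suc m)
  show ?case unfolding plugin.simps
    by (intro Suc.IH divide_right_mono sum_mono Suc.prems) (unfold plugin_support.simps, blast, simp)
qed simp

lemma plugin_cong:
  "(\<And>s. s \<in> plugin_support E n z m \<Longrightarrow> \<phi> s = \<psi> s) \<Longrightarrow> plugin E n z m \<phi> = plugin E n z m \<psi>"
  by (intro antisym plugin_mono) auto

lemma plugin_add: "plugin E n z m (\<lambda>s. \<phi> s + \<psi> s) = plugin E n z m \<phi> + plugin E n z m \<psi>"
  by (induction m arbitrary: \<phi> \<psi>) (simp_all add: sum.distrib add_divide_distrib)

lemma plugin_cmult: "plugin E n z m (\<lambda>s. c * \<phi> s) = c * plugin E n z m \<phi>"
proof (induction m arbitrary: \<phi>)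
  case (Suc m)
  show ?case unfolding plugin.simps by (subst Suc[symmetric]) (simp add: sum_distrib_left)
qed simp

lemma plugin_diff: "plugin E n z m (\<lambda>s. \<phi> s - \<psi> s) = plugin E n z m \<phi> - plugin E n z m \<psi>"
  using plugin_add[of E n z m \<phi> "\<lambda>s. (-1) * \<psi> s"] by (simp only: plugin_cmult) simp

lemma plugin_sum:
  "finite A \<Longrightarrow> plugin E n z m (\<lambda>s. \<Sum>a\<in>A. \<phi> a s) = (\<Sum>a\<in>A. plugin E n z m (\<phi> a))"
proof (induction rule: finite_induct)
  case empty
  show ?case using plugin_cmult[of E n z m 0] by simp
qed (simp add: plugin_add)

text \<open>A linear functional with finite support is a finite sum against point weights. These
  weights become the masses of the estimator.\<close>

lemma plugin_expand:
  assumes "finite S" "plugin_support E n z m \<subseteq> S"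
  shows "plugin E n z m \<phi> = (\<Sum>t\<in>S. \<phi> t * plugin E n z m (\<lambda>s. of_bool (s = t)))"
proof -
  have "plugin E n z m \<phi> = plugin E n z m (\<lambda>s. \<Sum>t\<in>S. \<phi> t * of_bool (s = t))"
  proof (rule plugin_cong)
    fix s assume "s \<in> plugin_support E n z m"
    hence "s \<in> S" using assms by blast
    have "(\<Sum>t\<in>S. \<phi> t * of_bool (s = t)) = (\<Sum>t\<in>S. if t = s then \<phi> t else 0)"
      by (rule sum.cong[OF refl]) simp
    also have "\<dots> = \<phi> s"
      using \<open>s \<in> S\<close> assms(1) by simp
    finally show "\<phi> s = (\<Sum>t\<in>S. \<phi> t * of_bool (s = t))" ..
  qed
  also have "\<dots> = (\<Sum>t\<in>S. plugin E n z m (\<lambda>s. \<phi> t * of_bool (s = t)))"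
    by (rule plugin_sum[OF assms(1)])
  finally show ?thesis by (simp add: plugin_cmult)
qed

lemma plugin_support_PiE:
  assumes "\<And>i k. i < n \<Longrightarrow> k \<in> {1..m} \<Longrightarrow> z i k \<in> G k"
  shows "plugin_support E n z m \<subseteq> PiE {1..m} G"
  using assms
proof (induction m)
  case (Suc m)
  have IH: "plugin_support E n z m \<subseteq> PiE {1..m} G"
    by (rule Suc.IH) (rule Suc.prems, simp_all)
  have *: "s(Suc m := z i (Suc m)) \<in> PiE {1..Suc m} G"
    if "s \<in> plugin_support E n z m" "i < n" for s i
  proof -
    have "s \<in> PiE {1..m} G" using IH that(1) by blast
    moreover have "z i (Suc m) \<in> G (Suc m)" using that(2) by (intro Suc.prems) auto
    ultimately show ?thesis
      using PiE_fun_upd[of "z i (Suc m)" G "Suc m" s "{1..m}"] by (simp add: atLeastAtMostSuc_conv)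
  qed
  show ?case
  proof
    fix t assume "t \<in> plugin_support E n z (Suc m)"
    then obtain s i where "t = s(Suc m := z i (Suc m))" "s \<in> plugin_support E n z m" "i < n"
      by (auto simp: matches_def)
    thus "t \<in> PiE {1..Suc m} G" using * by blast
  qed
qed auto

section \<open>Cliques of the graph and the sample points matching on them\<close>

lemma subset_atMost_pred: "C \<subseteq> {1..Suc m} \<Longrightarrow> Suc m \<notin> C \<Longrightarrow> C \<subseteq> {1..m}"
  by (simp add: atLeastAtMostSuc_conv subset_insert)

lemma sorted_dag_parents_subset: "sorted_dag K E \<Longrightarrow> parents E (Suc m) \<subseteq> {1..m}"
  by (fastforce simp: parents_def sorted_dag_def)

locale clique_dag =
  fixes K :: nat and E :: "(nat \<times> nat) set" and n :: nat and z :: "nat \<Rightarrow> nat \<Rightarrow> 'b"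
  assumes dag: "sorted_dag K E" and nc: "no_collider K E" and n: "0 < n"
begin

lemma parents_subset: "parents E (Suc m) \<subseteq> {1..m}"
  using dag by (rule sorted_dag_parents_subset)

lemma fully_connected_parents: "fully_connected E (parents E k)"
proof (cases "k \<in> {1..K}")
  case True thus ?thesis using nc by (auto simp: no_collider_def)
next
  case False
  hence "parents E k = {}" using dag by (fastforce simp: parents_def sorted_dag_def)
  thus ?thesis by (simp add: fully_connected_def)
qed

lemma clique_minus_subset_parents:
  assumes "fully_connected E C" "C \<subseteq> {1..Suc m}" "Suc m \<in> C"
  shows "C - {Suc m} \<subseteq> parents E (Suc m)"
  using assms by (fastforce simp: fully_connected_def parents_def)

text \<open>If the clique contains the last node, its other members are parents of that node, so the
  sample point that supplied the last coordinate agrees with the state on the whole clique.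
  Otherwise the last draw is irrelevant and induction applies. Applied to parent sets, this ensures
  that no draw divides by zero.\<close>

lemma support_matches_nonempty:
  assumes "fully_connected E C" "C \<subseteq> {1..m}" "s \<in> plugin_support E n z m"
  shows "matches n z C s \<noteq> {}"
  using assms
proof (induction m arbitrary: C s)
  case 0
  thus ?case using n by (auto simp: matches_def)
next
  case (Suc m)
  then obtain t i where s: "s = t(Suc m := z i (Suc m))" and t: "t \<in> plugin_support E n z m"
    and i: "i \<in> matches n z (parents E (Suc m)) t" by auto
  show ?case
  proof (cases "Suc m \<in> C")
    case True
    hence "C - {Suc m} \<subseteq> parents E (Suc m)" using clique_minus_subset_parents Suc.prems by blast
    hence "i \<in> matches n z C s" using i unfolding matches_def s by auto
    thus ?thesis by blast
  next
    case False
    hence "C \<subseteq> {1..m}" using Suc.prems(2) by (auto simp: le_Suc_eq)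
    moreover have "matches n z C s = matches n z C t"
      using False by (intro matches_cong) (auto simp: s)
    ultimately show ?thesis using Suc.IH[of C t] Suc.prems t by simp
  qed
qed

lemma parents_matches_nonempty:
  "s \<in> plugin_support E n z m \<Longrightarrow> matches n z (parents E (Suc m)) s \<noteq> {}"
  by (rule support_matches_nonempty[OF fully_connected_parents parents_subset])

text \<open>On fully connected sets of nodes, the plug-in estimator has the marginals of the empirical
  measure. This is where the absence of colliders enters.\<close>

lemma plugin_clique:
  assumes "fully_connected E C" "C \<subseteq> {1..m}"
    and "\<And>s s'. (\<And>l. l \<in> C \<Longrightarrow> s l = s' l) \<Longrightarrow> \<phi> s = \<phi> s'"
  shows "plugin E n z m \<phi> = (\<Sum>i<n. \<phi> (z i)) / n"
  using assms
proof (induction m arbitrary: C \<phi>)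
  case 0
  have "\<phi> (z i) = \<phi> (\<lambda>_. undefined)" for i by (rule 0(3)) (use 0 in auto)
  thus ?case using n by simp
next
  case (Suc m)
  let ?P = "parents E (Suc m)"
  let ?M = "matches n z ?P"
  let ?\<psi> = "\<lambda>s. (\<Sum>i\<in>?M s. \<phi> (s(Suc m := z i (Suc m)))) / card (?M s)"
  show ?case
  proof (cases "Suc m \<in> C")
    case False
    have "plugin E n z (Suc m) \<phi> = plugin E n z m \<phi>"
      unfolding plugin.simps
    proof (rule plugin_cong)
      fix s assume s: "s \<in> plugin_support E n z m"
      have "\<phi> (s(Suc m := y)) = \<phi> s" for y by (rule Suc.prems(3)) (use False in auto)
      moreover have "card (?M s) \<noteq> 0" using parents_matches_nonempty[OF s] by simp
      ultimately show "?\<psi> s = \<phi> s" by simp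
    qed
    also have "\<dots> = (\<Sum>i<n. \<phi> (z i)) / n"
    proof (rule Suc.IH)
      show "fully_connected E C" by fact
      show "C \<subseteq> {1..m}" by (rule subset_atMost_pred[OF Suc.prems(2) False])
      show "\<phi> s = \<phi> s'" if "\<And>l. l \<in> C \<Longrightarrow> s l = s' l" for s s' by (rule Suc.prems(3)) (rule that)
    qed
    finally show ?thesis .
  next
    case True
    have C: "l = Suc m \<or> l \<in> ?P" if "l \<in> C" for l
      using clique_minus_subset_parents[OF Suc.prems(1,2) True] that by auto
    have "plugin E n z (Suc m) \<phi> = plugin E n z m ?\<psi>" by simp
    \<comment> \<open>The averaged function depends on the parents of the last node only. These form
      a clique of earlier nodes, so the induction hypothesis applies to it.\<close>
    also have "\<dots> = (\<Sum>i<n. ?\<psi> (z i)) / n"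
    proof (rule Suc.IH[OF fully_connected_parents parents_subset])
      fix s s' :: "nat \<Rightarrow> 'b" assume eq: "\<And>l. l \<in> ?P \<Longrightarrow> s l = s' l"
      have "\<phi> (s(Suc m := y)) = \<phi> (s'(Suc m := y))" for y
        by (rule Suc.prems(3)) (use C eq in auto)
      thus "?\<psi> s = ?\<psi> s'" using matches_cong[of ?P s s' n z] eq by simp
    qed
    also have "(\<Sum>i<n. ?\<psi> (z i)) = (\<Sum>i<n. \<Sum>i'<n. of_bool (i' \<in> ?M (z i)) * \<phi> (z i') / card (?M (z i)))"
    proof (rule sum.cong[OF refl])
      fix i
      have eq: "\<phi> ((z i)(Suc m := z i' (Suc m))) = \<phi> (z i')" if "i' \<in> ?M (z i)" for i'
      proof (rule Suc.prems(3))
        fix l assume "l \<in> C"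
        from C[OF this] that show "((z i)(Suc m := z i' (Suc m))) l = z i' l" by (auto simp: matches_def)
      qed
      have "(\<Sum>i'\<in>?M (z i). \<phi> ((z i)(Suc m := z i' (Suc m)))) = (\<Sum>i'\<in>?M (z i). \<phi> (z i'))"
        by (rule sum.cong[OF refl]) (rule eq)
      also have "(\<Sum>i'\<in>?M (z i). \<phi> (z i')) = (\<Sum>i'<n. of_bool (i' \<in> ?M (z i)) * \<phi> (z i'))"
        by (rule sum.mono_neutral_cong_left) (auto simp: matches_def)
      finally show "?\<psi> (z i) = (\<Sum>i'<n. of_bool (i' \<in> ?M (z i)) * \<phi> (z i') / card (?M (z i)))"
        by (simp only: sum_divide_distrib)
    qed
    \<comment> \<open>Matching on the parents is an equivalence relation. After the exchange of
      sums, \<open>z i'\<close> is counted once for each member of its class, every time with the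
      inverse class size.\<close>
    also have "\<dots> = (\<Sum>i'<n. \<Sum>i<n. of_bool (i' \<in> ?M (z i)) * \<phi> (z i') / card (?M (z i)))"
      by (rule sum.swap)
    also have "\<dots> = (\<Sum>i'<n. \<phi> (z i'))"
    proof (rule sum.cong[OF refl])
      fix i' assume i': "i' \<in> {..<n}"
      have "(\<Sum>i<n. of_bool (i' \<in> ?M (z i)) * \<phi> (z i') / card (?M (z i)))
          = (\<Sum>i\<in>?M (z i'). \<phi> (z i') / card (?M (z i')))"
      proof (intro sum.mono_neutral_cong_right ballI)
        fix i assume "i \<in> ?M (z i')"
        moreover from this have "?M (z i) = ?M (z i')" by (intro matches_cong) (auto simp: matches_def)
        ultimately show "of_bool (i' \<in> ?M (z i)) * \<phi> (z i') / card (?M (z i)) = \<phi> (z i') / card (?M (z i'))"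
          using i' by (simp add: matches_def)
      qed (auto simp: matches_def)
      also have "card (?M (z i')) \<noteq> 0" using i' by (auto simp: matches_def)
      hence "(\<Sum>i\<in>?M (z i'). \<phi> (z i') / card (?M (z i'))) = \<phi> (z i')" by simp
      finally show "(\<Sum>i<n. of_bool (i' \<in> ?M (z i)) * \<phi> (z i') / card (?M (z i))) = \<phi> (z i')" .
    qed
    finally show ?thesis .
  qed
qed

end

section \<open>The cubes and their dyadic grids\<close>

lemma space_cube: "space (cube m) = PiE {..<m} (\<lambda>_. {0..1})"
  by (simp add: cube_def space_PiM)

lemma space_state_space: "space (state_space d I) = PiE I (\<lambda>i. space (cube (d i)))"
  by (simp add: state_space_def space_PiM)

lemma measurable_cube_component [measurable]:
  "j < m \<Longrightarrow> (\<lambda>x. x j) \<in> borel_measurable (cube m)"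
  unfolding cube_def
  by (rule measurable_restrict_space2_iff[THEN iffD1, THEN conjunct1, of _ _ _ "{0..1}"])
     (rule measurable_component_singleton, simp)

lemma measurable_state_component [measurable]:
  "i \<in> I \<Longrightarrow> (\<lambda>x. x i) \<in> state_space d I \<rightarrow>\<^sub>M cube (d i)"
  unfolding state_space_def by (rule measurable_component_singleton)

lemma measurable_state_restrict [measurable]:
  "J \<subseteq> I \<Longrightarrow> (\<lambda>x. restrict x J) \<in> state_space d I \<rightarrow>\<^sub>M state_space d J"
  unfolding state_space_def by (rule measurable_restrict_subset)

lemma cube_dist_le_iff: "0 \<le> c \<Longrightarrow> cube_dist m x y \<le> c \<longleftrightarrow> (\<forall>j<m. \<bar>x j - y j\<bar> \<le> c)"
  by (auto simp: cube_dist_def)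

lemma cube_dist_nonneg [simp]: "0 \<le> cube_dist m x y"
  by (simp add: cube_dist_def)

lemma abs_diff_le_cube_dist: "j < m \<Longrightarrow> \<bar>x j - y j\<bar> \<le> cube_dist m x y"
  using cube_dist_le_iff[of "cube_dist m x y" m x y] by simp

lemma cube_dist_self [simp]: "cube_dist m x x = 0"
  by (rule antisym) (simp_all add: cube_dist_le_iff)

lemma cube_dist_commute: "cube_dist m x y = cube_dist m y x"
  by (simp add: cube_dist_def abs_minus_commute)

lemma cube_dist_triangle: "cube_dist m x z \<le> cube_dist m x y + cube_dist m y z"
proof (subst cube_dist_le_iff, simp, intro allI impI)
  fix j assume "j < m"
  from abs_diff_le_cube_dist[OF this, of x y] abs_diff_le_cube_dist[OF this, of y z]
  show "\<bar>x j - z j\<bar> \<le> cube_dist m x y + cube_dist m y z" by linarith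
qed

lemma cube_component_bounds: "x \<in> space (cube m) \<Longrightarrow> j < m \<Longrightarrow> 0 \<le> x j \<and> x j \<le> 1"
  by (drule PiE_mem[of x "{..<m}" "\<lambda>_. {0..1}" j, folded space_cube]) simp_all

lemma cube_dist_le_1:
  assumes "x \<in> space (cube m)" "y \<in> space (cube m)" shows "cube_dist m x y \<le> 1"
proof (subst cube_dist_le_iff, simp, intro allI impI)
  fix j assume "j < m"
  from cube_component_bounds[OF assms(1) this] cube_component_bounds[OF assms(2) this]
  show "\<bar>x j - y j\<bar> \<le> 1" by linarith
qed

lemma measurable_cube_dist:
  assumes f: "f \<in> N \<rightarrow>\<^sub>M cube m" and g: "g \<in> N \<rightarrow>\<^sub>M cube m"
  shows "(\<lambda>x. cube_dist m (f x) (g x)) \<in> borel_measurable N"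
proof (rule borel_measurable_iff_le[THEN iffD2], rule allI)
  fix a :: real
  show "{x \<in> space N. cube_dist m (f x) (g x) \<le> a} \<in> sets N"
  proof (cases "0 \<le> a")
    case True
    have [measurable]: "(\<lambda>x. f x j) \<in> borel_measurable N" "(\<lambda>x. g x j) \<in> borel_measurable N" if "j < m" for j
      using measurable_compose[OF f measurable_cube_component[OF that]]
        measurable_compose[OF g measurable_cube_component[OF that]] .
    have "{x \<in> space N. \<forall>j\<in>{..<m}. \<bar>f x j - g x j\<bar> \<le> a} \<in> sets N"
      by measurable
    thus ?thesis using True by (simp add: cube_dist_le_iff)
  next
    case False
    hence "\<not> cube_dist m (f x) (g x) \<le> a" for x using cube_dist_nonneg[of m "f x" "g x"] by linarith
    thus ?thesis by simp
  qed
qed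

lemma state_dist_le_iff:
  "finite I \<Longrightarrow> 0 \<le> c \<Longrightarrow> state_dist d I x y \<le> c \<longleftrightarrow> (\<forall>i\<in>I. cube_dist (d i) (x i) (y i) \<le> c)"
  by (auto simp: state_dist_def)

lemma state_dist_nonneg [simp]: "finite I \<Longrightarrow> 0 \<le> state_dist d I x y"
  by (simp add: state_dist_def)

lemma cube_dist_le_state_dist:
  "finite I \<Longrightarrow> i \<in> I \<Longrightarrow> cube_dist (d i) (x i) (y i) \<le> state_dist d I x y"
  using state_dist_le_iff[of I "state_dist d I x y" d x y] by simp

lemma state_dist_self [simp]: "finite I \<Longrightarrow> state_dist d I x x = 0"
  by (rule antisym) (simp_all add: state_dist_le_iff)

lemma state_dist_commute: "state_dist d I x y = state_dist d I y x"
  unfolding state_dist_def by (simp add: cube_dist_commute)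

lemma state_dist_triangle:
  assumes "finite I" shows "state_dist d I x z \<le> state_dist d I x y + state_dist d I y z"
proof (subst state_dist_le_iff, use assms in simp_all, rule ballI)
  fix i assume "i \<in> I"
  from cube_dist_triangle[of "d i" "x i" "z i" "y i"] cube_dist_le_state_dist[OF assms this, of d x y]
    cube_dist_le_state_dist[OF assms this, of d y z]
  show "cube_dist (d i) (x i) (z i) \<le> state_dist d I x y + state_dist d I y z" by linarith
qed

lemma state_dist_le_1:
  assumes "finite I" "x \<in> space (state_space d I)" "y \<in> space (state_space d I)"
  shows "state_dist d I x y \<le> 1"
  using assms
  by (subst state_dist_le_iff) (simp_all add: space_state_space, blast intro: cube_dist_le_1 PiE_mem)

lemma state_dist_mono:
  assumes "finite I" "J \<subseteq> I" shows "state_dist d J (restrict x J) (restrict y J) \<le> state_dist d I x y"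
  using assms by (subst state_dist_le_iff)
    (auto simp: finite_subset subset_iff intro!: cube_dist_le_state_dist)

lemma state_dist_insert_le:
  assumes "finite I" "state_dist d I x x' \<le> c" "cube_dist (d k) y y' \<le> c" "k \<notin> I"
  shows "state_dist d (insert k I) (x(k := y)) (x'(k := y')) \<le> c"
proof -
  have "0 \<le> c" using assms(3) cube_dist_nonneg order_trans by blast
  thus ?thesis using assms by (auto simp: state_dist_le_iff)
qed

lemma measurable_state_dist:
  assumes fin: "finite I" and f: "f \<in> N \<rightarrow>\<^sub>M state_space d I" and g: "g \<in> N \<rightarrow>\<^sub>M state_space d I"
  shows "(\<lambda>x. state_dist d I (f x) (g x)) \<in> borel_measurable N"
proof (rule borel_measurable_iff_le[THEN iffD2], rule allI)
  fix a :: real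
  show "{x \<in> space N. state_dist d I (f x) (g x) \<le> a} \<in> sets N"
  proof (cases "0 \<le> a")
    case True
    have [measurable]: "(\<lambda>x. cube_dist (d i) (f x i) (g x i)) \<in> borel_measurable N" if "i \<in> I" for i
      using measurable_compose[OF f measurable_state_component[OF that]]
        measurable_compose[OF g measurable_state_component[OF that]] by (rule measurable_cube_dist)
    have "{x \<in> space N. \<forall>i\<in>I. cube_dist (d i) (f x i) (g x i) \<le> a} \<in> sets N"
      using fin by (intro sets.sets_Collect_finite_All borel_measurable_le) auto
    thus ?thesis using True fin by (simp add: state_dist_le_iff)
  next
    case False
    hence "\<not> state_dist d I (f x) (g x) \<le> a" for x
      using state_dist_nonneg[OF fin, of d "f x" "g x"] by linarith
    thus ?thesis by simp
  qed
qed

section \<open>Dyadic rounding and its grids\<close>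

definition cube_quant :: "nat \<Rightarrow> nat \<Rightarrow> (nat \<Rightarrow> real) \<Rightarrow> nat \<Rightarrow> real" where
  "cube_quant m j x = (\<lambda>i\<in>{..<m}. of_int \<lfloor>2 ^ j * x i\<rfloor> / 2 ^ j)"

text \<open>Rounding down leaves the endpoint 1 fixed, so the index runs up to \<open>2 ^ j\<close>
  inclusive. An axis thus carries \<open>2 ^ j + 1\<close> points, which is why the cardinality
  bounds below have \<open>Suc j\<close> in the exponent.\<close>

definition cube_grid :: "nat \<Rightarrow> nat \<Rightarrow> (nat \<Rightarrow> real) set" where
  "cube_grid m j = PiE {..<m} (\<lambda>_. (\<lambda>i. real i / 2 ^ j) ` {..2 ^ j})"

definition state_quant :: "(nat \<Rightarrow> nat) \<Rightarrow> nat set \<Rightarrow> nat \<Rightarrow> (nat \<Rightarrow> nat \<Rightarrow> real) \<Rightarrow> nat \<Rightarrow> nat \<Rightarrow> real" where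
  "state_quant d I j x = (\<lambda>i\<in>I. cube_quant (d i) j (x i))"

definition state_grid :: "(nat \<Rightarrow> nat) \<Rightarrow> nat set \<Rightarrow> nat \<Rightarrow> (nat \<Rightarrow> nat \<Rightarrow> real) set" where
  "state_grid d I j = PiE I (\<lambda>i. cube_grid (d i) j)"

lemma finite_cube_grid [simp]: "finite (cube_grid m j)"
  unfolding cube_grid_def by (intro finite_PiE) auto

lemma finite_state_grid [simp]: "finite I \<Longrightarrow> finite (state_grid d I j)"
  unfolding state_grid_def by (intro finite_PiE) auto

lemma card_cube_grid: "card (cube_grid m j) \<le> 2 ^ (Suc j * m)"
proof -
  have "card ((\<lambda>i. real i / 2 ^ j) ` {..2 ^ j::nat}) \<le> 2 ^ j + 1"
    using card_image_le[of "{..2 ^ j::nat}" "\<lambda>i. real i / 2 ^ j"] by simp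
  also have "\<dots> \<le> 2 ^ Suc j" by simp
  finally have "card ((\<lambda>i. real i / 2 ^ j) ` {..2 ^ j::nat}) ^ m \<le> (2 ^ Suc j) ^ m"
    by (intro power_mono) auto
  hence "card (cube_grid m j) \<le> (2 ^ Suc j) ^ m"
    unfolding cube_grid_def by (simp add: card_PiE)
  thus ?thesis by (simp only: power_mult)
qed

lemma card_state_grid:
  assumes "finite I" shows "card (state_grid d I j) \<le> 2 ^ (Suc j * (\<Sum>i\<in>I. d i))"
proof -
  have "card (state_grid d I j) \<le> (\<Prod>i\<in>I. 2 ^ (Suc j * d i))"
    unfolding state_grid_def using assms card_cube_grid by (auto simp: card_PiE intro!: prod_mono)
  also have "\<dots> = 2 ^ (Suc j * (\<Sum>i\<in>I. d i))"
    by (simp only: power_sum sum_distrib_left)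
  finally show ?thesis .
qed

lemma cube_grid_subset: "cube_grid m j \<subseteq> space (cube m)"
  unfolding cube_grid_def space_cube by (intro PiE_mono) (auto simp: field_simps simp flip: of_nat_power)

lemma state_grid_subset: "state_grid d I j \<subseteq> space (state_space d I)"
  unfolding state_grid_def space_state_space by (intro PiE_mono cube_grid_subset)

lemma cube_quant_in_grid: "x \<in> space (cube m) \<Longrightarrow> cube_quant m j x \<in> cube_grid m j"
  unfolding cube_grid_def cube_quant_def
proof (rule restrict_PiE_iff[THEN iffD2], rule ballI)
  fix i assume x: "x \<in> space (cube m)" and i: "i \<in> {..<m}"
  have x01: "0 \<le> x i" "x i \<le> 1" using cube_component_bounds[OF x, of i] i by simp_all
  have "2 ^ j * x i \<le> 2 ^ j" using x01 by simp
  hence "\<lfloor>2 ^ j * x i\<rfloor> \<le> \<lfloor>2 ^ j :: real\<rfloor>" by (rule floor_mono)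
  also have "\<lfloor>2 ^ j :: real\<rfloor> = 2 ^ j" by (metis floor_of_int of_int_numeral of_int_power)
  finally have "nat \<lfloor>2 ^ j * x i\<rfloor> \<le> 2 ^ j" by (simp add: nat_le_iff)
  moreover have "real_of_int \<lfloor>2 ^ j * x i\<rfloor> = real (nat \<lfloor>2 ^ j * x i\<rfloor>)" using x01 by simp
  ultimately show "real_of_int \<lfloor>2 ^ j * x i\<rfloor> / 2 ^ j \<in> (\<lambda>i. real i / 2 ^ j) ` {..2 ^ j}"
    by (metis atMost_iff image_eqI)
qed

lemma state_quant_in_grid: "x \<in> space (state_space d I) \<Longrightarrow> state_quant d I j x \<in> state_grid d I j"
  unfolding state_grid_def state_quant_def by (auto simp: space_state_space intro!: cube_quant_in_grid)

lemma cube_dist_quant: "cube_dist m (cube_quant m j x) x \<le> 1 / 2 ^ j"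
proof (subst cube_dist_le_iff, simp, intro allI impI)
  fix i assume i: "i < m"
  have "real_of_int \<lfloor>2 ^ j * x i\<rfloor> \<le> 2 ^ j * x i" "2 ^ j * x i < real_of_int \<lfloor>2 ^ j * x i\<rfloor> + 1"
    by linarith+
  hence "of_int \<lfloor>2 ^ j * x i\<rfloor> / 2 ^ j \<le> x i" "x i \<le> of_int \<lfloor>2 ^ j * x i\<rfloor> / 2 ^ j + 1 / 2 ^ j"
    by (simp_all add: field_simps)
  thus "\<bar>cube_quant m j x i - x i\<bar> \<le> 1 / 2 ^ j" using i by (simp add: cube_quant_def)
qed

lemma state_dist_quant: "finite I \<Longrightarrow> state_dist d I (state_quant d I j x) x \<le> 1 / 2 ^ j"
  by (simp add: state_dist_le_iff state_quant_def cube_dist_quant)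

text \<open>Dyadic cells are nested: halving the floor of \<open>2 * a\<close> and taking the floor
  again gives the floor of \<open>a\<close>. In \<open>chaining\<close> this lets the coarser value
  be read off from the finer cell.\<close>

lemma cube_quant_quant: "cube_quant m j (cube_quant m (Suc j) x) = cube_quant m j x"
proof -
  have "\<lfloor>2 ^ j * (real_of_int \<lfloor>2 ^ Suc j * t\<rfloor> / 2 ^ Suc j)\<rfloor> = \<lfloor>2 ^ j * t\<rfloor>" for t :: real
  proof -
    have "\<lfloor>2 ^ j * (real_of_int \<lfloor>2 ^ Suc j * t\<rfloor> / 2 ^ Suc j)\<rfloor> = \<lfloor>real_of_int \<lfloor>2 * (2 ^ j * t)\<rfloor> / 2\<rfloor>"
      by (simp add: mult.assoc)
    also have "\<lfloor>real_of_int \<lfloor>2 * a\<rfloor> / 2\<rfloor> = \<lfloor>a\<rfloor>" for a :: real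
    proof (rule floor_unique)
      have "2 * \<lfloor>a\<rfloor> \<le> \<lfloor>2 * a\<rfloor>" by linarith
      thus "real_of_int \<lfloor>a\<rfloor> \<le> real_of_int \<lfloor>2 * a\<rfloor> / 2" by linarith
      show "real_of_int \<lfloor>2 * a\<rfloor> / 2 < real_of_int \<lfloor>a\<rfloor> + 1" by linarith
    qed
    finally show ?thesis .
  qed
  thus ?thesis unfolding cube_quant_def by (auto simp: restrict_def fun_eq_iff)
qed

lemma restrict_eq_iff: "b \<in> extensional A \<Longrightarrow> restrict f A = b \<longleftrightarrow> (\<forall>i\<in>A. f i = b i)"
  by (auto simp: fun_eq_iff restrict_def extensional_def)

lemma cube_quant_eq_iff:
  "b \<in> cube_grid m j \<Longrightarrow> cube_quant m j x = b \<longleftrightarrow> (\<forall>i\<in>{..<m}. of_int \<lfloor>2 ^ j * x i\<rfloor> / 2 ^ j = b i)"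
  unfolding cube_quant_def cube_grid_def by (intro restrict_eq_iff) (simp add: PiE_def)

lemma state_quant_eq_iff:
  "b \<in> state_grid d I j \<Longrightarrow> state_quant d I j x = b \<longleftrightarrow> (\<forall>i\<in>I. cube_quant (d i) j (x i) = b i)"
  unfolding state_quant_def state_grid_def by (intro restrict_eq_iff) (simp add: PiE_def)

lemma measurable_cube_quant [measurable]:
  "cube_quant m j \<in> cube m \<rightarrow>\<^sub>M count_space (cube_grid m j)"
proof (subst measurable_count_space_eq2, simp, intro conjI ballI)
  show "cube_quant m j \<in> space (cube m) \<rightarrow> cube_grid m j" using cube_quant_in_grid by blast
  fix b assume b: "b \<in> cube_grid m j"
  have "cube_quant m j -` {b} \<inter> space (cube m) =
     {x \<in> space (cube m). \<forall>i\<in>{..<m}. of_int \<lfloor>2 ^ j * x i\<rfloor> / 2 ^ j = b i}"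
    using cube_quant_eq_iff[OF b] by auto
  also have "\<dots> \<in> sets (cube m)" by measurable
  finally show "cube_quant m j -` {b} \<inter> space (cube m) \<in> sets (cube m)" .
qed

lemma measurable_state_quant [measurable]:
  assumes fin: "finite I"
  shows "state_quant d I j \<in> state_space d I \<rightarrow>\<^sub>M count_space (state_grid d I j)"
proof (subst measurable_count_space_eq2, use fin in simp, intro conjI ballI)
  show "state_quant d I j \<in> space (state_space d I) \<rightarrow> state_grid d I j" using state_quant_in_grid by blast
  fix b assume b: "b \<in> state_grid d I j"
  have "state_quant d I j -` {b} \<inter> space (state_space d I) =
     {x \<in> space (state_space d I). \<forall>i\<in>I. cube_quant (d i) j (x i) = b i}"
    using state_quant_eq_iff[OF b] by auto
  also have "\<dots> \<in> sets (state_space d I)"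
  proof (rule sets.sets_Collect_finite_All[OF _ fin])
    fix i assume i: "i \<in> I"
    have "(\<lambda>x. cube_quant (d i) j (x i)) \<in> state_space d I \<rightarrow>\<^sub>M count_space (cube_grid (d i) j)"
      using measurable_compose[OF measurable_state_component[OF i] measurable_cube_quant] .
    moreover have "{b i} \<in> sets (count_space (cube_grid (d i) j))"
      using b i by (auto simp: state_grid_def)
    ultimately have "(\<lambda>x. cube_quant (d i) j (x i)) -` {b i} \<inter> space (state_space d I) \<in> sets (state_space d I)"
      by (rule measurable_sets)
    thus "{x \<in> space (state_space d I). cube_quant (d i) j (x i) = b i} \<in> sets (state_space d I)"
      by (simp add: vimage_def Int_def conj_commute)
  qed
  finally show "state_quant d I j -` {b} \<inter> space (state_space d I) \<in> sets (state_space d I)" .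
qed

section \<open>From Wasserstein distances to Lipschitz functions and back\<close>

lemma lipschitz_extension:
  fixes \<delta> :: "'a \<Rightarrow> 'a \<Rightarrow> real"
  assumes fin: "finite S" "S \<noteq> {}"
    and \<delta>: "\<And>x. \<delta> x x = 0" "\<And>x y. \<delta> x y = \<delta> y x" "\<And>x y z. \<delta> x z \<le> \<delta> x y + \<delta> y z"
    and meas: "\<And>s. s \<in> S \<Longrightarrow> (\<lambda>x. \<delta> x s) \<in> borel_measurable M"
    and lip: "\<And>x y. x \<in> S \<Longrightarrow> y \<in> S \<Longrightarrow> \<bar>f x - f y\<bar> \<le> \<delta> x y"
  obtains F where "F \<in> borel_measurable M" "\<And>x. x \<in> S \<Longrightarrow> F x = f x" "\<And>x y. \<bar>F x - F y\<bar> \<le> \<delta> x y"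
proof
  \<comment> \<open>McShane's extension. Over a finite set it is a minimum of finitely many
    measurable functions, so a potential on the grid becomes a measurable function on the whole
    space.\<close>
  let ?F = "\<lambda>x. Min ((\<lambda>s. f s + \<delta> x s) ` S)"
  show "?F \<in> borel_measurable M" using meas fin by measurable
  have le: "?F x \<le> f s + \<delta> x s" if "s \<in> S" for x s using fin that by simp
  have ex: "\<exists>s\<in>S. ?F x = f s + \<delta> x s" for x
    using Min_in[of "(\<lambda>s. f s + \<delta> x s) ` S"] fin by blast
  show "?F x = f x" if x: "x \<in> S" for x
  proof -
    obtain s where s: "s \<in> S" "?F x = f s + \<delta> x s" using ex by blast
    thus ?thesis using le[OF x, of x] lip[OF x s(1)] \<delta>(1)[of x] by linarith
  qed
  have 1: "?F x \<le> ?F y + \<delta> x y" for x y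
  proof -
    obtain s where s: "s \<in> S" "?F y = f s + \<delta> y s" using ex by blast
    thus ?thesis using le[OF s(1), of x] \<delta>(3)[of x s y] by linarith
  qed
  show "\<bar>?F x - ?F y\<bar> \<le> \<delta> x y" for x y using 1[of x y] 1[of y x] \<delta>(2)[of x y] by linarith
qed

text \<open>The easy half of duality: under any coupling, the difference of the integrals is the
  integral of \<open>g (fst z) - g (snd z)\<close>, which is at most the transport cost.\<close>

lemma integral_diff_le_wasserstein_1:
  assumes \<mu>: "\<mu> \<in> space (prob_algebra M)" and \<nu>: "\<nu> \<in> space (prob_algebra M)"
    and g: "g \<in> borel_measurable M" "\<And>x. x \<in> space M \<Longrightarrow> \<bar>g x\<bar> \<le> B"
    and lip: "\<And>x y. x \<in> space M \<Longrightarrow> y \<in> space M \<Longrightarrow> \<bar>g x - g y\<bar> \<le> \<delta> x y"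
  shows "ennreal \<bar>(\<integral>x. g x \<partial>\<mu>) - (\<integral>x. g x \<partial>\<nu>)\<bar> \<le> wasserstein \<delta> \<mu> \<nu>"
  unfolding wasserstein_def
proof (rule INF_greatest)
  fix \<pi> assume \<pi>: "\<pi> \<in> couplings \<mu> \<nu>"
  have sets [simp, measurable_cong]: "sets \<mu> = sets M" "sets \<nu> = sets M"
    using \<mu> \<nu> by (auto simp: space_prob_algebra)
  interpret \<mu>: prob_space \<mu> using \<mu> by (simp add: space_prob_algebra)
  have sets\<pi>: "sets \<pi> = sets (\<mu> \<Otimes>\<^sub>M \<nu>)" and d1: "distr \<pi> \<mu> fst = \<mu>" and d2: "distr \<pi> \<nu> snd = \<nu>"
    using \<pi> by (auto simp: couplings_def)
  have sp\<pi>: "space \<pi> = space M \<times> space M"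
    using sets_eq_imp_space_eq[OF sets\<pi>] sets[THEN sets_eq_imp_space_eq] by (simp add: space_pair_measure)
  have fs [measurable]: "fst \<in> \<pi> \<rightarrow>\<^sub>M \<mu>" "snd \<in> \<pi> \<rightarrow>\<^sub>M \<nu>"
    by (simp_all cong: measurable_cong_sets[OF sets\<pi> refl])
  have "prob_space (distr \<pi> \<mu> fst)" using d1 \<mu>.prob_space_axioms by simp
  then interpret \<pi>: prob_space \<pi> using prob_space_distrD[OF fs(1)] by blast
  have gm [measurable]: "g \<in> borel_measurable \<mu>" "g \<in> borel_measurable \<nu>"
    using g(1) by (simp_all cong: measurable_cong_sets)
  have i1: "integrable \<pi> (\<lambda>z. g (fst z))" "integrable \<pi> (\<lambda>z. g (snd z))"
    by (rule \<pi>.integrable_const_bound[where B = B], use g(2) sp\<pi> in \<open>auto intro!: AE_I2\<close>)+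
  have "(\<integral>x. g x \<partial>\<mu>) = (\<integral>z. g (fst z) \<partial>\<pi>)"
    by (subst d1[symmetric], subst integral_distr) auto
  moreover have "(\<integral>x. g x \<partial>\<nu>) = (\<integral>z. g (snd z) \<partial>\<pi>)"
    by (subst d2[symmetric], subst integral_distr) auto
  ultimately have "(\<integral>x. g x \<partial>\<mu>) - (\<integral>x. g x \<partial>\<nu>) = (\<integral>z. g (fst z) - g (snd z) \<partial>\<pi>)"
    using i1 by simp
  hence "ennreal \<bar>(\<integral>x. g x \<partial>\<mu>) - (\<integral>x. g x \<partial>\<nu>)\<bar> \<le> (\<integral>\<^sup>+ z. ennreal \<bar>g (fst z) - g (snd z)\<bar> \<partial>\<pi>)"
    using integral_norm_bound_ennreal[of \<pi> "\<lambda>z. g (fst z) - g (snd z)"] i1 by simp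
  also have "\<dots> \<le> (\<integral>\<^sup>+ z. ennreal (\<delta> (fst z) (snd z)) \<partial>\<pi>)"
    using lip by (intro nn_integral_mono ennreal_leI) (auto simp: sp\<pi>)
  finally show "ennreal \<bar>(\<integral>x. g x \<partial>\<mu>) - (\<integral>x. g x \<partial>\<nu>)\<bar> \<le> (\<integral>\<^sup>+ z. ennreal (\<delta> (fst z) (snd z)) \<partial>\<pi>)" .
qed

lemma integral_diff_le_wasserstein:
  assumes \<mu>: "\<mu> \<in> space (prob_algebra M)" and \<nu>: "\<nu> \<in> space (prob_algebra M)"
    and g: "g \<in> borel_measurable M" "\<And>x. x \<in> space M \<Longrightarrow> \<bar>g x\<bar> \<le> B"
    and lip: "\<And>x y. x \<in> space M \<Longrightarrow> y \<in> space M \<Longrightarrow> \<bar>g x - g y\<bar> \<le> \<Lambda> * \<delta> x y"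
    and \<Lambda>: "0 < \<Lambda>" and W: "wasserstein \<delta> \<mu> \<nu> \<le> ennreal w" "0 \<le> w"
  shows "\<bar>(\<integral>x. g x \<partial>\<mu>) - (\<integral>x. g x \<partial>\<nu>)\<bar> \<le> \<Lambda> * w"
proof -
  have "ennreal \<bar>(\<integral>x. g x / \<Lambda> \<partial>\<mu>) - (\<integral>x. g x / \<Lambda> \<partial>\<nu>)\<bar> \<le> wasserstein \<delta> \<mu> \<nu>"
  proof (rule integral_diff_le_wasserstein_1[OF \<mu> \<nu>])
    show "(\<lambda>x. g x / \<Lambda>) \<in> borel_measurable M" using g(1) by measurable
    show "\<bar>g x / \<Lambda>\<bar> \<le> B / \<Lambda>" if "x \<in> space M" for x
      using g(2)[OF that] \<Lambda> by (simp add: divide_right_mono)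
    show "\<bar>g x / \<Lambda> - g y / \<Lambda>\<bar> \<le> \<delta> x y" if "x \<in> space M" "y \<in> space M" for x y
      using lip[OF that] \<Lambda> by (simp add: diff_divide_distrib[symmetric] pos_divide_le_eq mult.commute)
  qed
  also have "\<dots> \<le> ennreal w" by (rule W)
  finally have "\<bar>(\<integral>x. g x \<partial>\<mu>) / \<Lambda> - (\<integral>x. g x \<partial>\<nu>) / \<Lambda>\<bar> \<le> w"
    using W(2) by (simp add: ennreal_le_iff)
  thus ?thesis using \<Lambda> by (simp add: diff_divide_distrib[symmetric] pos_divide_le_eq mult.commute)
qed

text \<open>Discretising costs at most \<open>r\<close>; on the grid the Wasserstein distance is a supremum over
  Lipschitz functions.\<close>

lemma wasserstein_le_by_duality:
  fixes \<delta> :: "'a \<Rightarrow> 'a \<Rightarrow> real"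
  assumes \<mu>: "\<mu> \<in> space (prob_algebra M)"
    and fin: "finite S" and SM: "S \<subseteq> space M"
    and \<delta>: "\<And>x y. 0 \<le> \<delta> x y" "\<And>x. \<delta> x x = 0" "\<And>x y. \<delta> x y = \<delta> y x" "\<And>x y z. \<delta> x z \<le> \<delta> x y + \<delta> y z"
    and meas: "(\<lambda>z. \<delta> (fst z) (snd z)) \<in> borel_measurable (M \<Otimes>\<^sub>M M)"
    and w: "\<And>s. s \<in> S \<Longrightarrow> 0 \<le> w s" "sum w S = 1"
    and qm: "Q \<in> M \<rightarrow>\<^sub>M count_space S" and r: "\<And>x. x \<in> space M \<Longrightarrow> \<delta> (Q x) x \<le> r"
    and dual: "\<And>F. F \<in> borel_measurable M \<Longrightarrow> (\<And>x y. \<bar>F x - F y\<bar> \<le> \<delta> x y) \<Longrightarrow>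
       (\<integral>x. F (Q x) \<partial>\<mu>) - (\<Sum>s\<in>S. w s * F s) \<le> c"
  shows "wasserstein \<delta> \<mu> (distr (point_measure S w) M (\<lambda>x. x)) \<le> ennreal (r + c)"
proof -
  have sets [simp, measurable_cong]: "sets \<mu> = sets M" using \<mu> by (simp add: space_prob_algebra)
  interpret \<mu>: prob_space \<mu> using \<mu> by (simp add: space_prob_algebra)
  have sp [simp]: "space \<mu> = space M" by (rule sets_eq_imp_space_eq) simp
  have QS: "Q x \<in> S" if "x \<in> space M" for x using measurable_space[OF qm that] by simp
  have Qm [measurable]: "Q \<in> \<mu> \<rightarrow>\<^sub>M count_space S" using qm by (simp cong: measurable_cong_sets)
  define p where "p s = measure \<mu> {x \<in> space M. Q x = s}" for s
  have pset [measurable]: "{x \<in> space M. Q x = s} \<in> sets \<mu>" if "s \<in> S" for s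
    using measurable_sets[OF Qm, of "{s}"] that by (simp add: vimage_def Int_def conj_commute)
  have int_Q: "(\<integral>x. G (Q x) \<partial>\<mu>) = (\<Sum>s\<in>S. p s * G s)" for G :: "'a \<Rightarrow> real"
  proof -
    have "(\<integral>x. G (Q x) \<partial>\<mu>) = (\<integral>x. (\<Sum>s\<in>S. G s * indicator {x \<in> space M. Q x = s} x) \<partial>\<mu>)"
      using fin QS by (intro Bochner_Integration.integral_cong refl)
        (simp add: indicator_def if_distrib[of "\<lambda>t. _ * t"] sum.delta cong: if_cong conj_cong)
    also have "\<dots> = (\<Sum>s\<in>S. G s * p s)"
      using pset by (subst Bochner_Integration.integral_sum)
        (auto simp: p_def intro!: integrable_mult_right \<mu>.integrable_const_bound[where B = 1] AE_I2)
    finally show ?thesis by (simp add: mult.commute)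
  qed
  have nn_Q: "(\<integral>\<^sup>+x. ennreal (G (Q x)) \<partial>\<mu>) = ennreal (\<Sum>s\<in>S. p s * G s)" if "\<And>s. s \<in> S \<Longrightarrow> 0 \<le> G s" for G
  proof -
    have gm: "(\<lambda>x. G (Q x)) \<in> borel_measurable \<mu>"
      by (rule measurable_compose[OF Qm]) simp
    have "integrable \<mu> (\<lambda>x. G (Q x))"
      using gm QS fin by (intro \<mu>.integrable_const_bound[where B = "\<Sum>s\<in>S. \<bar>G s\<bar>"] AE_I2)
        (auto intro: member_le_sum)
    thus ?thesis using that QS by (subst nn_integral_eq_integral) (auto simp: int_Q intro!: AE_I2)
  qed
  have p0: "0 \<le> p s" for s by (simp add: p_def)
  have p1: "sum p S = 1" using int_Q[of "\<lambda>_. 1"] \<mu>.prob_space by simp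
  \<comment> \<open>Duality is used on the finite grid only, between the law \<open>p\<close> of the
    rounded point and \<open>w\<close>. The resulting plan still has to be lifted to a coupling of
    \<open>\<mu>\<close> itself.\<close>
  obtain \<pi> f where \<pi>: "\<And>x y. x \<in> S \<Longrightarrow> y \<in> S \<Longrightarrow> 0 \<le> \<pi> x y"
    "\<And>x. x \<in> S \<Longrightarrow> (\<Sum>y\<in>S. \<pi> x y) = p x" "\<And>y. y \<in> S \<Longrightarrow> (\<Sum>x\<in>S. \<pi> x y) = w y"
    and f: "\<And>x y. x \<in> S \<Longrightarrow> y \<in> S \<Longrightarrow> \<bar>f x - f y\<bar> \<le> \<delta> x y"
    and opt: "(\<Sum>x\<in>S. \<Sum>y\<in>S. \<pi> x y * \<delta> x y) = (\<Sum>x\<in>S. f x * (p x - w x))"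
    using finite_kantorovich_duality[of S p w \<delta>, OF fin p0 p1 w \<delta>(2,3,4)] by blast
  have meas': "(\<lambda>x. \<delta> x s) \<in> borel_measurable M" if "s \<in> S" for s
    using measurable_compose[OF measurable_Pair2'[of s M M] meas] SM that by auto
  have "S \<noteq> {}" using p1 by auto
  then obtain F where F: "F \<in> borel_measurable M" "\<And>x. x \<in> S \<Longrightarrow> F x = f x" "\<And>x y. \<bar>F x - F y\<bar> \<le> \<delta> x y"
    using lipschitz_extension[of S \<delta> M f, OF fin _ \<delta>(2,3,4) meas' f] by blast
  have "(\<Sum>x\<in>S. f x * (p x - w x)) = (\<Sum>x\<in>S. p x * F x) - (\<Sum>x\<in>S. w x * F x)"
    by (simp add: F(2) algebra_simps sum_subtractf cong: sum.cong)
  also have "\<dots> \<le> c" using dual[OF F(1,3)] by (simp add: int_Q)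
  finally have cost: "(\<Sum>x\<in>S. \<Sum>y\<in>S. \<pi> x y * \<delta> x y) \<le> c" using opt by simp
  \<comment> \<open>The plan is disintegrated along its first marginal. On rows of mass zero,
    \<open>w t\<close> is a default that keeps every row a probability vector.\<close>
  define \<rho> where "\<rho> s t = (if p s = 0 then w t else \<pi> s t / p s)" for s t
  have \<rho>0: "0 \<le> \<rho> s t" if "s \<in> S" "t \<in> S" for s t using \<pi>(1) w(1) p0 that by (simp add: \<rho>_def)
  have \<rho>1: "(\<Sum>t\<in>S. \<rho> s t) = 1" if "s \<in> S" for s
    using \<pi>(2)[OF that] w(2) by (cases "p s = 0") (simp_all add: \<rho>_def flip: sum_divide_distrib)
  have p\<rho>: "p s * \<rho> s t = \<pi> s t" if "s \<in> S" "t \<in> S" for s t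
  proof (cases "p s = 0")
    case True
    hence "\<pi> s t = 0" using \<pi>(2)[OF that(1)] \<pi>(1)[OF that(1)] fin that(2)
      by (metis sum_nonneg_eq_0_iff)
    thus ?thesis using True by simp
  qed (simp add: \<rho>_def)
  let ?C = "\<mu> \<Otimes>\<^sub>M count_space S"
  \<comment> \<open>The lifted coupling: \<open>x\<close> is drawn from \<open>\<mu>\<close>, and
    then the grid point \<open>t\<close> with probability \<open>\<rho> (Q x) t\<close>.\<close>
  let ?D = "density ?C (\<lambda>z. ennreal (\<rho> (Q (fst z)) (snd z)))"
  let ?N = "distr (point_measure S w) M (\<lambda>x. x)"
  interpret S: sigma_finite_measure "count_space S"
    using fin by (rule sigma_finite_measure_count_space_finite)
  have \<rho>m [measurable]: "(\<lambda>z. ennreal (\<rho> (Q (fst z)) (snd z))) \<in> borel_measurable ?C"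
  proof -
    have "(\<lambda>z. (Q (fst z), snd z)) \<in> ?C \<rightarrow>\<^sub>M count_space S \<Otimes>\<^sub>M count_space S" by measurable
    hence "(\<lambda>z. (Q (fst z), snd z)) \<in> ?C \<rightarrow>\<^sub>M count_space (S \<times> S)"
      using fin by (simp add: pair_measure_count_space countable_finite)
    from measurable_compose[OF this, of "\<lambda>(s, t). ennreal (\<rho> s t)" borel] show ?thesis by simp
  qed
  have im [measurable]: "(\<lambda>t. t) \<in> count_space S \<rightarrow>\<^sub>M M" using SM by auto
  have Tm: "(\<lambda>z. z) \<in> ?C \<rightarrow>\<^sub>M \<mu> \<Otimes>\<^sub>M ?N"
  proof -
    have "(\<lambda>z. (fst z, snd z)) \<in> ?C \<rightarrow>\<^sub>M \<mu> \<Otimes>\<^sub>M M"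
      by (intro measurable_Pair measurable_fst measurable_compose[OF measurable_snd im])
    thus ?thesis by (simp cong: measurable_cong_sets sets_pair_measure_cong)
  qed
  \<comment> \<open>The identity carries the measure from the discrete second factor to the product
    sigma-algebra that \<open>couplings\<close> prescribes.\<close>
  let ?P = "distr ?D (\<mu> \<Otimes>\<^sub>M ?N) (\<lambda>z. z)"
  have nnP: "(\<integral>\<^sup>+z. G z \<partial>?P) = (\<integral>\<^sup>+x. (\<Sum>t\<in>S. ennreal (\<rho> (Q x) t) * G (x, t)) \<partial>\<mu>)"
    if G: "G \<in> borel_measurable (\<mu> \<Otimes>\<^sub>M ?N)" for G
  proof -
    have GC [measurable]: "G \<in> borel_measurable ?C" using measurable_compose[OF Tm G] .
    have "(\<integral>\<^sup>+z. G z \<partial>?P) = (\<integral>\<^sup>+z. G z \<partial>?D)"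
      using Tm G by (subst nn_integral_distr) auto
    also have "\<dots> = (\<integral>\<^sup>+z. ennreal (\<rho> (Q (fst z)) (snd z)) * G z \<partial>?C)"
      by (subst nn_integral_density) auto
    also have "\<dots> = (\<integral>\<^sup>+x. \<integral>\<^sup>+t. ennreal (\<rho> (Q x) t) * G (x, t) \<partial>count_space S \<partial>\<mu>)"
      by (subst S.nn_integral_fst[symmetric]) auto
    finally show ?thesis using fin by (simp add: nn_integral_count_space_finite)
  qed
  have em: "emeasure ?P A = (\<integral>\<^sup>+x. (\<Sum>t\<in>S. ennreal (\<rho> (Q x) t) * indicator A (x, t)) \<partial>\<mu>)"
    if "A \<in> sets (\<mu> \<Otimes>\<^sub>M ?N)" for A
    using nnP[of "indicator A"] that by (subst nn_integral_indicator[symmetric]) auto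
  have spN: "space ?N = space M" by simp
  have "distr ?P \<mu> fst = \<mu>"
  proof (rule measure_eqI)
    fix A assume "A \<in> sets (distr ?P \<mu> fst)"
    hence A [measurable]: "A \<in> sets \<mu>" by simp
    have AM: "A \<subseteq> space M" using sets.sets_into_space[OF A] by simp
    have vi: "fst -` A \<inter> space ?P = A \<times> space M" using AM by (auto simp: space_pair_measure)
    have "emeasure (distr ?P \<mu> fst) A = emeasure ?P (A \<times> space M)"
      by (subst emeasure_distr) (use A in \<open>simp_all add: vi[simplified]\<close>)
    also have "\<dots> = (\<integral>\<^sup>+x. (\<Sum>t\<in>S. ennreal (\<rho> (Q x) t) * indicator (A \<times> space M) (x, t)) \<partial>\<mu>)"
      by (rule em, rule pair_measureI) (use A in simp_all)
    also have "\<dots> = (\<integral>\<^sup>+x. indicator A x \<partial>\<mu>)"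
    proof (rule nn_integral_cong)
      fix x assume "x \<in> space \<mu>"
      hence x: "Q x \<in> S" using QS by simp
      have "(\<Sum>t\<in>S. ennreal (\<rho> (Q x) t) * indicator (A \<times> space M) (x, t)) = (\<Sum>t\<in>S. ennreal (\<rho> (Q x) t)) * indicator A x"
        using SM by (subst sum_distrib_right, intro sum.cong) (auto simp: indicator_def)
      also have "(\<Sum>t\<in>S. ennreal (\<rho> (Q x) t)) = 1" using \<rho>0[OF x] \<rho>1[OF x] by (subst sum_ennreal) auto
      finally show "(\<Sum>t\<in>S. ennreal (\<rho> (Q x) t) * indicator (A \<times> space M) (x, t)) = indicator A x" by simp
    qed
    also have "\<dots> = emeasure \<mu> A" using A by (rule nn_integral_indicator)
    finally show "emeasure (distr ?P \<mu> fst) A = emeasure \<mu> A" .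
  qed simp
  moreover have "distr ?P ?N snd = ?N"
  proof (rule measure_eqI)
    fix A assume "A \<in> sets (distr ?P ?N snd)"
    hence A [measurable]: "A \<in> sets M" by simp
    have AM: "A \<subseteq> space M" using sets.sets_into_space[OF A] by simp
    have vi: "snd -` A \<inter> space ?P = space \<mu> \<times> A" using AM by (auto simp: space_pair_measure)
    have "emeasure (distr ?P ?N snd) A = emeasure ?P (space \<mu> \<times> A)"
      by (subst emeasure_distr) (use A in \<open>simp_all add: vi[simplified]\<close>)
    also have "\<dots> = (\<integral>\<^sup>+x. (\<Sum>t\<in>S. ennreal (\<rho> (Q x) t) * indicator (space \<mu> \<times> A) (x, t)) \<partial>\<mu>)"
      by (rule em, rule pair_measureI) (use A in simp_all)
    also have "\<dots> = (\<integral>\<^sup>+x. ennreal (\<Sum>t\<in>S. \<rho> (Q x) t * indicator A t) \<partial>\<mu>)"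
    proof (rule nn_integral_cong)
      fix x assume "x \<in> space \<mu>"
      hence "Q x \<in> S" "x \<in> space M" using QS by simp_all
      hence "(\<Sum>t\<in>S. ennreal (\<rho> (Q x) t) * indicator (space \<mu> \<times> A) (x, t)) = (\<Sum>t\<in>S. ennreal (\<rho> (Q x) t * indicator A t))"
        by (intro sum.cong) (auto simp: indicator_def)
      also have "\<dots> = ennreal (\<Sum>t\<in>S. \<rho> (Q x) t * indicator A t)"
        using \<rho>0[OF \<open>Q x \<in> S\<close>] by (intro sum_ennreal) simp
      finally show "(\<Sum>t\<in>S. ennreal (\<rho> (Q x) t) * indicator (space \<mu> \<times> A) (x, t)) = ennreal (\<Sum>t\<in>S. \<rho> (Q x) t * indicator A t)" .
    qed
    also have "\<dots> = ennreal (\<Sum>s\<in>S. p s * (\<Sum>t\<in>S. \<rho> s t * indicator A t))"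
      by (rule nn_Q) (auto intro!: sum_nonneg \<rho>0 simp: indicator_def)
    also have "(\<Sum>s\<in>S. p s * (\<Sum>t\<in>S. \<rho> s t * indicator A t)) = (\<Sum>s\<in>S. \<Sum>t\<in>S. \<pi> s t * indicator A t)"
      by (intro sum.cong refl) (simp add: sum_distrib_left p\<rho> flip: mult.assoc cong: sum.cong)
    also have "\<dots> = (\<Sum>t\<in>S. w t * indicator A t)"
      by (subst sum.swap) (simp add: \<pi>(3) flip: sum_distrib_right cong: sum.cong)
    also have "(\<Sum>t\<in>S. w t * indicator A t) = (\<Sum>t\<in>S \<inter> A. w t)"
      using fin by (simp add: indicator_def of_bool_def sum.inter_restrict if_distrib cong: if_cong)
    also have "ennreal \<dots> = (\<Sum>t\<in>S \<inter> A. ennreal (w t))"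
      using w(1) by (intro sum_ennreal[symmetric]) simp
    also have "\<dots> = emeasure (point_measure S w) (S \<inter> A)"
      using fin by (subst emeasure_point_measure_finite) auto
    also have "\<dots> = emeasure ?N A"
    proof -
      have "(\<lambda>x. x) \<in> point_measure S w \<rightarrow>\<^sub>M M" using SM by (simp add: subset_iff)
      hence "emeasure ?N A = emeasure (point_measure S w) ((\<lambda>x. x) -` A \<inter> space (point_measure S w))"
        using A by (rule emeasure_distr)
      also have "(\<lambda>x. x) -` A \<inter> space (point_measure S w) = S \<inter> A" by (auto simp: space_point_measure)
      finally show ?thesis ..
    qed
    finally show "emeasure (distr ?P ?N snd) A = emeasure ?N A" .
  qed simp
  ultimately have "?P \<in> couplings \<mu> ?N" by (simp add: couplings_def)
  hence "wasserstein \<delta> \<mu> ?N \<le> (\<integral>\<^sup>+ z. ennreal (\<delta> (fst z) (snd z)) \<partial>?P)"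
    unfolding wasserstein_def by (rule INF_lower)
  also have "\<dots> = (\<integral>\<^sup>+x. (\<Sum>t\<in>S. ennreal (\<rho> (Q x) t) * ennreal (\<delta> x t)) \<partial>\<mu>)"
    using meas by (subst nnP) (simp_all cong: measurable_cong_sets sets_pair_measure_cong)
  also have "\<dots> \<le> (\<integral>\<^sup>+x. ennreal (r + (\<Sum>t\<in>S. \<rho> (Q x) t * \<delta> (Q x) t)) \<partial>\<mu>)"
  proof (rule nn_integral_mono)
    fix x assume "x \<in> space \<mu>"
    hence x: "x \<in> space M" "Q x \<in> S" using QS by simp_all
    have "(\<Sum>t\<in>S. ennreal (\<rho> (Q x) t) * ennreal (\<delta> x t)) = (\<Sum>t\<in>S. ennreal (\<rho> (Q x) t * \<delta> x t))"
      using \<rho>0[OF x(2)] \<delta>(1) by (intro sum.cong refl ennreal_mult[symmetric])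
    also have "\<dots> = ennreal (\<Sum>t\<in>S. \<rho> (Q x) t * \<delta> x t)"
      using \<rho>0[OF x(2)] \<delta>(1) by (intro sum_ennreal mult_nonneg_nonneg)
    also have "(\<Sum>t\<in>S. \<rho> (Q x) t * \<delta> x t) \<le> (\<Sum>t\<in>S. \<rho> (Q x) t * (r + \<delta> (Q x) t))"
    proof (intro sum_mono mult_left_mono \<rho>0 x(2))
      fix t show "\<delta> x t \<le> r + \<delta> (Q x) t"
        using \<delta>(4)[of x t "Q x"] \<delta>(3)[of x "Q x"] r[OF x(1)] by linarith
    qed
    also have "\<dots> = r + (\<Sum>t\<in>S. \<rho> (Q x) t * \<delta> (Q x) t)"
      using \<rho>1[OF x(2)] by (simp add: distrib_left sum.distrib flip: sum_distrib_right)
    finally show "(\<Sum>t\<in>S. ennreal (\<rho> (Q x) t) * ennreal (\<delta> x t)) \<le> ennreal (r + (\<Sum>t\<in>S. \<rho> (Q x) t * \<delta> (Q x) t))"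
      using ennreal_leI by metis
  qed
  also have "\<dots> = ennreal (\<Sum>s\<in>S. p s * (r + (\<Sum>t\<in>S. \<rho> s t * \<delta> s t)))"
  proof (rule nn_Q)
    obtain x where "x \<in> space M" using \<mu>.not_empty by auto
    hence "0 \<le> r" using r \<delta>(1) order_trans by blast
    thus "0 \<le> r + (\<Sum>t\<in>S. \<rho> s t * \<delta> s t)" if "s \<in> S" for s
      using \<rho>0[OF that] \<delta>(1) by (intro add_nonneg_nonneg sum_nonneg mult_nonneg_nonneg) auto
  qed
  also have "(\<Sum>s\<in>S. p s * (r + (\<Sum>t\<in>S. \<rho> s t * \<delta> s t))) = r + (\<Sum>s\<in>S. \<Sum>t\<in>S. \<pi> s t * \<delta> s t)"
  proof -
    have "p s * (r + (\<Sum>t\<in>S. \<rho> s t * \<delta> s t)) = p s * r + (\<Sum>t\<in>S. \<pi> s t * \<delta> s t)" if "s \<in> S" for s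
      by (simp add: distrib_left sum_distrib_left p\<rho>[OF that] flip: mult.assoc cong: sum.cong)
    thus ?thesis using p1 by (simp add: sum.distrib flip: sum_distrib_right cong: sum.cong)
  qed
  also have "ennreal (r + (\<Sum>s\<in>S. \<Sum>t\<in>S. \<pi> s t * \<delta> s t)) \<le> ennreal (r + c)"
    using cost by (intro ennreal_leI) simp
  finally show ?thesis .
qed

section \<open>Disintegration along Lipschitz kernels\<close>

abbreviation (input) "states d m \<equiv> state_space d {1..m}"

definition node_step ::
    "(nat \<times> nat) set \<Rightarrow> (nat \<Rightarrow> nat) \<Rightarrow> (nat \<Rightarrow> (nat \<Rightarrow> nat \<Rightarrow> real) \<Rightarrow> (nat \<Rightarrow> real) measure) \<Rightarrow>
     nat \<Rightarrow> (nat \<Rightarrow> nat \<Rightarrow> real) \<Rightarrow> (nat \<Rightarrow> nat \<Rightarrow> real) measure" where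
  "node_step E d \<kappa> m x =
     distr (\<kappa> (Suc m) (restrict x (parents E (Suc m)))) (states d (Suc m)) (\<lambda>y. x(Suc m := y))"

lemma kernel_product_Suc:
  "kernel_product E d \<kappa> (Suc m) = kernel_product E d \<kappa> m \<bind> node_step E d \<kappa> m"
  by (simp add: node_step_def[abs_def])

declare kernel_product.simps(2) [simp del]

lemma atLeast1_Suc: "{1..Suc m} = insert (Suc m) {1..m}"
  by auto

section \<open>Adding one node to a measure on the earlier nodes\<close>

lemma measurable_state_upd:
  "(\<lambda>(x, y). x(Suc m := y)) \<in> states d m \<Otimes>\<^sub>M cube (d (Suc m)) \<rightarrow>\<^sub>M states d (Suc m)"
  unfolding state_space_def atLeast1_Suc by (rule measurable_add_dim)

lemma state_upd_space:
  "x \<in> space (states d m) \<Longrightarrow> y \<in> space (cube (d (Suc m))) \<Longrightarrow>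
     x(Suc m := y) \<in> space (states d (Suc m))"
  unfolding space_state_space atLeast1_Suc by (rule PiE_fun_upd)

lemma measurable_state_upd_snd:
  assumes "x \<in> space (states d m)"
  shows "(\<lambda>y. x(Suc m := y)) \<in> cube (d (Suc m)) \<rightarrow>\<^sub>M states d (Suc m)"
  using measurable_Pair2[OF measurable_state_upd assms] by simp

context
  fixes E :: "(nat \<times> nat) set" and d :: "nat \<Rightarrow> nat" and m :: nat
    and \<kappa> :: "nat \<Rightarrow> (nat \<Rightarrow> nat \<Rightarrow> real) \<Rightarrow> (nat \<Rightarrow> real) measure"
  assumes pa: "parents E (Suc m) \<subseteq> {1..m}"
    and \<kappa>: "\<kappa> (Suc m) \<in> state_space d (parents E (Suc m)) \<rightarrow>\<^sub>M prob_algebra (cube (d (Suc m)))"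
begin

abbreviation (input) "ker x \<equiv> \<kappa> (Suc m) (restrict x (parents E (Suc m)))"

lemma measurable_kernel_restrict:
  "(\<lambda>x. ker x) \<in> states d m \<rightarrow>\<^sub>M prob_algebra (cube (d (Suc m)))"
  by (rule measurable_compose[OF measurable_state_restrict[OF pa] \<kappa>])

lemma kernel_restrict_space:
  "x \<in> space (states d m) \<Longrightarrow>
     ker x \<in> space (prob_algebra (cube (d (Suc m))))"
  by (rule measurable_space[OF measurable_kernel_restrict])

lemma measurable_node_step:
  "node_step E d \<kappa> m \<in> states d m \<rightarrow>\<^sub>M prob_algebra (states d (Suc m))"
  unfolding node_step_def[abs_def]
  by (rule measurable_distr_prob_space2[OF measurable_kernel_restrict measurable_state_upd])

lemma bind_node_step_space:
  "N \<in> space (prob_algebra (states d m)) \<Longrightarrow>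
     N \<bind> node_step E d \<kappa> m \<in> space (prob_algebra (states d (Suc m)))"
  using prob_space_bind'[OF _ measurable_node_step] sets_bind'[OF _ measurable_node_step]
  by (simp add: space_prob_algebra)

lemma nn_integral_bind_node_step:
  assumes N: "N \<in> space (prob_algebra (states d m))"
    and h: "h \<in> borel_measurable (states d (Suc m))"
  shows "(\<integral>\<^sup>+x. h x \<partial>(N \<bind> node_step E d \<kappa> m)) =
     (\<integral>\<^sup>+x. \<integral>\<^sup>+y. h (x(Suc m := y)) \<partial>ker x \<partial>N)"
proof -
  have sets [measurable_cong]: "sets N = sets (states d m)" using N by (simp add: space_prob_algebra)
  have "node_step E d \<kappa> m \<in> N \<rightarrow>\<^sub>M subprob_algebra (states d (Suc m))"
    using measurable_prob_algebraD[OF measurable_node_step] by (simp only: measurable_cong_sets[OF sets refl])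
  from nn_integral_bind[OF h this] have
    "(\<integral>\<^sup>+x. h x \<partial>(N \<bind> node_step E d \<kappa> m)) = (\<integral>\<^sup>+x. \<integral>\<^sup>+y. h y \<partial>node_step E d \<kappa> m x \<partial>N)" .
  also have "\<dots> = (\<integral>\<^sup>+x. \<integral>\<^sup>+y. h (x(Suc m := y)) \<partial>ker x \<partial>N)"
  proof (rule nn_integral_cong)
    fix x assume "x \<in> space N"
    hence x: "x \<in> space (states d m)" using sets_eq_imp_space_eq[OF sets] by simp
    have "sets (ker x) = sets (cube (d (Suc m)))"
      using kernel_restrict_space[OF x] by (simp add: space_prob_algebra)
    hence "(\<lambda>y. x(Suc m := y)) \<in> ker x \<rightarrow>\<^sub>M states d (Suc m)"
      using measurable_state_upd_snd[OF x] by (simp cong: measurable_cong_sets)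
    thus "(\<integral>\<^sup>+y. h y \<partial>node_step E d \<kappa> m x) = (\<integral>\<^sup>+y. h (x(Suc m := y)) \<partial>ker x)"
      unfolding node_step_def using h by (subst nn_integral_distr) simp_all
  qed
  finally show ?thesis .
qed

text \<open>The step leaves the earlier coordinates untouched and its kernels have total mass one,
  so integrating out the new coordinate returns \<open>N\<close>.\<close>

lemma marginal_bind_node_step:
  assumes N: "N \<in> space (prob_algebra (states d m))"
  shows "distr (N \<bind> node_step E d \<kappa> m) (states d m) (\<lambda>x. restrict x {1..m}) = N"
proof (rule measure_eqI)
  have sets: "sets N = sets (states d m)" using N by (simp add: space_prob_algebra)
  have setsB: "sets (N \<bind> node_step E d \<kappa> m) = sets (states d (Suc m))"
    using bind_node_step_space[OF N] by (simp add: space_prob_algebra)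
  show "sets (distr (N \<bind> node_step E d \<kappa> m) (states d m) (\<lambda>x. restrict x {1..m})) = sets N"
    using sets by simp
  fix A assume "A \<in> sets (distr (N \<bind> node_step E d \<kappa> m) (states d m) (\<lambda>x. restrict x {1..m}))"
  hence A: "A \<in> sets (states d m)" by simp
  have r: "(\<lambda>x. restrict x {1..m}) \<in> states d (Suc m) \<rightarrow>\<^sub>M states d m"
    by (rule measurable_state_restrict) auto
  have h: "(\<lambda>x. indicator A (restrict x {1..m}) :: ennreal) \<in> borel_measurable (states d (Suc m))"
    by (rule measurable_compose[OF r]) (use A in simp)
  have "emeasure (distr (N \<bind> node_step E d \<kappa> m) (states d m) (\<lambda>x. restrict x {1..m})) A
     = (\<integral>\<^sup>+x. indicator A x \<partial>distr (N \<bind> node_step E d \<kappa> m) (states d m) (\<lambda>x. restrict x {1..m}))"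
    using A by simp
  also have "\<dots> = (\<integral>\<^sup>+x. indicator A (restrict x {1..m}) \<partial>(N \<bind> node_step E d \<kappa> m))"
    using r A by (subst nn_integral_distr) (simp_all cong: measurable_cong_sets[OF setsB refl])
  also have "\<dots> = (\<integral>\<^sup>+x. \<integral>\<^sup>+y. indicator A (restrict (x(Suc m := y)) {1..m}) \<partial>ker x \<partial>N)"
    by (rule nn_integral_bind_node_step[OF N h])
  also have "\<dots> = (\<integral>\<^sup>+x. indicator A x \<partial>N)"
  proof (rule nn_integral_cong)
    fix x assume "x \<in> space N"
    hence x: "x \<in> space (states d m)" using sets_eq_imp_space_eq[OF sets] by simp
    have "restrict (x(Suc m := y)) {1..m} = x" for y
      using x by (auto simp: space_state_space PiE_def extensional_def restrict_def fun_eq_iff)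
    moreover have "prob_space (ker x)"
      using kernel_restrict_space[OF x] by (simp add: space_prob_algebra)
    ultimately show "(\<integral>\<^sup>+y. indicator A (restrict (x(Suc m := y)) {1..m}) \<partial>ker x) = indicator A x"
      by (simp add: prob_space.emeasure_space_1)
  qed
  finally show "emeasure (distr (N \<bind> node_step E d \<kappa> m) (states d m) (\<lambda>x. restrict x {1..m})) A = emeasure N A"
    using A sets by simp
qed

end

lemma kernel_product_space:
  assumes dag: "sorted_dag K E"
    and \<kappa>: "\<And>k. k \<in> {1..m} \<Longrightarrow> \<kappa> k \<in> state_space d (parents E k) \<rightarrow>\<^sub>M prob_algebra (cube (d k))"
  shows "kernel_product E d \<kappa> m \<in> space (prob_algebra (states d m))"
  using \<kappa>
proof (induction m)
  case 0
  have "(\<lambda>_. undefined) \<in> space (state_space d {})" by (simp add: space_state_space)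
  thus ?case by (simp add: space_prob_algebra prob_space_return)
next
  case (Suc m)
  have "kernel_product E d \<kappa> m \<in> space (prob_algebra (states d m))"
    by (rule Suc.IH, rule Suc.prems) simp
  thus ?case unfolding kernel_product_Suc
    by (rule bind_node_step_space[OF sorted_dag_parents_subset[OF dag], rotated]) (rule Suc.prems, simp)
qed

section \<open>Marginals, and exchange of versions of the conditional distributions\<close>

definition marginal :: "(nat \<Rightarrow> nat) \<Rightarrow> (nat \<Rightarrow> nat \<Rightarrow> real) measure \<Rightarrow> nat set \<Rightarrow> (nat \<Rightarrow> nat \<Rightarrow> real) measure" where
  "marginal d \<mu> I = distr \<mu> (state_space d I) (\<lambda>x. restrict x I)"

lemma marginal_space:
  assumes "\<mu> \<in> space (prob_algebra (state_space d J))" "I \<subseteq> J"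
  shows "marginal d \<mu> I \<in> space (prob_algebra (state_space d I))"
proof -
  have "sets \<mu> = sets (state_space d J)" using assms by (simp add: space_prob_algebra)
  hence "(\<lambda>x. restrict x I) \<in> \<mu> \<rightarrow>\<^sub>M state_space d I"
    using measurable_state_restrict[OF assms(2)] by (simp cong: measurable_cong_sets)
  thus ?thesis using assms(1) by (auto simp: marginal_def space_prob_algebra intro: prob_space.prob_space_distr)
qed

lemma marginal_marginal:
  assumes "sets \<mu> = sets (state_space d J)" "H \<subseteq> I" "I \<subseteq> J"
  shows "marginal d (marginal d \<mu> I) H = marginal d \<mu> H"
proof -
  have "(\<lambda>x. restrict x I) \<in> \<mu> \<rightarrow>\<^sub>M state_space d I"
    using measurable_state_restrict[OF assms(3)] assms(1) by (simp cong: measurable_cong_sets)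
  thus ?thesis
    unfolding marginal_def
    by (simp only: distr_distr[OF measurable_state_restrict[OF assms(2)]] comp_def restrict_restrict Int_absorb1[OF assms(2)])
qed

lemma marginal_kernel_product:
  assumes dag: "sorted_dag K E" and "m \<le> M"
    and \<kappa>: "\<And>k. k \<in> {1..M} \<Longrightarrow> \<kappa> k \<in> state_space d (parents E k) \<rightarrow>\<^sub>M prob_algebra (cube (d k))"
  shows "marginal d (kernel_product E d \<kappa> M) {1..m} = kernel_product E d \<kappa> m"
  using assms(2) \<kappa>
proof (induction M)
  case 0
  have "(\<lambda>x. restrict x {}) = (\<lambda>x::nat \<Rightarrow> nat \<Rightarrow> real. \<lambda>_. undefined)" by (simp add: restrict_def)
  moreover have "(\<lambda>_. undefined) \<in> space (state_space d {})" by (simp add: space_state_space)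
  ultimately show ?case using 0 by (simp add: marginal_def distr_return)
next
  case (Suc M)
  have sp: "kernel_product E d \<kappa> (Suc M) \<in> space (prob_algebra (state_space d {1..Suc M}))"
    by (rule kernel_product_space[OF dag]) (rule Suc.prems)
  hence sets: "sets (kernel_product E d \<kappa> (Suc M)) = sets (state_space d {1..Suc M})"
    by (simp add: space_prob_algebra)
  have spM: "kernel_product E d \<kappa> M \<in> space (prob_algebra (state_space d {1..M}))"
    by (rule kernel_product_space[OF dag], rule Suc.prems) simp
  show ?case
  proof (cases "m = Suc M")
    case True
    have "marginal d (kernel_product E d \<kappa> (Suc M)) {1..Suc M} = distr (kernel_product E d \<kappa> (Suc M)) (state_space d {1..Suc M}) (\<lambda>x. x)"
      unfolding marginal_def
      by (rule distr_cong[OF refl refl]) (simp add: sets_eq_imp_space_eq[OF sets] space_state_space PiE_restrict)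
    also have "\<dots> = kernel_product E d \<kappa> (Suc M)" using sets by (simp add: distr_id2)
    finally show ?thesis using True by simp
  next
    case False
    hence m: "m \<le> M" using Suc.prems(1) by simp
    have IH: "marginal d (kernel_product E d \<kappa> M) {1..m} = kernel_product E d \<kappa> m"
      by (rule Suc.IH[OF m], rule Suc.prems) simp
    have "marginal d (kernel_product E d \<kappa> (Suc M)) {1..M} = kernel_product E d \<kappa> M"
      unfolding marginal_def kernel_product_Suc
      by (rule marginal_bind_node_step[OF sorted_dag_parents_subset[OF dag] _ spM]) (rule Suc.prems, simp)
    with marginal_marginal[OF sets, of "{1..m}" "{1..M}"] m IH show ?thesis by simp
  qed
qed


lemma measurable_emeasure_kernel:
  assumes "\<kappa> \<in> N \<rightarrow>\<^sub>M prob_algebra M" "B \<in> sets M"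
  shows "(\<lambda>x. emeasure (\<kappa> x) B) \<in> borel_measurable N"
  by (rule measurable_compose[OF measurable_prob_algebraD[OF assms(1)] measurable_emeasure_subprob_algebra[OF assms(2)]])

text \<open>For fixed \<open>B\<close>, both evaluations are densities, with respect to the marginal
  on \<open>P\<close>, of the measure that maps \<open>A\<close> to the probability of
  \<open>A\<close> and \<open>B\<close> occurring jointly; densities are unique almost everywhere.
  The exceptional null set may depend on \<open>B\<close>.\<close>

lemma is_cond_distr_AE_eq:
  assumes \<mu>: "\<mu> \<in> space (prob_algebra (states d K))" and P: "P \<subseteq> {1..K}"
    and \<kappa>: "is_cond_distr K d \<mu> k P \<kappa>" "is_cond_distr K d \<mu> k P \<kappa>'" and B: "B \<in> sets (cube (d k))"
  shows "AE y in marginal d \<mu> P. emeasure (\<kappa> y) B = emeasure (\<kappa>' y) B"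
proof -
  have sp: "marginal d \<mu> P \<in> space (prob_algebra (state_space d P))" by (rule marginal_space[OF \<mu> P])
  hence sets: "sets (marginal d \<mu> P) = sets (state_space d P)" by (simp add: space_prob_algebra)
  interpret prob_space "marginal d \<mu> P" using sp by (simp add: space_prob_algebra)
  have mk: "\<kappa> \<in> state_space d P \<rightarrow>\<^sub>M prob_algebra (cube (d k))" "\<kappa>' \<in> state_space d P \<rightarrow>\<^sub>M prob_algebra (cube (d k))"
    using \<kappa> by (simp_all add: is_cond_distr_def)
  have m: "(\<lambda>y. emeasure (\<kappa> y) B) \<in> borel_measurable (marginal d \<mu> P)"
    "(\<lambda>y. emeasure (\<kappa>' y) B) \<in> borel_measurable (marginal d \<mu> P)"
    using measurable_emeasure_kernel[OF mk(1) B] measurable_emeasure_kernel[OF mk(2) B]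
    by (simp_all only: measurable_cong_sets[OF sets refl])
  show ?thesis
  proof (rule density_unique[OF m], rule measure_eqI)
    fix A assume "A \<in> sets (density (marginal d \<mu> P) (\<lambda>y. emeasure (\<kappa> y) B))"
    hence A: "A \<in> sets (marginal d \<mu> P)" "A \<in> sets (state_space d P)" using sets by simp_all
    show "emeasure (density (marginal d \<mu> P) (\<lambda>y. emeasure (\<kappa> y) B)) A =
        emeasure (density (marginal d \<mu> P) (\<lambda>y. emeasure (\<kappa>' y) B)) A"
      using \<kappa> A(2) B by (simp add: emeasure_density[OF m(1) A(1)] emeasure_density[OF m(2) A(1)]
          is_cond_distr_def flip: marginal_def)
  qed simp
qed

text \<open>Boxes generate the product sigma-algebra and are stable under intersection, so it
  suffices to compare the measures on them. A box involves a single set \<open>B\<close> at the new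
  node; hence null sets that depend on \<open>B\<close> do no harm.\<close>

lemma bind_node_step_cong:
  assumes pa: "parents E (Suc m) \<subseteq> {1..m}"
    and \<kappa>: "\<kappa> (Suc m) \<in> state_space d (parents E (Suc m)) \<rightarrow>\<^sub>M prob_algebra (cube (d (Suc m)))"
    and \<kappa>': "\<kappa>' (Suc m) \<in> state_space d (parents E (Suc m)) \<rightarrow>\<^sub>M prob_algebra (cube (d (Suc m)))"
    and N: "N \<in> space (prob_algebra (states d m))"
    and AE: "\<And>B. B \<in> sets (cube (d (Suc m))) \<Longrightarrow>
       AE y in marginal d N (parents E (Suc m)). emeasure (\<kappa> (Suc m) y) B = emeasure (\<kappa>' (Suc m) y) B"
  shows "N \<bind> node_step E d \<kappa> m = N \<bind> node_step E d \<kappa>' m"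
proof (rule measure_eqI_PiM_finite[where I = "{1..Suc m}" and M = "\<lambda>i. cube (d i)" and A = "\<lambda>_. space (states d (Suc m))"])
  note B1 = bind_node_step_space[where \<kappa> = \<kappa>, OF pa \<kappa> N, unfolded space_prob_algebra]
  note B2 = bind_node_step_space[where \<kappa> = \<kappa>', OF pa \<kappa>' N, unfolded space_prob_algebra]
  show "sets (N \<bind> node_step E d \<kappa> m) = sets (Pi\<^sub>M {1..Suc m} (\<lambda>i. cube (d i)))"
    "sets (N \<bind> node_step E d \<kappa>' m) = sets (Pi\<^sub>M {1..Suc m} (\<lambda>i. cube (d i)))"
    using B1 B2 by (simp_all add: state_space_def)
  show "range (\<lambda>_::nat. space (states d (Suc m))) \<subseteq> prod_algebra {1..Suc m} (\<lambda>i. cube (d i))"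
    unfolding space_state_space by (auto intro!: prod_algebraI_finite)
  show "(\<Union>i::nat. space (states d (Suc m))) = space (Pi\<^sub>M {1..Suc m} (\<lambda>i. cube (d i)))"
    by (simp add: state_space_def)
  show "emeasure (N \<bind> node_step E d \<kappa> m) (space (states d (Suc m))) \<noteq> \<infinity>"
    using B1 prob_space.emeasure_le_1[of "N \<bind> node_step E d \<kappa> m" "space (states d (Suc m))"]
    by (auto simp: top_unique)
  fix A assume A: "\<And>i. i \<in> {1..Suc m} \<Longrightarrow> A i \<in> sets (cube (d i))"
  let ?P = "parents E (Suc m)"
  have setsN: "sets N = sets (states d m)" using N by (simp add: space_prob_algebra)
  have Pm: "(\<lambda>x. restrict x ?P) \<in> N \<rightarrow>\<^sub>M state_space d ?P"
    using measurable_state_restrict[OF pa] by (simp only: measurable_cong_sets[OF setsN refl])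
  have box: "PiE {1..Suc m} A \<in> sets (states d (Suc m))"
    unfolding state_space_def using A by (intro sets_PiM_I_finite) auto
  have mem: "x(Suc m := y) \<in> PiE {1..Suc m} A \<longleftrightarrow> x \<in> PiE {1..m} A \<and> y \<in> A (Suc m)"
    if "x \<in> extensional {1..m}" for x y
    using that unfolding atLeast1_Suc by (auto simp: PiE_iff extensional_def)
  have eq: "emeasure (N \<bind> node_step E d \<kappa> m) (PiE {1..Suc m} A) =
      (\<integral>\<^sup>+x. indicator (PiE {1..m} A) x * emeasure (\<kappa> (Suc m) (restrict x ?P)) (A (Suc m)) \<partial>N)"
    if \<kappa>: "\<kappa> (Suc m) \<in> state_space d ?P \<rightarrow>\<^sub>M prob_algebra (cube (d (Suc m)))" for \<kappa>
  proof -
    have box': "PiE {1..Suc m} A \<in> sets (N \<bind> node_step E d \<kappa> m)"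
      using bind_node_step_space[where \<kappa> = \<kappa>, OF pa \<kappa> N] box by (simp add: space_prob_algebra)
    have "emeasure (N \<bind> node_step E d \<kappa> m) (PiE {1..Suc m} A) =
      (\<integral>\<^sup>+x. indicator (PiE {1..Suc m} A) x \<partial>(N \<bind> node_step E d \<kappa> m))"
      using nn_integral_indicator[OF box'] by simp
    also have "\<dots> = (\<integral>\<^sup>+x. \<integral>\<^sup>+y. indicator (PiE {1..Suc m} A) (x(Suc m := y)) \<partial>\<kappa> (Suc m) (restrict x ?P) \<partial>N)"
      by (rule nn_integral_bind_node_step[where \<kappa> = \<kappa>, OF pa \<kappa> N]) (use box in simp)
    also have "\<dots> = (\<integral>\<^sup>+x. indicator (PiE {1..m} A) x * emeasure (\<kappa> (Suc m) (restrict x ?P)) (A (Suc m)) \<partial>N)"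
    proof (rule nn_integral_cong)
      fix x assume "x \<in> space N"
      hence x: "x \<in> space (states d m)" using sets_eq_imp_space_eq[OF setsN] by simp
      hence ext: "x \<in> extensional {1..m}" by (simp add: space_state_space PiE_def)
      have s: "A (Suc m) \<in> sets (\<kappa> (Suc m) (restrict x ?P))"
        using kernel_restrict_space[where \<kappa> = \<kappa>, OF pa \<kappa> x] A[of "Suc m"] by (simp add: space_prob_algebra)
      have "(\<integral>\<^sup>+y. indicator (PiE {1..Suc m} A) (x(Suc m := y)) \<partial>\<kappa> (Suc m) (restrict x ?P)) =
        (\<integral>\<^sup>+y. indicator (PiE {1..m} A) x * indicator (A (Suc m)) y \<partial>\<kappa> (Suc m) (restrict x ?P))"
        by (rule nn_integral_cong) (simp only: indicator_def mem[OF ext], simp)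
      also have "\<dots> = indicator (PiE {1..m} A) x * emeasure (\<kappa> (Suc m) (restrict x ?P)) (A (Suc m))"
        using s by (simp add: nn_integral_cmult)
      finally show "(\<integral>\<^sup>+y. indicator (PiE {1..Suc m} A) (x(Suc m := y)) \<partial>\<kappa> (Suc m) (restrict x ?P)) =
          indicator (PiE {1..m} A) x * emeasure (\<kappa> (Suc m) (restrict x ?P)) (A (Suc m))" .
    qed
    finally show ?thesis .
  qed
  have "AE x in N. emeasure (\<kappa> (Suc m) (restrict x ?P)) (A (Suc m)) = emeasure (\<kappa>' (Suc m) (restrict x ?P)) (A (Suc m))"
    using AE_distrD[OF Pm AE[of "A (Suc m)", unfolded marginal_def]] A[of "Suc m"] by simp
  thus "emeasure (N \<bind> node_step E d \<kappa> m) (PiE {1..Suc m} A) = emeasure (N \<bind> node_step E d \<kappa>' m) (PiE {1..Suc m} A)"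
    unfolding eq[of \<kappa>, OF \<kappa>] eq[of \<kappa>', OF \<kappa>'] by (intro nn_integral_cong_AE) auto
qed simp

text \<open>The definition of \<open>graph_measures\<close> and the Lipschitz condition may refer to different versions
  of the conditional distributions. The locale fixes the Lipschitz versions; \<open>markov\<close> says that \<open>\<mu>\<close>
  disintegrates along them as well.\<close>

locale lipschitz_model =
  fixes K :: nat and E :: "(nat \<times> nat) set" and d :: "nat \<Rightarrow> nat" and L :: real
    and \<mu> :: "(nat \<Rightarrow> nat \<Rightarrow> real) measure"
    and \<kappa> :: "nat \<Rightarrow> (nat \<Rightarrow> nat \<Rightarrow> real) \<Rightarrow> (nat \<Rightarrow> real) measure"
  assumes dag: "sorted_dag K E" and L: "0 < L"
    and \<mu>: "\<mu> \<in> space (prob_algebra (states d K))"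
    and cond: "\<And>k. k \<in> {1..K} \<Longrightarrow> is_cond_distr K d \<mu> k (parents E k) (\<kappa> k)"
    and markov: "\<And>m. m < K \<Longrightarrow> marginal d \<mu> {1..m} \<bind> node_step E d \<kappa> m = marginal d \<mu> {1..Suc m}"
    and kernel_lipschitz: "\<And>k x x'. k \<in> {1..K} \<Longrightarrow> parents E k \<noteq> {} \<Longrightarrow>
       x \<in> space (state_space d (parents E k)) \<Longrightarrow> x' \<in> space (state_space d (parents E k)) \<Longrightarrow>
       wasserstein (cube_dist (d k)) (\<kappa> k x) (\<kappa> k x') \<le> ennreal (L * state_dist d (parents E k) x x')"

lemma lipschitz_graph_measures_model:
  assumes dag: "sorted_dag K E" and L: "0 < L" and \<mu>Q: "\<mu> \<in> lipschitz_graph_measures K E d L"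
  obtains \<kappa> where "lipschitz_model K E d L \<mu> \<kappa>"
proof -
  from \<mu>Q have \<mu>: "\<mu> \<in> space (prob_algebra (states d K))"
    by (simp add: lipschitz_graph_measures_def graph_measures_def)
  from \<mu>Q obtain \<kappa>0 where c0: "\<And>k. k \<in> {1..K} \<Longrightarrow> is_cond_distr K d \<mu> k (parents E k) (\<kappa>0 k)"
    and \<mu>0: "\<mu> = kernel_product E d \<kappa>0 K"
    unfolding lipschitz_graph_measures_def graph_measures_def by blast
  have "\<forall>k. \<exists>\<kappa>. k \<in> {1..K} \<longrightarrow> is_cond_distr K d \<mu> k (parents E k) \<kappa> \<and>
     (parents E k \<noteq> {} \<longrightarrow> (\<forall>x\<in>space (state_space d (parents E k)). \<forall>x'\<in>space (state_space d (parents E k)).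
             wasserstein (cube_dist (d k)) (\<kappa> x) (\<kappa> x')
               \<le> ennreal (L * state_dist d (parents E k) x x')))"
  proof
    fix k
    show "\<exists>\<kappa>. k \<in> {1..K} \<longrightarrow> is_cond_distr K d \<mu> k (parents E k) \<kappa> \<and>
     (parents E k \<noteq> {} \<longrightarrow> (\<forall>x\<in>space (state_space d (parents E k)). \<forall>x'\<in>space (state_space d (parents E k)).
             wasserstein (cube_dist (d k)) (\<kappa> x) (\<kappa> x')
               \<le> ennreal (L * state_dist d (parents E k) x x')))"
    proof (cases "k \<in> {2..K}")
      case True
      thus ?thesis using \<mu>Q unfolding lipschitz_graph_measures_def by blast
    next
      case False
      \<comment> \<open>The Lipschitz condition starts at node 2. Node 1 has no parents, so there
        the factorising version can be taken.\<close>
      have "parents E k = {}" if "k \<in> {1..K}"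
      proof -
        have "k = Suc 0" using that False by auto
        thus ?thesis using sorted_dag_parents_subset[OF dag, of 0] by simp
      qed
      thus ?thesis using c0[of k] by blast
    qed
  qed
  from choice[OF this] obtain \<kappa> where \<kappa>: "\<And>k. k \<in> {1..K} \<Longrightarrow> is_cond_distr K d \<mu> k (parents E k) (\<kappa> k)"
    "\<And>k x x'. k \<in> {1..K} \<Longrightarrow> parents E k \<noteq> {} \<Longrightarrow>
       x \<in> space (state_space d (parents E k)) \<Longrightarrow> x' \<in> space (state_space d (parents E k)) \<Longrightarrow>
       wasserstein (cube_dist (d k)) (\<kappa> k x) (\<kappa> k x') \<le> ennreal (L * state_dist d (parents E k) x x')"
    by blast
  have "marginal d \<mu> {1..m} \<bind> node_step E d \<kappa> m = marginal d \<mu> {1..Suc m}" if m: "m < K" for m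
  proof -
    have k: "Suc m \<in> {1..K}" using m by auto
    have mk: "\<kappa>0 k \<in> state_space d (parents E k) \<rightarrow>\<^sub>M prob_algebra (cube (d k))"
      "\<kappa> k \<in> state_space d (parents E k) \<rightarrow>\<^sub>M prob_algebra (cube (d k))" if "k \<in> {1..K}" for k
      using c0[OF that] \<kappa>(1)[OF that] by (simp_all add: is_cond_distr_def)
    note pa = sorted_dag_parents_subset[OF dag, of m]
    \<comment> \<open>The Lipschitz kernel is exchanged for \<open>\<kappa>0\<close>, along which
      \<open>\<mu>\<close> is known to be a product; marginals of the product are its partial
      products.\<close>
    have "marginal d \<mu> {1..m} \<bind> node_step E d \<kappa> m = marginal d \<mu> {1..m} \<bind> node_step E d \<kappa>0 m"
    proof (rule bind_node_step_cong[where \<kappa> = \<kappa> and \<kappa>' = \<kappa>0, OF pa mk(2)[OF k] mk(1)[OF k] marginal_space[OF \<mu>]])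
      show "{1..m} \<subseteq> {1..K}" using m by auto
      fix B assume B: "B \<in> sets (cube (d (Suc m)))"
      have eq: "marginal d (marginal d \<mu> {1..m}) (parents E (Suc m)) = marginal d \<mu> (parents E (Suc m))"
        using \<mu> m by (intro marginal_marginal[OF _ pa]) (auto simp: space_prob_algebra)
      have "parents E (Suc m) \<subseteq> {1..K}" using pa m by fastforce
      thus "AE y in marginal d (marginal d \<mu> {1..m}) (parents E (Suc m)). emeasure (\<kappa> (Suc m) y) B = emeasure (\<kappa>0 (Suc m) y) B"
        unfolding eq by (rule is_cond_distr_AE_eq[OF \<mu> _ \<kappa>(1)[OF k] c0[OF k] B])
    qed
    also have "\<dots> = kernel_product E d \<kappa>0 m \<bind> node_step E d \<kappa>0 m"
      unfolding \<mu>0 using m mk(1) by (subst marginal_kernel_product[OF dag, of m]) auto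
    also have "kernel_product E d \<kappa>0 m \<bind> node_step E d \<kappa>0 m = marginal d \<mu> {1..Suc m}"
      unfolding \<mu>0 kernel_product_Suc[symmetric]
      using m mk(1) by (intro marginal_kernel_product[OF dag, symmetric]) auto
    finally show ?thesis .
  qed
  with dag L \<mu> \<kappa> have "lipschitz_model K E d L \<mu> \<kappa>" by unfold_locales
  thus thesis by (rule that)
qed

section \<open>Centred empirical sums\<close>

lemmas bochner_sums = Bochner_Integration.integral_sum Bochner_Integration.integrable_sum
lemmas bochner_cong = Bochner_Integration.integral_cong[OF refl]

text \<open>By independence and centring the mixed terms of the square vanish, and only the
  \<open>n\<close> diagonal terms remain.\<close>

lemma (in prob_space) integral_iid_sum_square:
  fixes \<xi> :: "'a \<Rightarrow> real"
  assumes \<xi>: "\<xi> \<in> borel_measurable M" "\<And>x. x \<in> space M \<Longrightarrow> \<bar>\<xi> x\<bar> \<le> 1" and mean: "(\<integral>x. \<xi> x \<partial>M) = 0"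
  shows "(\<integral>X. (\<Sum>i<n. \<xi> (X i))\<^sup>2 \<partial>Pi\<^sub>M {..<n} (\<lambda>_. M)) = real n * (\<integral>x. (\<xi> x)\<^sup>2 \<partial>M)"
proof -
  interpret P: product_sigma_finite "\<lambda>_::nat. M" by (simp add: product_sigma_finite_def sigma_finite_measure_axioms)
  let ?N = "Pi\<^sub>M {..<n} (\<lambda>_. M)"
  interpret N: prob_space ?N by (intro prob_space_PiM prob_space_axioms)
  have int1: "integrable M (\<lambda>x. \<xi> x)"
    using \<xi> by (intro integrable_const_bound[where B = 1] AE_I2) auto
  have sq1: "\<bar>(\<xi> x)\<^sup>2\<bar> \<le> 1" if "x \<in> space M" for x
    using power_le_one[OF abs_ge_zero \<xi>(2)[OF that], of 2] by simp
  have int2: "integrable M (\<lambda>x. (\<xi> x)\<^sup>2)"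
    using \<xi>(1) sq1 by (intro integrable_const_bound[where B = 1] AE_I2) auto
  have comp: "(\<lambda>X. \<xi> (X i)) \<in> borel_measurable ?N" if "i < n" for i
    using measurable_compose[OF measurable_component_singleton[of i "{..<n}" "\<lambda>_. M"] \<xi>(1)] that by simp
  have sp: "X i \<in> space M" if "X \<in> space ?N" "i < n" for X i
    using that by (auto simp: space_PiM PiE_mem)
  have prod: "(\<integral>X. \<xi> (X i) * \<xi> (X j) \<partial>?N) = of_bool (i = j) * (\<integral>x. (\<xi> x)\<^sup>2 \<partial>M)" if ij: "i < n" "j < n" for i j
  proof -
    \<comment> \<open>Each term of the expanded square is written as a product over all coordinates,
      with factor 1 where nothing happens. This covers \<open>i = j\<close> and
      \<open>i \<noteq> j\<close> alike, and Fubini applies to both.\<close>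
    define g where "g l x = (if l = i then \<xi> x else 1) * (if l = j then \<xi> x else 1)" for l x
    have gi: "integrable M (g l)" for l
      using int1 int2 by (cases "l = i"; cases "l = j") (simp_all add: g_def[abs_def] power2_eq_square)
    have "\<xi> (X i) * \<xi> (X j) = (\<Prod>l\<in>{..<n}. g l (X l))" for X
      using ij by (simp add: g_def prod.distrib prod.delta)
    hence "(\<integral>X. \<xi> (X i) * \<xi> (X j) \<partial>?N) = (\<integral>X. (\<Prod>l\<in>{..<n}. g l (X l)) \<partial>?N)" by simp
    also have "\<dots> = (\<Prod>l\<in>{..<n}. \<integral>x. g l x \<partial>M)"
      by (rule P.product_integral_prod) (simp_all add: gi)
    also have "\<dots> = of_bool (i = j) * (\<integral>x. (\<xi> x)\<^sup>2 \<partial>M)"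
    proof (cases "i = j")
      case True
      have "(\<integral>x. g l x \<partial>M) = (if l = i then (\<integral>x. (\<xi> x)\<^sup>2 \<partial>M) else 1)" for l
        using True prob_space by (simp add: g_def power2_eq_square)
      thus ?thesis using True ij by (simp add: prod.delta)
    next
      case False
      have "(\<integral>x. g i x \<partial>M) = 0" using False mean by (simp add: g_def)
      hence "(\<Prod>l\<in>{..<n}. \<integral>x. g l x \<partial>M) = 0" using ij by (intro prod_zero) auto
      thus ?thesis using False by simp
    qed
    finally show ?thesis .
  qed
  have "(\<integral>X. (\<Sum>i<n. \<xi> (X i))\<^sup>2 \<partial>?N) = (\<integral>X. (\<Sum>i<n. \<Sum>j<n. \<xi> (X i) * \<xi> (X j)) \<partial>?N)"
    by (simp add: power2_eq_square sum_product)
  also have "\<dots> = (\<Sum>i<n. \<Sum>j<n. \<integral>X. \<xi> (X i) * \<xi> (X j) \<partial>?N)"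
  proof -
    have ii: "integrable ?N (\<lambda>X. \<xi> (X i) * \<xi> (X j))" if "i < n" "j < n" for i j
      using comp that \<xi>(2) sp
      by (intro N.integrable_const_bound[where B = 1] AE_I2) (auto simp: abs_mult intro!: mult_le_one)
    have "(\<integral>X. (\<Sum>i<n. \<Sum>j<n. \<xi> (X i) * \<xi> (X j)) \<partial>?N) = (\<Sum>i<n. \<integral>X. (\<Sum>j<n. \<xi> (X i) * \<xi> (X j)) \<partial>?N)"
      by (intro bochner_sums ii) auto
    also have "\<dots> = (\<Sum>i<n. \<Sum>j<n. \<integral>X. \<xi> (X i) * \<xi> (X j) \<partial>?N)"
      by (intro sum.cong refl Bochner_Integration.integral_sum ii) auto
    finally show ?thesis .
  qed
  also have "\<dots> = (\<Sum>i<n. \<Sum>j<n. of_bool (i = j) * (\<integral>x. (\<xi> x)\<^sup>2 \<partial>M))"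
    by (intro sum.cong refl prod) auto
  also have "\<dots> = (\<Sum>i<n. \<integral>x. (\<xi> x)\<^sup>2 \<partial>M)"
    by (intro sum.cong refl) (simp flip: sum_distrib_right)
  finally show ?thesis by simp
qed

lemma (in prob_space) iid_sum_integrable:
  fixes \<xi> :: "'a \<Rightarrow> real" and n :: nat
  assumes \<xi>: "\<xi> \<in> borel_measurable M" "\<And>x. x \<in> space M \<Longrightarrow> \<bar>\<xi> x\<bar> \<le> 1"
  shows "integrable (Pi\<^sub>M {..<n} (\<lambda>_. M)) (\<lambda>X. \<bar>\<Sum>i<n. \<xi> (X i)\<bar>)"
    and "integrable (Pi\<^sub>M {..<n} (\<lambda>_. M)) (\<lambda>X. (\<Sum>i<n. \<xi> (X i))\<^sup>2)"
proof -
  let ?N = "Pi\<^sub>M {..<n} (\<lambda>_. M)"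
  let ?T = "\<lambda>X. \<Sum>i<n. \<xi> (X i)"
  interpret N: prob_space ?N by (intro prob_space_PiM prob_space_axioms)
  have comp: "(\<lambda>X. \<xi> (X i)) \<in> borel_measurable ?N" if "i < n" for i
    using measurable_compose[OF measurable_component_singleton[of i "{..<n}" "\<lambda>_. M"] \<xi>(1)] that by simp
  have Tm [measurable]: "?T \<in> borel_measurable ?N"
    using comp by (intro borel_measurable_sum) simp
  have Tb: "\<bar>?T X\<bar> \<le> real n" if "X \<in> space ?N" for X
  proof -
    have "\<bar>?T X\<bar> \<le> (\<Sum>i<n. \<bar>\<xi> (X i)\<bar>)" by (rule sum_abs)
    also have "\<dots> \<le> (\<Sum>i<n. 1)"
      using that by (intro sum_mono \<xi>(2)) (auto simp: space_PiM PiE_mem)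
    finally show ?thesis by simp
  qed
  show "integrable ?N (\<lambda>X. \<bar>?T X\<bar>)"
    using Tb by (intro N.integrable_const_bound[where B = n] AE_I2) auto
  show "integrable ?N (\<lambda>X. (?T X)\<^sup>2)"
    using Tb by (intro N.integrable_const_bound[where B = "(real n)\<^sup>2"] AE_I2) (auto simp: abs_le_square_iff[symmetric])
qed

text \<open>The free weight \<open>c\<close> replaces the square root of the Cauchy--Schwarz inequality. It makes the
  bound linear in \<open>v\<close>, so that it can be summed over all cells of a grid.\<close>

lemma (in prob_space) integral_abs_iid_sum_le:
  fixes \<xi> :: "'a \<Rightarrow> real"
  assumes \<xi>: "\<xi> \<in> borel_measurable M" "\<And>x. x \<in> space M \<Longrightarrow> \<bar>\<xi> x\<bar> \<le> 1" and mean: "(\<integral>x. \<xi> x \<partial>M) = 0"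
    and c: "0 < c" and v: "(\<integral>x. (\<xi> x)\<^sup>2 \<partial>M) \<le> v"
  shows "(\<integral>X. \<bar>\<Sum>i<n. \<xi> (X i)\<bar> \<partial>Pi\<^sub>M {..<n} (\<lambda>_. M)) \<le> real n * v / (2 * c) + c / 2"
proof -
  let ?N = "Pi\<^sub>M {..<n} (\<lambda>_. M)"
  let ?T = "\<lambda>X. \<Sum>i<n. \<xi> (X i)"
  interpret N: prob_space ?N by (intro prob_space_PiM prob_space_axioms)
  note i1 = iid_sum_integrable(1)[OF \<xi>] and i2 = iid_sum_integrable(2)[OF \<xi>]
  have "(\<integral>X. \<bar>?T X\<bar> \<partial>?N) \<le> (\<integral>X. (?T X)\<^sup>2 / (2 * c) + c / 2 \<partial>?N)"
  proof (rule integral_mono[OF i1])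
    show "integrable ?N (\<lambda>X. (?T X)\<^sup>2 / (2 * c) + c / 2)" using i2 by simp
    fix X
    have "0 \<le> (\<bar>?T X\<bar> - c)\<^sup>2" by simp
    thus "\<bar>?T X\<bar> \<le> (?T X)\<^sup>2 / (2 * c) + c / 2"
      using c by (simp add: field_simps power2_eq_square)
  qed
  also have "\<dots> = (\<integral>X. (?T X)\<^sup>2 \<partial>?N) / (2 * c) + c / 2"
    using i2 N.prob_space by simp
  also have "(\<integral>X. (?T X)\<^sup>2 \<partial>?N) = real n * (\<integral>x. (\<xi> x)\<^sup>2 \<partial>M)"
    by (rule integral_iid_sum_square[OF \<xi> mean])
  also have "real n * (\<integral>x. (\<xi> x)\<^sup>2 \<partial>M) / (2 * c) + c / 2 \<le> real n * v / (2 * c) + c / 2"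
    using v c by (simp add: divide_right_mono mult_left_mono)
  finally show ?thesis .
qed

declare One_nat_def [simp del]

section \<open>The bias of the plug-in estimator\<close>

text \<open>A version of the conditional expectation of \<open>h\<close> given the first
  \<open>m\<close> coordinates. Since it is built from a kernel, it has a definite value at every
  state, including grid points that \<open>\<mu>\<close> does not charge; the estimator evaluates it
  exactly there.\<close>

definition backward ::
    "(nat \<times> nat) set \<Rightarrow> (nat \<Rightarrow> (nat \<Rightarrow> nat \<Rightarrow> real) \<Rightarrow> (nat \<Rightarrow> real) measure) \<Rightarrow> nat \<Rightarrow>
     ((nat \<Rightarrow> nat \<Rightarrow> real) \<Rightarrow> real) \<Rightarrow> (nat \<Rightarrow> nat \<Rightarrow> real) \<Rightarrow> real" where
  "backward E \<kappa> m h x = (\<integral>y. h (x(Suc m := y)) \<partial>\<kappa> (Suc m) (restrict x (parents E (Suc m))))"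

lemma (in prob_space) abs_integral_le:
  fixes f :: "'a \<Rightarrow> real"
  assumes "f \<in> borel_measurable M" "\<And>x. x \<in> space M \<Longrightarrow> \<bar>f x\<bar> \<le> B"
  shows "\<bar>\<integral>x. f x \<partial>M\<bar> \<le> B"
proof -
  have i: "integrable M f" using assms by (intro integrable_const_bound[where B = B] AE_I2) auto
  have "\<bar>\<integral>x. f x \<partial>M\<bar> \<le> (\<integral>x. \<bar>f x\<bar> \<partial>M)" by (rule integral_abs_bound)
  also have "\<dots> \<le> (\<integral>x. B \<partial>M)" using i assms(2) by (intro integral_mono) auto
  finally show ?thesis using prob_space by simp
qed

context lipschitz_model
begin

abbreviation (input) "kern m x \<equiv> \<kappa> (Suc m) (restrict x (parents E (Suc m)))"

lemma pa: "parents E (Suc m) \<subseteq> {1..m}"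
  by (rule sorted_dag_parents_subset[OF dag])

lemma finite_parents: "finite (parents E (Suc m))"
  using pa by (rule finite_subset) simp

lemma kernel_measurable:
  "m < K \<Longrightarrow> \<kappa> (Suc m) \<in> state_space d (parents E (Suc m)) \<rightarrow>\<^sub>M prob_algebra (cube (d (Suc m)))"
  using cond[of "Suc m"] by (simp add: is_cond_distr_def)

lemma marginal_prob: "m \<le> K \<Longrightarrow> marginal d \<mu> {1..m} \<in> space (prob_algebra (states d m))"
  by (rule marginal_space[OF \<mu>]) auto

lemma backward_eq_node_step:
  assumes m: "m < K" and h: "h \<in> borel_measurable (states d (Suc m))"
    and x: "x \<in> space (states d m)"
  shows "backward E \<kappa> m h x = (\<integral>y. h y \<partial>node_step E d \<kappa> m x)"
proof -
  have sets: "sets (kern m x) = sets (cube (d (Suc m)))"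
    using kernel_restrict_space[where \<kappa> = \<kappa>, OF pa kernel_measurable[OF m] x] by (simp add: space_prob_algebra)
  have "(\<lambda>y. x(Suc m := y)) \<in> kern m x \<rightarrow>\<^sub>M states d (Suc m)"
    using measurable_state_upd_snd[OF x] by (simp only: measurable_cong_sets[OF sets refl])
  thus ?thesis using h unfolding backward_def node_step_def by (subst integral_distr) simp_all
qed

lemma backward_measurable:
  assumes m: "m < K" and h: "h \<in> borel_measurable (states d (Suc m))"
  shows "backward E \<kappa> m h \<in> borel_measurable (states d m)"
proof -
  have "(\<lambda>x. \<integral>y. h y \<partial>node_step E d \<kappa> m x) \<in> borel_measurable (states d m)"
    by (rule measurable_compose[OF measurable_prob_algebraD[OF measurable_node_step[where \<kappa> = \<kappa>, OF pa kernel_measurable[OF m]]]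
        integral_measurable_subprob_algebra[OF h]])
  thus ?thesis by (subst measurable_cong[OF backward_eq_node_step[OF m h]])
qed

context
  fixes m :: nat and h :: "(nat \<Rightarrow> nat \<Rightarrow> real) \<Rightarrow> real" and B :: real
  assumes m: "m < K" and h: "h \<in> borel_measurable (states d (Suc m))"
    and hB: "\<And>x. x \<in> space (states d (Suc m)) \<Longrightarrow> \<bar>h x\<bar> \<le> B"
begin

lemma kernel_prob:
  assumes "u \<in> space (state_space d (parents E (Suc m)))"
  shows "prob_space (\<kappa> (Suc m) u)" "sets (\<kappa> (Suc m) u) = sets (cube (d (Suc m)))"
    "space (\<kappa> (Suc m) u) = space (cube (d (Suc m)))" "\<kappa> (Suc m) u \<in> space (prob_algebra (cube (d (Suc m))))"
proof -
  show *: "\<kappa> (Suc m) u \<in> space (prob_algebra (cube (d (Suc m))))"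
    by (rule measurable_space[OF kernel_measurable[OF m] assms])
  thus "prob_space (\<kappa> (Suc m) u)" "sets (\<kappa> (Suc m) u) = sets (cube (d (Suc m)))"
    by (simp_all add: space_prob_algebra)
  thus "space (\<kappa> (Suc m) u) = space (cube (d (Suc m)))" by (intro sets_eq_imp_space_eq)
qed

lemma restrict_parents_space:
  "x \<in> space (states d m) \<Longrightarrow> restrict x (parents E (Suc m)) \<in> space (state_space d (parents E (Suc m)))"
  by (rule measurable_space[OF measurable_state_restrict[OF pa]])

lemma section_measurable:
  "x \<in> space (states d m) \<Longrightarrow> (\<lambda>y. h (x(Suc m := y))) \<in> borel_measurable (cube (d (Suc m)))"
  by (rule measurable_compose[OF measurable_state_upd_snd h])

lemma section_bounded:
  "x \<in> space (states d m) \<Longrightarrow> y \<in> space (cube (d (Suc m))) \<Longrightarrow> \<bar>h (x(Suc m := y))\<bar> \<le> B"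
  by (rule hB[OF state_upd_space])

lemma section_integrable:
  assumes "x \<in> space (states d m)" "u \<in> space (state_space d (parents E (Suc m)))"
  shows "integrable (\<kappa> (Suc m) u) (\<lambda>y. h (x(Suc m := y)))"
proof -
  interpret prob_space "\<kappa> (Suc m) u" using kernel_prob(1)[OF assms(2)] .
  show ?thesis using section_measurable[OF assms(1)] section_bounded[OF assms(1)]
    by (intro integrable_const_bound[where B = B] AE_I2)
      (simp_all only: kernel_prob(3)[OF assms(2)] real_norm_def measurable_cong_sets[OF kernel_prob(2)[OF assms(2)] refl])
qed

lemma backward_bounded:
  assumes x: "x \<in> space (states d m)" shows "\<bar>backward E \<kappa> m h x\<bar> \<le> B"
  unfolding backward_def
proof (rule prob_space.abs_integral_le)
  note u = restrict_parents_space[OF x]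
  show "prob_space (kern m x)" by (rule kernel_prob(1)[OF u])
  show "(\<lambda>y. h (x(Suc m := y))) \<in> borel_measurable (kern m x)"
    using section_measurable[OF x] by (simp only: measurable_cong_sets[OF kernel_prob(2)[OF u] refl])
  show "\<bar>h (x(Suc m := y))\<bar> \<le> B" if "y \<in> space (kern m x)" for y
    using section_bounded[OF x] that by (simp add: kernel_prob(3)[OF u])
qed

text \<open>The tower property of conditional expectation. The disintegration formula is stated for
  nonnegative functions, so \<open>h\<close> is first shifted by its bound \<open>B\<close>.\<close>

lemma integral_backward:
  "(\<integral>x. backward E \<kappa> m h x \<partial>marginal d \<mu> {1..m}) = (\<integral>x. h x \<partial>marginal d \<mu> {1..Suc m})"
proof -
  let ?N = "marginal d \<mu> {1..m}" and ?N' = "marginal d \<mu> {1..Suc m}"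
  let ?P = "parents E (Suc m)"
  have N: "?N \<in> space (prob_algebra (states d m))" using m by (intro marginal_prob) simp
  hence setsN: "sets ?N = sets (states d m)" by (simp add: space_prob_algebra)
  interpret N: prob_space ?N using N by (simp add: space_prob_algebra)
  have N': "?N' \<in> space (prob_algebra (states d (Suc m)))" using m by (intro marginal_prob) simp
  hence setsN': "sets ?N' = sets (states d (Suc m))" by (simp add: space_prob_algebra)
  interpret N': prob_space ?N' using N' by (simp add: space_prob_algebra)
  note spN = sets_eq_imp_space_eq[OF setsN] and spN' = sets_eq_imp_space_eq[OF setsN']
  have bm: "backward E \<kappa> m h \<in> borel_measurable ?N"
    using backward_measurable[OF m h] by (simp only: measurable_cong_sets[OF setsN refl])
  have hm: "h \<in> borel_measurable ?N'" using h by (simp only: measurable_cong_sets[OF setsN' refl])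
  have bi: "integrable ?N (backward E \<kappa> m h)"
    using bm backward_bounded by (intro N.integrable_const_bound[where B = B] AE_I2) (simp_all add: spN)
  have hi: "integrable ?N' h"
    using hm hB by (intro N'.integrable_const_bound[where B = B] AE_I2) (simp_all add: spN')
  have pos': "0 \<le> h x + B" if "x \<in> space ?N'" for x
    using hB[of x] that unfolding spN' by linarith
  have pos: "0 \<le> backward E \<kappa> m h x + B" if "x \<in> space ?N" for x
    using backward_bounded[of x] that unfolding spN by linarith
  have "ennreal (\<integral>x. h x + B \<partial>?N') = (\<integral>\<^sup>+x. ennreal (h x + B) \<partial>?N')"
    using hi pos' by (intro nn_integral_eq_integral[symmetric] AE_I2) auto
  also have "\<dots> = (\<integral>\<^sup>+x. ennreal (h x + B) \<partial>(?N \<bind> node_step E d \<kappa> m))"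
    by (simp only: markov[OF m])
  also have "\<dots> = (\<integral>\<^sup>+x. \<integral>\<^sup>+y. ennreal (h (x(Suc m := y)) + B) \<partial>kern m x \<partial>?N)"
  proof (rule nn_integral_bind_node_step[where \<kappa> = \<kappa>, OF pa kernel_measurable[OF m] N])
    show "(\<lambda>x. ennreal (h x + B)) \<in> borel_measurable (states d (Suc m))"
      by (rule measurable_compose[OF _ measurable_ennreal], rule borel_measurable_add[OF h]) simp
  qed
  also have "\<dots> = (\<integral>\<^sup>+x. ennreal (backward E \<kappa> m h x + B) \<partial>?N)"
  proof (rule nn_integral_cong)
    fix x assume "x \<in> space ?N"
    hence x: "x \<in> space (states d m)" using spN by simp
    note u = restrict_parents_space[OF x]
    interpret \<kappa>: prob_space "kern m x" by (rule kernel_prob(1)[OF u])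
    have "(\<integral>\<^sup>+y. ennreal (h (x(Suc m := y)) + B) \<partial>kern m x) =
        ennreal (\<integral>y. h (x(Suc m := y)) + B \<partial>kern m x)"
    proof (intro nn_integral_eq_integral AE_I2)
      show "integrable (kern m x) (\<lambda>y. h (x(Suc m := y)) + B)"
        using section_integrable[OF x u] by simp
      fix y assume "y \<in> space (kern m x)"
      hence "\<bar>h (x(Suc m := y))\<bar> \<le> B" using section_bounded[OF x] by (simp add: kernel_prob(3)[OF u])
      thus "0 \<le> h (x(Suc m := y)) + B" by linarith
    qed
    also have "(\<integral>y. h (x(Suc m := y)) + B \<partial>kern m x) = backward E \<kappa> m h x + B"
      using section_integrable[OF x u] \<kappa>.prob_space by (simp add: backward_def)
    finally show "(\<integral>\<^sup>+y. ennreal (h (x(Suc m := y)) + B) \<partial>kern m x) = ennreal (backward E \<kappa> m h x + B)" .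
  qed
  also have "\<dots> = ennreal (\<integral>x. backward E \<kappa> m h x + B \<partial>?N)"
    using bi pos by (intro nn_integral_eq_integral AE_I2) auto
  finally have eq: "ennreal (\<integral>x. h x + B \<partial>?N') = ennreal (\<integral>x. backward E \<kappa> m h x + B \<partial>?N)" .
  have "0 \<le> (\<integral>x. h x + B \<partial>?N')"
    using pos' by (intro integral_nonneg_AE AE_I2) auto
  moreover have "0 \<le> (\<integral>x. backward E \<kappa> m h x + B \<partial>?N)"
    using pos by (intro integral_nonneg_AE AE_I2) auto
  ultimately have "(\<integral>x. h x + B \<partial>?N') = (\<integral>x. backward E \<kappa> m h x + B \<partial>?N)" using eq by simp
  thus ?thesis using bi hi N.prob_space N'.prob_space by simp
qed

context
  fixes \<Lambda> :: real
  assumes \<Lambda>: "0 < \<Lambda>"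
    and lip: "\<And>x x'. x \<in> space (states d (Suc m)) \<Longrightarrow> x' \<in> space (states d (Suc m)) \<Longrightarrow>
       \<bar>h x - h x'\<bar> \<le> \<Lambda> * state_dist d {1..Suc m} x x'"
begin

lemma section_lipschitz:
  assumes x: "x \<in> space (states d m)" "x' \<in> space (states d m)"
    and y: "y \<in> space (cube (d (Suc m)))" "y' \<in> space (cube (d (Suc m)))"
    and c: "state_dist d {1..m} x x' \<le> c" "cube_dist (d (Suc m)) y y' \<le> c"
  shows "\<bar>h (x(Suc m := y)) - h (x'(Suc m := y'))\<bar> \<le> \<Lambda> * c"
proof -
  have "state_dist d {1..Suc m} (x(Suc m := y)) (x'(Suc m := y')) \<le> c"
    unfolding atLeast1_Suc using c by (intro state_dist_insert_le) auto
  thus ?thesis using lip[OF state_upd_space[OF x(1) y(1)] state_upd_space[OF x(2) y(2)]] \<Lambda>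
    by (meson mult_left_mono less_imp_le order_trans)
qed

lemma kernel_integral_lipschitz:
  assumes x: "x \<in> space (states d m)"
    and u: "u \<in> space (state_space d (parents E (Suc m)))" "u' \<in> space (state_space d (parents E (Suc m)))"
  shows "\<bar>(\<integral>y. h (x(Suc m := y)) \<partial>\<kappa> (Suc m) u) - (\<integral>y. h (x(Suc m := y)) \<partial>\<kappa> (Suc m) u')\<bar>
     \<le> \<Lambda> * (L * state_dist d (parents E (Suc m)) u u')"
proof (cases "parents E (Suc m) = {}")
  \<comment> \<open>Without parents the kernel has a single possible argument. The locale gives a
    Wasserstein bound only for nodes with parents, so this case is separate.\<close>
  case True
  have "u = u'" using u True by (simp add: space_state_space)
  thus ?thesis using L \<Lambda> finite_parents by simp
next
  case False
  show ?thesis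
  proof (rule integral_diff_le_wasserstein[OF kernel_prob(4)[OF u(1)] kernel_prob(4)[OF u(2)]
        section_measurable[OF x] section_bounded[OF x]])
    show "\<bar>h (x(Suc m := y)) - h (x(Suc m := y'))\<bar> \<le> \<Lambda> * cube_dist (d (Suc m)) y y'"
      if "y \<in> space (cube (d (Suc m)))" "y' \<in> space (cube (d (Suc m)))" for y y'
      using that by (intro section_lipschitz x) auto
    show "wasserstein (cube_dist (d (Suc m))) (\<kappa> (Suc m) u) (\<kappa> (Suc m) u') \<le> ennreal (L * state_dist d (parents E (Suc m)) u u')"
      using m by (intro kernel_lipschitz False u) auto
  qed (use L \<Lambda> finite_parents in auto)
qed

text \<open>Changing the integrand under a fixed kernel costs a factor \<open>\<Lambda>\<close>, and
  changing the kernel under a fixed integrand costs \<open>\<Lambda> * L\<close>. So each node that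
  is integrated out multiplies the Lipschitz constant by \<open>1 + L\<close>.\<close>

lemma backward_lipschitz:
  assumes x: "x \<in> space (states d m)" "x' \<in> space (states d m)"
  shows "\<bar>backward E \<kappa> m h x - backward E \<kappa> m h x'\<bar> \<le> (1 + L) * \<Lambda> * state_dist d {1..m} x x'"
proof -
  let ?P = "parents E (Suc m)"
  let ?\<kappa> = "kern m x" and ?\<kappa>' = "\<kappa> (Suc m) (restrict x' ?P)"
  note u = restrict_parents_space[OF x(1)] restrict_parents_space[OF x(2)]
  interpret \<kappa>: prob_space ?\<kappa> by (rule kernel_prob(1)[OF u(1)])
  note i = section_integrable[OF x(1) u(1)] section_integrable[OF x(2) u(1)]
  have "\<bar>(\<integral>y. h (x(Suc m := y)) \<partial>?\<kappa>) - (\<integral>y. h (x'(Suc m := y)) \<partial>?\<kappa>)\<bar> = \<bar>\<integral>y. h (x(Suc m := y)) - h (x'(Suc m := y)) \<partial>?\<kappa>\<bar>"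
    using i by simp
  also have "\<dots> \<le> \<Lambda> * state_dist d {1..m} x x'"
  proof (rule \<kappa>.abs_integral_le)
    show "(\<lambda>y. h (x(Suc m := y)) - h (x'(Suc m := y))) \<in> borel_measurable ?\<kappa>" using i by auto
    show "\<bar>h (x(Suc m := y)) - h (x'(Suc m := y))\<bar> \<le> \<Lambda> * state_dist d {1..m} x x'" if "y \<in> space ?\<kappa>" for y
      using that by (intro section_lipschitz x) (simp_all add: kernel_prob(3)[OF u(1)])
  qed
  finally have 1: "\<bar>(\<integral>y. h (x(Suc m := y)) \<partial>?\<kappa>) - (\<integral>y. h (x'(Suc m := y)) \<partial>?\<kappa>)\<bar> \<le> \<Lambda> * state_dist d {1..m} x x'" .
  have "\<bar>(\<integral>y. h (x'(Suc m := y)) \<partial>?\<kappa>) - (\<integral>y. h (x'(Suc m := y)) \<partial>?\<kappa>')\<bar> \<le> \<Lambda> * (L * state_dist d ?P (restrict x ?P) (restrict x' ?P))"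
    by (rule kernel_integral_lipschitz[OF x(2) u])
  also have "\<dots> \<le> \<Lambda> * (L * state_dist d {1..m} x x')"
    using state_dist_mono[OF _ pa, of m d x x'] \<Lambda> L by simp
  finally show ?thesis using 1 unfolding backward_def by (simp add: algebra_simps)
qed

end

end

end

text \<open>A Lipschitz function of the finest cell is a sum of increments over the scales, the \<open>j\<close>-th of
  which depends on the cell of scale \<open>j\<close> only and is of the order \<open>2\<^sup>-\<^sup>j\<close>.\<close>

lemma chaining:
  assumes lip: "\<And>y y'. y \<in> space (cube m) \<Longrightarrow> y' \<in> space (cube m) \<Longrightarrow> \<bar>g y - g y'\<bar> \<le> \<Lambda> * cube_dist m y y'"
    and \<Lambda>: "0 \<le> \<Lambda>"
  obtains c :: real and D :: "nat \<Rightarrow> (nat \<Rightarrow> real) \<Rightarrow> real"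
  where "\<And>j b. b \<in> cube_grid m j \<Longrightarrow> \<bar>D j b\<bar> \<le> \<Lambda> * (2 / 2 ^ j)"
    and "\<And>J y. y \<in> space (cube m) \<Longrightarrow>
       g (cube_quant m J y) = c + (\<Sum>j\<le>J. \<Sum>b\<in>cube_grid m j. D j b * of_bool (cube_quant m j y = b))"
proof -
  have "(\<lambda>i\<in>{..<m}. 0) \<in> space (cube m)" by (auto simp: space_cube)
  then obtain a where a: "a \<in> space (cube m)" by blast
  \<comment> \<open>Telescoping increments: the value at a cell minus the value at the coarser cell
    containing it, and at scale 0 minus the value at a reference point. Neighbouring scales differ
    by at most \<open>1 / 2 ^ i\<close>, which is \<open>2 / 2 ^ j\<close> for
    \<open>j = Suc i\<close>.\<close>
  define D where "D j b = (case j of 0 \<Rightarrow> g b - g a | Suc i \<Rightarrow> g b - g (cube_quant m i b))" for j b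
  have pick: "(\<Sum>b\<in>cube_grid m j. D j b * of_bool (cube_quant m j y = b)) = D j (cube_quant m j y)"
    if "y \<in> space (cube m)" for j y
  proof -
    have "(\<Sum>b\<in>cube_grid m j. D j b * of_bool (cube_quant m j y = b)) = (\<Sum>b\<in>cube_grid m j. if cube_quant m j y = b then D j b else 0)"
      by (rule sum.cong[OF refl]) simp
    thus ?thesis using cube_quant_in_grid[OF that] by simp
  qed
  show thesis
  proof (rule that[of D "g a"])
    fix j b assume b: "b \<in> cube_grid m j"
    hence bs: "b \<in> space (cube m)" using cube_grid_subset by blast
    show "\<bar>D j b\<bar> \<le> \<Lambda> * (2 / 2 ^ j)"
    proof (cases j)
      case 0
      have "\<bar>g b - g a\<bar> \<le> \<Lambda> * cube_dist m b a" by (rule lip[OF bs a])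
      also have "\<dots> \<le> \<Lambda> * 2"
        using cube_dist_le_1[OF bs a] \<Lambda> by (intro mult_left_mono) auto
      finally show ?thesis using 0 by (simp add: D_def)
    next
      case (Suc i)
      have "\<bar>g b - g (cube_quant m i b)\<bar> \<le> \<Lambda> * cube_dist m b (cube_quant m i b)"
        using cube_quant_in_grid[OF bs] cube_grid_subset by (intro lip[OF bs]) blast
      also have "\<dots> \<le> \<Lambda> * (1 / 2 ^ i)"
        using cube_dist_quant[of m i b] \<Lambda> by (intro mult_left_mono) (simp_all add: cube_dist_commute)
      finally show ?thesis using Suc by (simp add: D_def)
    qed
  next
    fix J y assume y: "y \<in> space (cube m)"
    show "g (cube_quant m J y) = g a + (\<Sum>j\<le>J. \<Sum>b\<in>cube_grid m j. D j b * of_bool (cube_quant m j y = b))"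
      unfolding pick[OF y]
    proof (induction J)
      case (Suc J)
      thus ?case by (simp add: D_def cube_quant_quant)
    qed (simp add: D_def)
  qed
qed

text \<open>\<open>deviation\<close> is the centred contribution of a sample point \<open>x\<close> to the number of sample
  points whose parent coordinates of the node \<open>Suc m\<close> lie in the cell \<open>a\<close> of the finest scale \<open>J\<close>
  and whose own coordinate lies in the cell \<open>b\<close> of scale \<open>j\<close>.\<close>

definition deviation where
  "deviation E d \<kappa> J m a j b x =
     of_bool (state_quant d (parents E (Suc m)) J (restrict x (parents E (Suc m))) = a) *
     (of_bool (cube_quant (d (Suc m)) j (x (Suc m)) = b) -
      measure (\<kappa> (Suc m) (restrict x (parents E (Suc m)))) {y \<in> space (cube (d (Suc m))). cube_quant (d (Suc m)) j y = b})"

text \<open>The weights \<open>2 / 2 ^ j\<close> are the bounds on the chaining coefficients for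
  Lipschitz constant 1. The sum therefore dominates the fluctuation in the cell \<open>a\<close> for
  every such function simultaneously.\<close>

definition cell_deviation where
  "cell_deviation E d \<kappa> n J m X a =
     (\<Sum>j\<le>J. \<Sum>b\<in>cube_grid (d (Suc m)) j. 2 / 2 ^ j * \<bar>\<Sum>i<n. deviation E d \<kappa> J m a j b (X i)\<bar>)"

definition total_deviation where
  "total_deviation E d \<kappa> n J m X = (\<Sum>a\<in>state_grid d (parents E (Suc m)) J. cell_deviation E d \<kappa> n J m X a)"

lemma cell_deviation_nonneg: "0 \<le> cell_deviation E d \<kappa> n J m X a"
  unfolding cell_deviation_def by (intro sum_nonneg mult_nonneg_nonneg) auto

text \<open>A class occurs as often as it has members, each time divided by its size, so every
  nonempty class contributes exactly once. This is where the cell counts drop out.\<close>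

lemma sum_classes_le:
  fixes n :: nat
  assumes fin: "finite G" and r: "\<And>i. i < n \<Longrightarrow> \<rho> i \<in> G" and F: "\<And>a. (0::real) \<le> F a"
  shows "(\<Sum>i<n. F (\<rho> i) / card {i'\<in>{..<n}. \<rho> i' = \<rho> i}) \<le> (\<Sum>a\<in>G. F a)"
proof -
  have "(\<Sum>i<n. F (\<rho> i) / card {i'\<in>{..<n}. \<rho> i' = \<rho> i}) =
      (\<Sum>a\<in>G. \<Sum>i\<in>{i\<in>{..<n}. \<rho> i = a}. F (\<rho> i) / card {i'\<in>{..<n}. \<rho> i' = \<rho> i})"
    using fin r by (intro sum.group[symmetric]) auto
  also have "\<dots> \<le> (\<Sum>a\<in>G. F a)"
  proof (rule sum_mono)
    fix a
    have "(\<Sum>i\<in>{i\<in>{..<n}. \<rho> i = a}. F (\<rho> i) / card {i'\<in>{..<n}. \<rho> i' = \<rho> i}) =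
        (\<Sum>i\<in>{i\<in>{..<n}. \<rho> i = a}. F a / card {i'\<in>{..<n}. \<rho> i' = a})"
      by (rule sum.cong) auto
    also have "\<dots> \<le> F a" using F[of a] by (cases "card {i'\<in>{..<n}. \<rho> i' = a} = 0") simp_all
    finally show "(\<Sum>i\<in>{i\<in>{..<n}. \<rho> i = a}. F (\<rho> i) / card {i'\<in>{..<n}. \<rho> i' = \<rho> i}) \<le> F a" .
  qed
  finally show ?thesis .
qed

section \<open>The error of a single plug-in step\<close>

context lipschitz_model
begin

context
  fixes n J :: nat and X :: "nat \<Rightarrow> nat \<Rightarrow> nat \<Rightarrow> real"
  assumes nc: "no_collider K E" and n: "0 < n"
    and X: "\<And>i. i < n \<Longrightarrow> X i \<in> space (states d K)"
begin

abbreviation (input) "quant_sample \<equiv> \<lambda>i. state_quant d {1..K} J (X i)"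

interpretation clique_dag K E n quant_sample
  using dag nc n by unfold_locales

lemma plugin_support_grid:
  "m \<le> K \<Longrightarrow> plugin_support E n quant_sample m \<subseteq> state_grid d {1..m} J"
  unfolding state_grid_def
proof (rule plugin_support_PiE)
  fix i k assume "m \<le> K" "i < n" "k \<in> {1..m}"
  thus "quant_sample i k \<in> cube_grid (d k) J"
    by (intro PiE_mem[OF state_quant_in_grid[OF X, unfolded state_grid_def]]) auto
qed

context
  fixes m :: nat and h :: "(nat \<Rightarrow> nat \<Rightarrow> real) \<Rightarrow> real" and B \<Lambda> :: real
  assumes m: "m < K" and h: "h \<in> borel_measurable (states d (Suc m))"
    and hB: "\<And>x. x \<in> space (states d (Suc m)) \<Longrightarrow> \<bar>h x\<bar> \<le> B"
    and \<Lambda>: "0 < \<Lambda>"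
    and lip: "\<And>x x'. x \<in> space (states d (Suc m)) \<Longrightarrow> x' \<in> space (states d (Suc m)) \<Longrightarrow>
       \<bar>h x - h x'\<bar> \<le> \<Lambda> * state_dist d {1..Suc m} x x'"
begin

lemma sample_parents_space:
  "i < n \<Longrightarrow> restrict (X i) (parents E (Suc m)) \<in> space (state_space d (parents E (Suc m)))"
  using m pa[of m] by (intro measurable_space[OF measurable_state_restrict X]) auto

lemma sample_node_space: "i < n \<Longrightarrow> X i (Suc m) \<in> space (cube (d (Suc m)))"
  using m by (intro measurable_space[OF measurable_state_component[of "Suc m" "{1..K}"] X]) auto

lemma quant_sample_parents:
  "state_quant d (parents E (Suc m)) J (restrict (X i) (parents E (Suc m))) = restrict (quant_sample i) (parents E (Suc m))"
  using m pa[of m] by (auto simp: state_quant_def restrict_def fun_eq_iff)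

lemma matches_quant_sample:
  "matches n quant_sample (parents E (Suc m)) s =
     {i\<in>{..<n}. restrict (quant_sample i) (parents E (Suc m)) = restrict s (parents E (Suc m))}"
  unfolding matches_def by (auto simp: restrict_def fun_eq_iff)

text \<open>The error is split at the kernels of the matching sample points. Their fluctuation is
  controlled by chaining. The bias is \<open>\<Lambda> / 2 ^ J\<close> for rounding the node, plus
  \<open>\<Lambda> * L / 2 ^ J\<close> for replacing each kernel by the one at \<open>s\<close>,
  since all matching parents round to the same grid point.\<close>

lemma conditional_step:
  assumes s: "s \<in> plugin_support E n quant_sample m"
  defines "I \<equiv> matches n quant_sample (parents E (Suc m)) s"
  shows "\<bar>(\<Sum>i\<in>I. h (s(Suc m := quant_sample i (Suc m)))) / card I - backward E \<kappa> m h s\<bar>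
    \<le> \<Lambda> * ((1 + L) / 2 ^ J) + \<Lambda> * (cell_deviation E d \<kappa> n J m X (restrict s (parents E (Suc m))) / card I)"
proof -
  let ?P = "parents E (Suc m)" and ?k = "Suc m"
  let ?C = "cube (d ?k)"
  let ?\<kappa> = "\<lambda>i. \<kappa> ?k (restrict (X i) ?P)"
  let ?q = "cube_quant (d ?k)"
  define g where "g y = h (s(?k := y))" for y
  have sS: "s \<in> space (states d m)"
    using s plugin_support_grid[OF less_imp_le[OF m]] state_grid_subset[of d "{1..m}" J] by blast
  have gm: "g \<in> borel_measurable ?C" unfolding g_def by (rule section_measurable[OF m h hB sS])
  have gB: "\<bar>g y\<bar> \<le> B" if "y \<in> space ?C" for y
    using section_bounded[OF m h hB sS that] by (simp add: g_def)
  have glip: "\<bar>g y - g y'\<bar> \<le> \<Lambda> * cube_dist (d ?k) y y'" if "y \<in> space ?C" "y' \<in> space ?C" for y y'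
    unfolding g_def by (rule section_lipschitz[OF m h hB \<Lambda> lip sS sS that]) auto
  \<comment> \<open>The increments \<open>D\<close> depend on \<open>h\<close> and on the state
    \<open>s\<close>, but their bounds depend on neither. Only the bounds survive in the final
    estimate.\<close>
  obtain c D where D: "\<And>j b. b \<in> cube_grid (d ?k) j \<Longrightarrow> \<bar>D j b\<bar> \<le> \<Lambda> * (2 / 2 ^ j)"
    and G: "\<And>y. y \<in> space ?C \<Longrightarrow>
       g (?q J y) = c + (\<Sum>j\<le>J. \<Sum>b\<in>cube_grid (d ?k) j. D j b * of_bool (?q j y = b))"
  proof (rule chaining[of "d ?k" g \<Lambda>])
    fix c D
    assume 1: "\<And>j b. b \<in> cube_grid (d ?k) j \<Longrightarrow> \<bar>D j b\<bar> \<le> \<Lambda> * (2 / 2 ^ j)"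
      and 2: "\<And>J y. y \<in> space ?C \<Longrightarrow>
       g (?q J y) = c + (\<Sum>j\<le>J. \<Sum>b\<in>cube_grid (d ?k) j. D j b * of_bool (?q j y = b))"
    show thesis by (rule that[OF 1 2])
  qed (use glip \<Lambda> in auto)
  have iI: "i < n" if "i \<in> I" for i using that unfolding I_def matches_def by blast
  have cell: "state_quant d ?P J (restrict (X i) ?P) = restrict s ?P \<longleftrightarrow> i \<in> I" if "i < n" for i
    using that by (simp add: quant_sample_parents I_def matches_quant_sample)
  have \<kappa>p: "prob_space (?\<kappa> i)" "sets (?\<kappa> i) = sets ?C" "space (?\<kappa> i) = space ?C" if "i \<in> I" for i
    using kernel_prob[OF m h hB sample_parents_space[OF iI[OF that]]] by auto
  have Gm: "(\<lambda>y. g (?q J y)) \<in> borel_measurable ?C"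
    by (rule measurable_compose[OF measurable_cube_quant]) simp
  have qS: "?q j y \<in> space ?C" if "y \<in> space ?C" for j y
    using cube_quant_in_grid[OF that] cube_grid_subset by blast
  let ?p = "\<lambda>i j b. measure (?\<kappa> i) {y \<in> space ?C. ?q j y = b}"
  have intG: "(\<integral>y. g (?q J y) \<partial>?\<kappa> i) = c + (\<Sum>j\<le>J. \<Sum>b\<in>cube_grid (d ?k) j. D j b * ?p i j b)" if i: "i \<in> I" for i
  proof -
    interpret \<kappa>: prob_space "?\<kappa> i" by (rule \<kappa>p(1)[OF i])
    have meas: "{y \<in> space ?C. ?q j y = b} \<in> sets (?\<kappa> i)" if "b \<in> cube_grid (d ?k) j" for j b
      using measurable_sets[OF measurable_cube_quant, of "{b}" "d ?k" j] that
      by (simp add: \<kappa>p(2)[OF i] vimage_def Int_def conj_commute)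
    have ii: "integrable (?\<kappa> i) (\<lambda>y. D j b * indicator {y \<in> space ?C. ?q j y = b} y)" if "b \<in> cube_grid (d ?k) j" for j b
      using meas[OF that] by (intro integrable_mult_right \<kappa>.integrable_const_bound[where B = 1] AE_I2) auto
    have "(\<integral>y. g (?q J y) \<partial>?\<kappa> i) =
       (\<integral>y. c + (\<Sum>j\<le>J. \<Sum>b\<in>cube_grid (d ?k) j. D j b * indicator {y \<in> space ?C. ?q j y = b} y) \<partial>?\<kappa> i)"
      by (rule bochner_cong) (simp add: G \<kappa>p(3)[OF i] indicator_def)
    also have "\<dots> = c + (\<integral>y. (\<Sum>j\<le>J. \<Sum>b\<in>cube_grid (d ?k) j. D j b * indicator {y \<in> space ?C. ?q j y = b} y) \<partial>?\<kappa> i)"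
    proof -
      have "integrable (?\<kappa> i) (\<lambda>y. \<Sum>j\<le>J. \<Sum>b\<in>cube_grid (d ?k) j. D j b * indicator {y \<in> space ?C. ?q j y = b} y)"
        by (intro Bochner_Integration.integrable_sum ii)
      from Bochner_Integration.integral_add[OF _ this, of "\<lambda>_. c"] show ?thesis
        using \<kappa>.prob_space by simp
    qed
    also have "(\<integral>y. (\<Sum>j\<le>J. \<Sum>b\<in>cube_grid (d ?k) j. D j b * indicator {y \<in> space ?C. ?q j y = b} y) \<partial>?\<kappa> i)
      = (\<Sum>j\<le>J. \<integral>y. (\<Sum>b\<in>cube_grid (d ?k) j. D j b * indicator {y \<in> space ?C. ?q j y = b} y) \<partial>?\<kappa> i)"
      by (intro bochner_sums ii)
    also have "\<dots> = (\<Sum>j\<le>J. \<Sum>b\<in>cube_grid (d ?k) j. D j b * ?p i j b)"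
    proof (rule sum.cong[OF refl])
      fix j
      have "(\<integral>y. (\<Sum>b\<in>cube_grid (d ?k) j. D j b * indicator {y \<in> space ?C. ?q j y = b} y) \<partial>?\<kappa> i)
        = (\<Sum>b\<in>cube_grid (d ?k) j. \<integral>y. D j b * indicator {y \<in> space ?C. ?q j y = b} y \<partial>?\<kappa> i)"
        by (intro Bochner_Integration.integral_sum ii)
      also have "\<dots> = (\<Sum>b\<in>cube_grid (d ?k) j. D j b * ?p i j b)"
        by (rule sum.cong[OF refl]) (use meas in \<open>simp add: Int_absorb1 \<kappa>p(3)[OF i] subset_iff\<close>)
      finally show "(\<integral>y. (\<Sum>b\<in>cube_grid (d ?k) j. D j b * indicator {y \<in> space ?C. ?q j y = b} y) \<partial>?\<kappa> i)
        = (\<Sum>b\<in>cube_grid (d ?k) j. D j b * ?p i j b)" .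
    qed
    finally show ?thesis .
  qed
  have bias: "\<bar>(\<integral>y. g (?q J y) \<partial>?\<kappa> i) - backward E \<kappa> m h s\<bar> \<le> \<Lambda> * ((1 + L) / 2 ^ J)" if i: "i \<in> I" for i
  proof -
    interpret \<kappa>: prob_space "?\<kappa> i" by (rule \<kappa>p(1)[OF i])
    have m1: "(\<lambda>y. g (?q J y)) \<in> borel_measurable (?\<kappa> i)" "g \<in> borel_measurable (?\<kappa> i)"
      using Gm gm by (simp_all only: measurable_cong_sets[OF \<kappa>p(2)[OF i] refl])
    have i1: "integrable (?\<kappa> i) (\<lambda>y. g (?q J y))" "integrable (?\<kappa> i) g"
      by (intro \<kappa>.integrable_const_bound[where B = B] AE_I2 m1; simp only: \<kappa>p(3)[OF i] real_norm_def gB qS)+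
    have "\<bar>(\<integral>y. g (?q J y) \<partial>?\<kappa> i) - (\<integral>y. g y \<partial>?\<kappa> i)\<bar> = \<bar>\<integral>y. g (?q J y) - g y \<partial>?\<kappa> i\<bar>"
      using i1 by simp
    also have "\<dots> \<le> \<Lambda> * (1 / 2 ^ J)"
    proof (rule \<kappa>.abs_integral_le)
      show "(\<lambda>y. g (?q J y) - g y) \<in> borel_measurable (?\<kappa> i)" using i1 by auto
      fix y assume "y \<in> space (?\<kappa> i)"
      hence y: "y \<in> space ?C" by (simp add: \<kappa>p(3)[OF i])
      have "\<bar>g (?q J y) - g y\<bar> \<le> \<Lambda> * cube_dist (d ?k) (?q J y) y" by (rule glip[OF qS[OF y] y])
      also have "\<dots> \<le> \<Lambda> * (1 / 2 ^ J)"
        using cube_dist_quant[of "d ?k" J y] \<Lambda> by (intro mult_left_mono) auto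
      finally show "\<bar>g (?q J y) - g y\<bar> \<le> \<Lambda> * (1 / 2 ^ J)" .
    qed
    finally have 1: "\<bar>(\<integral>y. g (?q J y) \<partial>?\<kappa> i) - (\<integral>y. g y \<partial>?\<kappa> i)\<bar> \<le> \<Lambda> * (1 / 2 ^ J)" .
    have "restrict s ?P = state_quant d ?P J (restrict (X i) ?P)" using cell[OF iI[OF i]] i by simp
    hence "state_dist d ?P (restrict (X i) ?P) (restrict s ?P) \<le> 1 / 2 ^ J"
      using state_dist_quant[OF finite_parents, of d m J "restrict (X i) ?P"] by (simp add: state_dist_commute)
    hence "\<Lambda> * (L * state_dist d ?P (restrict (X i) ?P) (restrict s ?P)) \<le> \<Lambda> * (L * (1 / 2 ^ J))"
      using \<Lambda> L by (intro mult_left_mono) auto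
    moreover have "\<bar>(\<integral>y. g y \<partial>?\<kappa> i) - backward E \<kappa> m h s\<bar> \<le> \<Lambda> * (L * state_dist d ?P (restrict (X i) ?P) (restrict s ?P))"
      unfolding g_def backward_def
      by (rule kernel_integral_lipschitz[OF m h hB \<Lambda> lip sS sample_parents_space[OF iI[OF i]]
            restrict_parents_space[OF m h hB sS]])
    ultimately show ?thesis using 1 by (simp add: algebra_simps add_divide_distrib)
  qed
  have I0: "real (card I) > 0"
    using parents_matches_nonempty[OF s] by (simp add: I_def card_gt_0_iff)
  have finI: "finite I" by (simp add: I_def)
  \<comment> \<open>The indicator of the parent cell vanishes for sample points outside
    \<open>I\<close>. The sum over the matching points is thus a sum over the whole sample with
    independent summands, whereas \<open>I\<close> itself is random.\<close>
  have dev: "(\<Sum>i<n. deviation E d \<kappa> J m (restrict s ?P) j b (X i)) = (\<Sum>i\<in>I. of_bool (?q j (X i ?k) = b) - ?p i j b)" for j b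
  proof -
    have "(\<Sum>i<n. deviation E d \<kappa> J m (restrict s ?P) j b (X i)) =
        (\<Sum>i<n. if i \<in> I then of_bool (?q j (X i ?k) = b) - ?p i j b else 0)"
      by (rule sum.cong[OF refl]) (simp add: deviation_def cell)
    also have "\<dots> = (\<Sum>i\<in>{..<n} \<inter> I. of_bool (?q j (X i ?k) = b) - ?p i j b)"
      by (subst sum.inter_restrict) simp_all
    also have "{..<n} \<inter> I = I" using iI by auto
    finally show ?thesis .
  qed
  have tri: "\<bar>a\<bar> \<le> x \<Longrightarrow> \<bar>b\<bar> \<le> y \<Longrightarrow> c = a + b \<Longrightarrow> \<bar>c\<bar> \<le> y + x" for a b c x y :: real
    by linarith
  have "\<bar>\<Sum>i\<in>I. g (?q J (X i ?k)) - (\<integral>y. g (?q J y) \<partial>?\<kappa> i)\<bar> \<le> \<Lambda> * cell_deviation E d \<kappa> n J m X (restrict s ?P)"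
  proof -
    have eq1: "(\<Sum>i\<in>I. g (?q J (X i ?k)) - (\<integral>y. g (?q J y) \<partial>?\<kappa> i)) =
        (\<Sum>i\<in>I. \<Sum>j\<le>J. \<Sum>b\<in>cube_grid (d ?k) j. D j b * (of_bool (?q j (X i ?k) = b) - ?p i j b))"
      by (rule sum.cong[OF refl])
        (simp add: G[OF sample_node_space[OF iI]] intG right_diff_distrib sum_subtractf)
    have eq2: "(\<Sum>i\<in>I. \<Sum>j\<le>J. \<Sum>b\<in>cube_grid (d ?k) j. D j b * (of_bool (?q j (X i ?k) = b) - ?p i j b)) =
        (\<Sum>j\<le>J. \<Sum>b\<in>cube_grid (d ?k) j. D j b * (\<Sum>i\<in>I. of_bool (?q j (X i ?k) = b) - ?p i j b))"
    proof -
      have "(\<Sum>i\<in>I. \<Sum>j\<le>J. \<Sum>b\<in>cube_grid (d ?k) j. D j b * (of_bool (?q j (X i ?k) = b) - ?p i j b)) =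
        (\<Sum>j\<le>J. \<Sum>i\<in>I. \<Sum>b\<in>cube_grid (d ?k) j. D j b * (of_bool (?q j (X i ?k) = b) - ?p i j b))"
        by (rule sum.swap)
      also have "\<dots> = (\<Sum>j\<le>J. \<Sum>b\<in>cube_grid (d ?k) j. \<Sum>i\<in>I. D j b * (of_bool (?q j (X i ?k) = b) - ?p i j b))"
        by (rule sum.cong[OF refl], rule sum.swap)
      finally show ?thesis by (simp only: sum_distrib_left)
    qed
    have "\<bar>\<Sum>j\<le>J. \<Sum>b\<in>cube_grid (d ?k) j. D j b * (\<Sum>i\<in>I. of_bool (?q j (X i ?k) = b) - ?p i j b)\<bar>
        \<le> (\<Sum>j\<le>J. \<Sum>b\<in>cube_grid (d ?k) j. \<Lambda> * (2 / 2 ^ j * \<bar>\<Sum>i<n. deviation E d \<kappa> J m (restrict s ?P) j b (X i)\<bar>))"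
    proof (rule order_trans[OF sum_abs], rule sum_mono, rule order_trans[OF sum_abs], rule sum_mono)
      fix j b assume "b \<in> cube_grid (d ?k) j"
      from mult_right_mono[OF D[OF this] abs_ge_zero[of "\<Sum>i\<in>I. of_bool (?q j (X i ?k) = b) - ?p i j b"]]
      show "\<bar>D j b * (\<Sum>i\<in>I. of_bool (?q j (X i ?k) = b) - ?p i j b)\<bar>
          \<le> \<Lambda> * (2 / 2 ^ j * \<bar>\<Sum>i<n. deviation E d \<kappa> J m (restrict s ?P) j b (X i)\<bar>)"
        unfolding dev abs_mult by (simp only: mult.assoc)
    qed
    thus ?thesis unfolding eq1 eq2 cell_deviation_def sum_distrib_left[of \<Lambda>] .
  qed
  moreover have "\<bar>\<Sum>i\<in>I. (\<integral>y. g (?q J y) \<partial>?\<kappa> i) - backward E \<kappa> m h s\<bar> \<le> card I * (\<Lambda> * ((1 + L) / 2 ^ J))"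
  proof -
    have "\<bar>\<Sum>i\<in>I. (\<integral>y. g (?q J y) \<partial>?\<kappa> i) - backward E \<kappa> m h s\<bar> \<le> (\<Sum>i\<in>I. \<Lambda> * ((1 + L) / 2 ^ J))"
      by (rule order_trans[OF sum_abs sum_mono]) (rule bias)
    thus ?thesis by simp
  qed
  moreover have "(\<Sum>i\<in>I. h (s(?k := quant_sample i ?k))) - card I * backward E \<kappa> m h s =
      (\<Sum>i\<in>I. g (?q J (X i ?k)) - (\<integral>y. g (?q J y) \<partial>?\<kappa> i)) + (\<Sum>i\<in>I. (\<integral>y. g (?q J y) \<partial>?\<kappa> i) - backward E \<kappa> m h s)"
  proof -
    have "h (s(?k := quant_sample i ?k)) = g (?q J (X i ?k))" for i
      using m by (simp add: g_def state_quant_def)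
    thus ?thesis by (simp only: sum_subtractf sum_constant)
  qed
  ultimately have "\<bar>(\<Sum>i\<in>I. h (s(?k := quant_sample i ?k))) - card I * backward E \<kappa> m h s\<bar>
      \<le> card I * (\<Lambda> * ((1 + L) / 2 ^ J)) + \<Lambda> * cell_deviation E d \<kappa> n J m X (restrict s ?P)"
    by (rule tri)
  hence "\<bar>(\<Sum>i\<in>I. h (s(?k := quant_sample i ?k))) - card I * backward E \<kappa> m h s\<bar> / card I
      \<le> (card I * (\<Lambda> * ((1 + L) / 2 ^ J)) + \<Lambda> * cell_deviation E d \<kappa> n J m X (restrict s ?P)) / card I"
    using I0 by (intro divide_right_mono) auto
  moreover have "\<bar>a - card I * b\<bar> / card I = \<bar>a / card I - b\<bar>" for a b :: real
  proof -
    have "\<bar>a - card I * b\<bar> / card I = \<bar>(a - card I * b) / card I\<bar>"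
      using I0 by (simp only: abs_divide abs_of_pos)
    also have "(a - card I * b) / card I = a / card I - b" using I0 by (simp add: diff_divide_distrib)
    finally show ?thesis .
  qed
  moreover have "(card I * a + b * c) / card I = a + b * (c / card I)" for a b c :: real
    using I0 by (simp add: add_divide_distrib)
  ultimately show ?thesis by (simp only:)
qed

text \<open>The bound of \<open>conditional_step\<close> depends on the state through the parents
  only. Hence \<open>plugin_clique\<close> turns its plug-in average into an average over the
  sample, and \<open>sum_classes_le\<close> removes the division by the number of matches.\<close>

lemma plugin_step:
  "\<bar>plugin E n quant_sample (Suc m) h - plugin E n quant_sample m (backward E \<kappa> m h)\<bar>
     \<le> \<Lambda> * ((1 + L) / 2 ^ J + total_deviation E d \<kappa> n J m X / n)"
proof -
  let ?P = "parents E (Suc m)"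
  let ?M = "matches n quant_sample ?P"
  let ?\<alpha> = "\<lambda>s. (\<Sum>i\<in>?M s. h (s(Suc m := quant_sample i (Suc m)))) / card (?M s)"
  let ?F = "\<lambda>s. cell_deviation E d \<kappa> n J m X (restrict s ?P)"
  let ?\<phi> = "\<lambda>s. \<Lambda> * ((1 + L) / 2 ^ J) + \<Lambda> * (?F s / card (?M s))"
  let ?A = "plugin E n quant_sample m"
  have "\<bar>?A ?\<alpha> - ?A (backward E \<kappa> m h)\<bar> \<le> ?A ?\<phi>"
  proof -
    have 1: "?\<alpha> s - backward E \<kappa> m h s \<le> ?\<phi> s" "backward E \<kappa> m h s - ?\<alpha> s \<le> ?\<phi> s"
      if "s \<in> plugin_support E n quant_sample m" for s
      using conditional_step[OF that] by linarith+
    have "?A (\<lambda>s. ?\<alpha> s - backward E \<kappa> m h s) \<le> ?A ?\<phi>" by (rule plugin_mono) (rule 1)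
    moreover have "?A (\<lambda>s. backward E \<kappa> m h s - ?\<alpha> s) \<le> ?A ?\<phi>" by (rule plugin_mono) (rule 1)
    ultimately show ?thesis unfolding plugin_diff by linarith
  qed
  also have "?A ?\<phi> = (\<Sum>i<n. ?\<phi> (quant_sample i)) / n"
  proof (rule plugin_clique[OF fully_connected_parents[of "Suc m"] parents_subset])
    fix s s' :: "nat \<Rightarrow> nat \<Rightarrow> real" assume eq: "\<And>l. l \<in> ?P \<Longrightarrow> s l = s' l"
    have "restrict s ?P = restrict s' ?P" using eq by (auto simp: restrict_def)
    moreover have "?M s = ?M s'" by (rule matches_cong) (rule eq)
    ultimately show "?\<phi> s = ?\<phi> s'" by simp
  qed
  also have "\<dots> = \<Lambda> * ((1 + L) / 2 ^ J) + \<Lambda> * ((\<Sum>i<n. ?F (quant_sample i) / card (?M (quant_sample i))) / n)"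
  proof -
    have "(\<Sum>i<n. ?\<phi> (quant_sample i)) = real n * (\<Lambda> * ((1 + L) / 2 ^ J)) + \<Lambda> * (\<Sum>i<n. ?F (quant_sample i) / card (?M (quant_sample i)))"
      by (simp only: sum.distrib sum_distrib_left[symmetric] sum_constant card_lessThan) (simp only: mult.left_commute)
    thus ?thesis using n by (simp add: add_divide_distrib)
  qed
  also have "\<dots> \<le> \<Lambda> * ((1 + L) / 2 ^ J) + \<Lambda> * (total_deviation E d \<kappa> n J m X / n)"
  proof (intro add_left_mono mult_left_mono divide_right_mono)
    have "restrict (quant_sample i) ?P \<in> state_grid d ?P J" if "i < n" for i
      using state_quant_in_grid[OF sample_parents_space[OF that], of J] by (simp only: quant_sample_parents)
    thus "(\<Sum>i<n. ?F (quant_sample i) / card (?M (quant_sample i))) \<le> total_deviation E d \<kappa> n J m X"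
      unfolding total_deviation_def matches_quant_sample
      by (intro sum_classes_le finite_state_grid finite_parents cell_deviation_nonneg)
  qed (use \<Lambda> in auto)
  finally show ?thesis by (simp add: distrib_left)
qed

end

end

end

section \<open>Backward induction over the nodes, and the estimator as a measure\<close>

primrec backward_iter where
  "backward_iter E \<kappa> K F 0 = F"
| "backward_iter E \<kappa> K F (Suc j) = backward E \<kappa> (K - Suc j) (backward_iter E \<kappa> K F j)"

definition plugin_measure where
  "plugin_measure K E d n J z =
     distr (point_measure (state_grid d {1..K} J) (\<lambda>s. plugin E n z K (\<lambda>t. of_bool (t = s))))
       (states d K) (\<lambda>x. x)"

lemma plugin_nonneg:
  assumes "\<And>s. 0 \<le> \<phi> s" shows "0 \<le> plugin E n z m \<phi>"
proof -
  have "plugin E n z m (\<lambda>_. 0) \<le> plugin E n z m \<phi>" by (rule plugin_mono) (rule assms)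
  thus ?thesis using plugin_cmult[of E n z m 0 "\<lambda>_. 0"] by simp
qed

context clique_dag
begin

lemma plugin_one: "plugin E n z m (\<lambda>_. 1) = 1"
  using plugin_clique[of "{}" m "\<lambda>_. 1"] n by (simp add: fully_connected_def)

lemma plugin_weights_sum:
  assumes "finite S" "plugin_support E n z m \<subseteq> S"
  shows "(\<Sum>s\<in>S. plugin E n z m (\<lambda>t. of_bool (t = s))) = 1"
  using plugin_expand[OF assms, of "\<lambda>_. 1"] plugin_one[of m] by simp

end

lemma plugin_measure_prob:
  assumes dag: "sorted_dag K E" and nc: "no_collider K E" and n: "0 < n"
    and z: "\<And>i. i < n \<Longrightarrow> z i \<in> state_grid d {1..K} J"
  shows "plugin_measure K E d n J z \<in> space (prob_algebra (states d K))"
proof -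
  interpret clique_dag K E n z using dag nc n by unfold_locales
  let ?S = "state_grid d {1..K} J" and ?w = "\<lambda>s. plugin E n z K (\<lambda>t. of_bool (t = s))"
  have supp: "plugin_support E n z K \<subseteq> ?S"
    unfolding state_grid_def
  proof (rule plugin_support_PiE)
    show "z i k \<in> cube_grid (d k) J" if "i < n" "k \<in> {1..K}" for i k
      by (rule PiE_mem[OF z[OF that(1), unfolded state_grid_def] that(2)])
  qed
  have fin: "finite ?S" by simp
  have "emeasure (point_measure ?S ?w) (space (point_measure ?S ?w)) = (\<Sum>s\<in>?S. ennreal (?w s))"
    unfolding space_point_measure by (rule emeasure_point_measure_finite[OF fin]) simp
  also have "\<dots> = ennreal (\<Sum>s\<in>?S. ?w s)" by (intro sum_ennreal plugin_nonneg) simp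
  also have "\<dots> = 1" by (simp only: plugin_weights_sum[OF fin supp] ennreal_1)
  finally have "prob_space (point_measure ?S ?w)" by (rule prob_spaceI)
  moreover have "(\<lambda>x. x) \<in> point_measure ?S ?w \<rightarrow>\<^sub>M states d K"
    using state_grid_subset[of d "{1..K}" J] by (simp add: Pi_def subset_iff)
  ultimately show ?thesis
    by (simp add: plugin_measure_def space_prob_algebra prob_space.prob_space_distr)
qed

context lipschitz_model
begin

context
  fixes n J :: nat and X :: "nat \<Rightarrow> nat \<Rightarrow> nat \<Rightarrow> real"
  assumes nc: "no_collider K E" and n: "0 < n"
    and X: "\<And>i. i < n \<Longrightarrow> X i \<in> space (states d K)"
begin

interpretation clique_dag K E n "\<lambda>i. state_quant d {1..K} J (X i)"
  using dag nc n by unfold_locales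

text \<open>The right-hand side does not involve \<open>F\<close>. The estimate may therefore be
  applied to a dual potential chosen after seeing the sample.\<close>

lemma plugin_bias:
  assumes F: "F \<in> borel_measurable (states d K)"
    and lip: "\<And>x y. \<bar>F x - F y\<bar> \<le> state_dist d {1..K} x y"
  shows "\<bar>plugin E n (\<lambda>i. state_quant d {1..K} J (X i)) K F - (\<integral>x. F x \<partial>\<mu>)\<bar>
    \<le> (1 + L) ^ K * (\<Sum>m<K. (1 + L) / 2 ^ J + total_deviation E d \<kappa> n J m X / n)"
proof -
  let ?A = "plugin E n (\<lambda>i. state_quant d {1..K} J (X i))"
  let ?h = "backward_iter E \<kappa> K F"
  let ?R = "\<lambda>m. (1 + L) / 2 ^ J + total_deviation E d \<kappa> n J m X / n"
  have R0: "0 \<le> ?R m" for m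
    using L by (auto simp: total_deviation_def intro!: add_nonneg_nonneg divide_nonneg_nonneg sum_nonneg cell_deviation_nonneg)
  obtain x0 where x0: "x0 \<in> space (states d K)" using X[OF n] by blast
  \<comment> \<open>The state space has diameter at most 1, so \<open>F\<close> exceeds its value at
    one point by at most 1 in absolute value.\<close>
  define B where "B = \<bar>F x0\<bar> + 1"
  have FB: "\<bar>F x\<bar> \<le> B" if "x \<in> space (states d K)" for x
    using lip[of x x0] state_dist_le_1[OF _ that x0] unfolding B_def by simp
  \<comment> \<open>The invariant after \<open>j\<close> nodes have been integrated out:
    measurability, boundedness and the Lipschitz constant feed the next step, the integral is
    preserved, and the accumulated errors carry the common factor
    \<open>(1 + L) ^ K\<close>.\<close>
  have inv: "?h j \<in> borel_measurable (state_space d {1..K - j}) \<and>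
      (\<forall>x\<in>space (state_space d {1..K - j}). \<bar>?h j x\<bar> \<le> B) \<and>
      (\<forall>x\<in>space (state_space d {1..K - j}). \<forall>x'\<in>space (state_space d {1..K - j}).
         \<bar>?h j x - ?h j x'\<bar> \<le> (1 + L) ^ j * state_dist d {1..K - j} x x') \<and>
      (\<integral>x. ?h j x \<partial>marginal d \<mu> {1..K - j}) = (\<integral>x. F x \<partial>marginal d \<mu> {1..K}) \<and>
      \<bar>?A K F - ?A (K - j) (?h j)\<bar> \<le> (1 + L) ^ K * (\<Sum>m\<in>{K - j..<K}. ?R m)"
    if "j \<le> K" for j
    using that
  proof (induction j)
    case 0
    thus ?case using F FB lip by simp
  next
    case (Suc j)
    \<comment> \<open>The nodes up to \<open>K - j = Suc m\<close> are left; this step removes the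
      node \<open>Suc m\<close>.\<close>
    define m where "m = K - Suc j"
    have m: "m < K" and Sm: "K - j = Suc m" using Suc.prems by (auto simp: m_def)
    have "j \<le> K" using Suc.prems by simp
    note IH = Suc.IH[OF this, unfolded Sm]
    have h: "?h j \<in> borel_measurable (states d (Suc m))" using IH by blast
    have hB: "\<bar>?h j x\<bar> \<le> B" if "x \<in> space (states d (Suc m))" for x using IH that by blast
    have hl: "\<bar>?h j x - ?h j x'\<bar> \<le> (1 + L) ^ j * state_dist d {1..Suc m} x x'"
      if "x \<in> space (states d (Suc m))" "x' \<in> space (states d (Suc m))" for x x'
      using IH that by blast
    have \<Lambda>: "0 < (1 + L) ^ j" using L by simp
    have eq: "?h (Suc j) = backward E \<kappa> m (?h j)" by (simp add: m_def)
    have "\<bar>?A (Suc m) (?h j) - ?A m (?h (Suc j))\<bar> \<le> (1 + L) ^ j * ?R m"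
      unfolding eq by (rule plugin_step[OF nc n X m h hB \<Lambda> hl])
    also have "\<dots> \<le> (1 + L) ^ K * ?R m"
      using L Suc.prems by (intro mult_right_mono power_increasing R0) auto
    finally have "\<bar>?A (Suc m) (?h j) - ?A m (?h (Suc j))\<bar> \<le> (1 + L) ^ K * ?R m" .
    moreover have "\<bar>?A K F - ?A (Suc m) (?h j)\<bar> \<le> (1 + L) ^ K * (\<Sum>m\<in>{Suc m..<K}. ?R m)"
      using IH by blast
    moreover have "(\<Sum>m\<in>{m..<K}. ?R m) = ?R m + (\<Sum>m\<in>{Suc m..<K}. ?R m)"
      by (rule sum.atLeast_Suc_lessThan[OF m])
    hence "(1 + L) ^ K * (\<Sum>m\<in>{m..<K}. ?R m) = (1 + L) ^ K * ?R m + (1 + L) ^ K * (\<Sum>m\<in>{Suc m..<K}. ?R m)"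
      by (simp only: distrib_left)
    ultimately have "\<bar>?A K F - ?A m (?h (Suc j))\<bar> \<le> (1 + L) ^ K * (\<Sum>m\<in>{m..<K}. ?R m)"
      by linarith
    moreover have "?h (Suc j) \<in> borel_measurable (states d m)"
      unfolding eq by (rule backward_measurable[OF m h])
    moreover have "\<bar>?h (Suc j) x\<bar> \<le> B" if "x \<in> space (states d m)" for x
      unfolding eq by (rule backward_bounded[OF m h hB that])
    moreover have "\<bar>?h (Suc j) x - ?h (Suc j) x'\<bar> \<le> (1 + L) ^ Suc j * state_dist d {1..m} x x'"
      if "x \<in> space (states d m)" "x' \<in> space (states d m)" for x x'
      unfolding eq power_Suc by (rule backward_lipschitz[OF m h hB \<Lambda> hl that])
    moreover have "(\<integral>x. ?h (Suc j) x \<partial>marginal d \<mu> {1..m}) = (\<integral>x. F x \<partial>marginal d \<mu> {1..K})"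
    proof -
      have "(\<integral>x. backward E \<kappa> m (?h j) x \<partial>marginal d \<mu> {1..m}) = (\<integral>x. ?h j x \<partial>marginal d \<mu> {1..Suc m})"
        by (rule integral_backward[OF m h hB])
      thus ?thesis unfolding eq using IH by argo
    qed
    ultimately show ?case unfolding m_def[symmetric] by blast
  qed
  have sets: "sets \<mu> = sets (states d K)" using \<mu> by (simp add: space_prob_algebra)
  have "(\<integral>x. F x \<partial>marginal d \<mu> {1..K}) = (\<integral>x. F (restrict x {1..K}) \<partial>\<mu>)"
    unfolding marginal_def using F measurable_state_restrict[of "{1..K}" "{1..K}" d]
    by (subst integral_distr) (simp_all only: measurable_cong_sets[OF sets refl] subset_refl)
  also have "\<dots> = (\<integral>x. F x \<partial>\<mu>)"
    by (rule bochner_cong)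
      (simp add: sets_eq_imp_space_eq[OF sets] space_state_space PiE_restrict)
  finally have margK: "(\<integral>x. F x \<partial>marginal d \<mu> {1..K}) = (\<integral>x. F x \<partial>\<mu>)" .
  \<comment> \<open>With no nodes left the state space is a single point, where the estimator and
    the true marginal agree. The whole error thus sits in the telescoped sum.\<close>
  have N: "marginal d \<mu> {1..0} \<in> space (prob_algebra (state_space d {1..0}))" by (rule marginal_prob) simp
  hence sets0: "sets (marginal d \<mu> {1..0}) = sets (state_space d {1..0})" by (simp add: space_prob_algebra)
  interpret N: prob_space "marginal d \<mu> {1..0}" using N by (simp add: space_prob_algebra)
  have "x = (\<lambda>_. undefined)" if "x \<in> space (marginal d \<mu> {1..0})" for x
    using that sets_eq_imp_space_eq[OF sets0] by (simp add: space_state_space)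
  hence "(\<integral>x. ?h K x \<partial>marginal d \<mu> {1..0}) = (\<integral>x. ?h K (\<lambda>_. undefined) \<partial>marginal d \<mu> {1..0})"
    by (intro Bochner_Integration.integral_cong refl) metis
  also have "\<dots> = ?A 0 (?h K)" using N.prob_space by simp
  finally have "?A 0 (?h K) = (\<integral>x. F x \<partial>\<mu>)" using inv[of K] margK by simp
  thus ?thesis using inv[of K] by (simp add: lessThan_atLeast0)
qed

lemma wasserstein_plugin_measure:
  "wasserstein (state_dist d {1..K}) \<mu> (plugin_measure K E d n J (\<lambda>i. state_quant d {1..K} J (X i)))
    \<le> ennreal (2 / 2 ^ J + (1 + L) ^ K * (\<Sum>m<K. (1 + L) / 2 ^ J + total_deviation E d \<kappa> n J m X / n))"
proof -
  let ?z = "\<lambda>i. state_quant d {1..K} J (X i)"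
  let ?S = "state_grid d {1..K} J"
  let ?w = "\<lambda>s. plugin E n ?z K (\<lambda>t. of_bool (t = s))"
  let ?c = "(1 + L) ^ K * (\<Sum>m<K. (1 + L) / 2 ^ J + total_deviation E d \<kappa> n J m X / n)"
  have supp: "plugin_support E n ?z K \<subseteq> ?S" by (rule plugin_support_grid[OF nc n X]) simp_all
  have fin: "finite ?S" by simp
  have sets: "sets \<mu> = sets (states d K)" using \<mu> by (simp add: space_prob_algebra)
  interpret \<mu>: prob_space \<mu> using \<mu> by (simp add: space_prob_algebra)
  note sp = sets_eq_imp_space_eq[OF sets]
  have Qm: "state_quant d {1..K} J \<in> states d K \<rightarrow>\<^sub>M count_space ?S" by (rule measurable_state_quant) simp
  \<comment> \<open>Rounding costs \<open>1 / 2 ^ J\<close> twice: as transport from a point to its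
    grid point, and when the integral of \<open>F\<close> at rounded points is replaced by the
    integral of \<open>F\<close>.\<close>
  have "wasserstein (state_dist d {1..K}) \<mu> (distr (point_measure ?S ?w) (states d K) (\<lambda>x. x))
      \<le> ennreal (1 / 2 ^ J + (1 / 2 ^ J + ?c))"
  proof (rule wasserstein_le_by_duality[OF \<mu> fin state_grid_subset _ _ _ _ _ _ _ Qm])
    show "state_dist d {1..K} x z \<le> state_dist d {1..K} x y + state_dist d {1..K} y z" for x y z
      by (rule state_dist_triangle) simp
    show "state_dist d {1..K} x y = state_dist d {1..K} y x" for x y by (rule state_dist_commute)
    show "(\<lambda>z. state_dist d {1..K} (fst z) (snd z)) \<in> borel_measurable (states d K \<Otimes>\<^sub>M states d K)"
      by (rule measurable_state_dist) simp_all
    show "0 \<le> ?w s" for s by (rule plugin_nonneg) simp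
    show "sum ?w ?S = 1" by (rule plugin_weights_sum[OF fin supp])
    show "state_dist d {1..K} (state_quant d {1..K} J x) x \<le> 1 / 2 ^ J" for x
      by (rule state_dist_quant) simp
    fix F :: "(nat \<Rightarrow> nat \<Rightarrow> real) \<Rightarrow> real"
    assume F: "F \<in> borel_measurable (states d K)"
      and lip: "\<And>x y. \<bar>F x - F y\<bar> \<le> state_dist d {1..K} x y"
    obtain x0 where x0: "x0 \<in> space (states d K)" using X[OF n] by blast
    have FB: "\<bar>F x\<bar> \<le> \<bar>F x0\<bar> + 1" if "x \<in> space (states d K)" for x
      using lip[of x x0] state_dist_le_1[OF _ that x0] by simp
    have Fm: "F \<in> borel_measurable \<mu>" using F by (simp only: measurable_cong_sets[OF sets refl])
    have FQm: "(\<lambda>x. F (state_quant d {1..K} J x)) \<in> borel_measurable \<mu>"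
      using measurable_compose[OF Qm, of F borel] by (simp add: measurable_cong_sets[OF sets refl])
    have QS: "state_quant d {1..K} J x \<in> space (states d K)" if "x \<in> space (states d K)" for x
      using state_quant_in_grid[OF that] state_grid_subset by blast
    have i1: "integrable \<mu> F"
      using FB by (intro \<mu>.integrable_const_bound[where B = "\<bar>F x0\<bar> + 1"] AE_I2 Fm) (simp add: sp)
    have i2: "integrable \<mu> (\<lambda>x. F (state_quant d {1..K} J x))"
      using FB QS by (intro \<mu>.integrable_const_bound[where B = "\<bar>F x0\<bar> + 1"] AE_I2 FQm) (simp add: sp)
    have "\<bar>\<integral>x. F (state_quant d {1..K} J x) - F x \<partial>\<mu>\<bar> \<le> 1 / 2 ^ J"
    proof (rule \<mu>.abs_integral_le)
      show "(\<lambda>x. F (state_quant d {1..K} J x) - F x) \<in> borel_measurable \<mu>" using i1 i2 by auto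
      show "\<bar>F (state_quant d {1..K} J x) - F x\<bar> \<le> 1 / 2 ^ J" for x
        using lip[of "state_quant d {1..K} J x" x] state_dist_quant[of "{1..K}" d J x] by simp
    qed
    moreover have "plugin E n ?z K F = (\<Sum>s\<in>?S. ?w s * F s)"
      using plugin_expand[OF fin supp, of F] by (simp add: mult.commute)
    ultimately show "(\<integral>x. F (state_quant d {1..K} J x) \<partial>\<mu>) - (\<Sum>s\<in>?S. ?w s * F s) \<le> 1 / 2 ^ J + ?c"
      using plugin_bias[OF F lip] i1 i2 by simp
  qed simp_all
  thus ?thesis by (simp add: plugin_measure_def)
qed

end

end

section \<open>The expected fluctuation\<close>

context lipschitz_model
begin

context
  fixes m J :: nat
  assumes m: "m < K"
begin

abbreviation (input) "pset \<equiv> parents E (Suc m)"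
abbreviation (input) "node_cube \<equiv> cube (d (Suc m))"
abbreviation (input) "parent_cell x \<equiv> state_quant d pset J (restrict x pset)"
abbreviation (input) "node_cell j x \<equiv> cube_quant (d (Suc m)) j (x (Suc m))"
abbreviation (input) "dev \<equiv> deviation E d \<kappa> J m"

definition cell_prob where
  "cell_prob a j b = measure \<mu> {x \<in> space (states d K).
     parent_cell x = a \<and> node_cell j x = b}"

lemma pset_subset: "pset \<subseteq> {1..K}"
  using pa[of m] m by force

text \<open>With \<open>c\<close> and \<open>w\<close> the indicators of the parent and node cells
  and \<open>e\<close> the kernel probability of the node cell, the deviation is
  \<open>c * w - c * e\<close>. Both products have the mean \<open>cell_prob\<close>. As all factors
  lie between 0 and 1, the square is at most \<open>c * w + c * e\<close>, so the variance is
  proportional to the probability of the cell.\<close>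

lemma deviation_moments:
  assumes a: "a \<in> state_grid d pset J" and b: "b \<in> cube_grid (d (Suc m)) j"
  shows "dev a j b \<in> borel_measurable \<mu>"
    and "x \<in> space \<mu> \<Longrightarrow> \<bar>dev a j b x\<bar> \<le> 1"
    and "(\<integral>x. dev a j b x \<partial>\<mu>) = 0"
    and "(\<integral>x. (dev a j b x)\<^sup>2 \<partial>\<mu>) \<le> 2 * cell_prob a j b"
proof -
  have sets: "sets \<mu> = sets (states d K)" using \<mu> by (simp add: space_prob_algebra)
  interpret \<mu>: prob_space \<mu> using \<mu> by (simp add: space_prob_algebra)
  note sp = sets_eq_imp_space_eq[OF sets]
  define A where "A = {u \<in> space (state_space d pset). state_quant d pset J u = a}"
  define B where "B = {y \<in> space node_cube. cube_quant (d (Suc m)) j y = b}"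
  define c where "c x = (indicator A (restrict x pset) :: real)" for x
  define w where "w x = (indicator B (x (Suc m)) :: real)" for x :: "nat \<Rightarrow> nat \<Rightarrow> real"
  define e where "e x = measure (\<kappa> (Suc m) (restrict x pset)) B" for x
  have A: "A \<in> sets (state_space d pset)"
    using measurable_sets[OF measurable_state_quant[OF finite_parents], of "{a}" d m J] a
    by (simp add: A_def vimage_def Int_def conj_commute)
  have B: "B \<in> sets node_cube"
    using measurable_sets[OF measurable_cube_quant, of "{b}" "d (Suc m)" j] b
    by (simp add: B_def vimage_def Int_def conj_commute)
  have rm: "(\<lambda>x. restrict x pset) \<in> \<mu> \<rightarrow>\<^sub>M state_space d pset"
    using measurable_state_restrict[OF pset_subset] by (simp only: measurable_cong_sets[OF sets refl])
  have km: "(\<lambda>x. x (Suc m)) \<in> \<mu> \<rightarrow>\<^sub>M node_cube"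
    using measurable_state_component[of "Suc m" "{1..K}" d] m by (simp add: measurable_cong_sets[OF sets refl])
  have cm: "c \<in> borel_measurable \<mu>"
    unfolding c_def[abs_def] by (rule measurable_compose[OF rm]) (use A in simp)
  have wm: "w \<in> borel_measurable \<mu>"
    unfolding w_def[abs_def] by (rule measurable_compose[OF km]) (use B in simp)
  have em: "e \<in> borel_measurable \<mu>"
    unfolding e_def[abs_def]
    by (rule measurable_compose[OF measurable_compose[OF rm kernel_measurable[OF m]] measurable_measure_prob_algebra[OF B]])
  have e01: "0 \<le> e x" "e x \<le> 1" if "x \<in> space \<mu>" for x
  proof -
    have "prob_space (\<kappa> (Suc m) (restrict x pset))"
      using measurable_space[OF kernel_measurable[OF m] measurable_space[OF rm that]] by (simp add: space_prob_algebra)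
    thus "0 \<le> e x" "e x \<le> 1" by (simp_all add: e_def prob_space.prob_le_1)
  qed
  have c01: "c x = 0 \<or> c x = 1" and w01: "w x = 0 \<or> w x = 1" for x
    by (simp_all add: c_def w_def indicator_def)
  have dev_eq: "dev a j b x = c x * w x - c x * e x" if "x \<in> space \<mu>" for x
    using measurable_space[OF rm that] measurable_space[OF km that]
    by (simp add: deviation_def c_def w_def e_def A_def indicator_def right_diff_distrib flip: B_def)
      (simp add: B_def)
  show "dev a j b \<in> borel_measurable \<mu>"
    using cm wm em by (subst measurable_cong[OF dev_eq]) auto
  show "\<bar>dev a j b x\<bar> \<le> 1" if "x \<in> space \<mu>" for x
    using c01[of x] w01[of x] e01[OF that] dev_eq[OF that] by auto
  have i1: "integrable \<mu> (\<lambda>x. c x * w x)"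
  proof (rule \<mu>.integrable_const_bound[where B = 1])
    show "AE x in \<mu>. norm (c x * w x) \<le> 1" by (intro AE_I2) (simp add: c_def w_def indicator_def)
  qed (use cm wm in simp)
  have i2: "integrable \<mu> (\<lambda>x. c x * e x)"
  proof (rule \<mu>.integrable_const_bound[where B = 1])
    show "AE x in \<mu>. norm (c x * e x) \<le> 1" using e01 by (intro AE_I2) (simp add: c_def indicator_def)
  qed (use cm em in simp)
  let ?C = "{x \<in> space (states d K). restrict x pset \<in> A \<and> x (Suc m) \<in> B}"
  have Ceq: "?C = {x \<in> space (states d K). parent_cell x = a \<and> node_cell j x = b}"
    using measurable_space[OF rm] measurable_space[OF km] unfolding sp A_def B_def by blast
  have Cs: "?C \<in> sets \<mu>"
  proof -
    have "((\<lambda>x. restrict x pset) -` A \<inter> space \<mu>) \<inter> ((\<lambda>x. x (Suc m)) -` B \<inter> space \<mu>) \<in> sets \<mu>"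
      by (intro sets.Int measurable_sets[OF rm A] measurable_sets[OF km B])
    also have "((\<lambda>x. restrict x pset) -` A \<inter> space \<mu>) \<inter> ((\<lambda>x. x (Suc m)) -` B \<inter> space \<mu>) = ?C"
      unfolding sp by blast
    finally show ?thesis .
  qed
  have int1: "(\<integral>x. c x * w x \<partial>\<mu>) = cell_prob a j b"
  proof -
    have "(\<integral>x. c x * w x \<partial>\<mu>) = (\<integral>x. indicator ?C x \<partial>\<mu>)"
      by (rule bochner_cong) (simp add: c_def w_def indicator_def sp)
    also have "\<dots> = measure \<mu> ?C" using Cs sets.sets_into_space[OF Cs] by (simp add: Int_absorb1)
    finally show ?thesis unfolding cell_prob_def Ceq .
  qed
  \<comment> \<open>The defining equation of the conditional distribution, applied to the two cells.
    It is what makes the deviation exactly centred.\<close>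
  have int2: "(\<integral>x. c x * e x \<partial>\<mu>) = cell_prob a j b"
  proof -
    have "ennreal (cell_prob a j b) = emeasure \<mu> ?C"
      unfolding cell_prob_def Ceq[symmetric] by (rule \<mu>.emeasure_eq_measure[symmetric])
    also have "\<dots> = (\<integral>\<^sup>+ y\<in>A. emeasure (\<kappa> (Suc m) y) B \<partial>distr \<mu> (state_space d pset) (\<lambda>x. restrict x pset))"
      using cond[of "Suc m"] m A B by (simp add: is_cond_distr_def)
    also have "\<dots> = (\<integral>\<^sup>+ x. emeasure (\<kappa> (Suc m) (restrict x pset)) B * indicator A (restrict x pset) \<partial>\<mu>)"
    proof (rule nn_integral_distr[OF rm])
      show "(\<lambda>y. emeasure (\<kappa> (Suc m) y) B * indicator A y) \<in> borel_measurable (distr \<mu> (state_space d pset) (\<lambda>x. restrict x pset))"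
        using measurable_emeasure_kernel[OF kernel_measurable[OF m] B] A by simp
    qed
    also have "\<dots> = (\<integral>\<^sup>+ x. ennreal (c x * e x) \<partial>\<mu>)"
    proof (rule nn_integral_cong)
      fix x assume "x \<in> space \<mu>"
      hence "prob_space (\<kappa> (Suc m) (restrict x pset))"
        using measurable_space[OF kernel_measurable[OF m] measurable_space[OF rm]] by (simp add: space_prob_algebra)
      then interpret \<kappa>: prob_space "\<kappa> (Suc m) (restrict x pset)" .
      show "emeasure (\<kappa> (Suc m) (restrict x pset)) B * indicator A (restrict x pset) = ennreal (c x * e x)"
        by (simp add: c_def e_def \<kappa>.emeasure_eq_measure indicator_def)
    qed
    also have "\<dots> = ennreal (\<integral>x. c x * e x \<partial>\<mu>)"
      using i2 c01 e01 by (intro nn_integral_eq_integral AE_I2) (auto simp: c_def indicator_def)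
    finally have "ennreal (cell_prob a j b) = ennreal (\<integral>x. c x * e x \<partial>\<mu>)" .
    moreover have "0 \<le> (\<integral>x. c x * e x \<partial>\<mu>)"
      using e01 by (intro integral_nonneg_AE AE_I2) (auto simp: c_def indicator_def)
    ultimately show ?thesis by (simp add: cell_prob_def)
  qed
  have "(\<integral>x. dev a j b x \<partial>\<mu>) = (\<integral>x. c x * w x - c x * e x \<partial>\<mu>)"
    by (rule bochner_cong) (rule dev_eq)
  thus "(\<integral>x. dev a j b x \<partial>\<mu>) = 0"
    using int1 int2 i1 i2 by simp
  have "(\<integral>x. (dev a j b x)\<^sup>2 \<partial>\<mu>) \<le> (\<integral>x. c x * w x + c x * e x \<partial>\<mu>)"
  proof (rule integral_mono)
    have "(\<lambda>x. (c x * w x - c x * e x)\<^sup>2) \<in> borel_measurable \<mu>" using cm wm em by simp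
    moreover have "\<bar>c x * w x - c x * e x\<bar> \<le> 1" if "x \<in> space \<mu>" for x
      using c01[of x] w01[of x] e01[OF that] by auto
    hence "\<bar>(c x * w x - c x * e x)\<^sup>2\<bar> \<le> 1" if "x \<in> space \<mu>" for x
      using that by (simp add: abs_square_le_1)
    ultimately have "integrable \<mu> (\<lambda>x. (c x * w x - c x * e x)\<^sup>2)"
      by (intro \<mu>.integrable_const_bound[where B = 1] AE_I2) auto
    thus "integrable \<mu> (\<lambda>x. (dev a j b x)\<^sup>2)"
      by (subst Bochner_Integration.integrable_cong[OF refl]) (simp_all add: dev_eq)
    show "integrable \<mu> (\<lambda>x. c x * w x + c x * e x)" using i1 i2 by simp
    fix x assume x: "x \<in> space \<mu>"
    have "e x * e x \<le> e x" using e01[OF x] mult_left_mono[of "e x" 1 "e x"] by simp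
    thus "(dev a j b x)\<^sup>2 \<le> c x * w x + c x * e x"
      using c01[of x] w01[of x] e01[OF x] unfolding dev_eq[OF x]
      by (auto simp: power2_eq_square algebra_simps)
  qed
  also have "\<dots> = 2 * cell_prob a j b" using int1 int2 i1 i2 by simp
  finally show "(\<integral>x. (dev a j b x)\<^sup>2 \<partial>\<mu>) \<le> 2 * cell_prob a j b" .
qed

text \<open>The cells of one scale partition the space. The variance bounds of all cells therefore
  add up to a constant, however many cells there are.\<close>

lemma sum_cell_prob: "(\<Sum>a\<in>state_grid d pset J. \<Sum>b\<in>cube_grid (d (Suc m)) j. cell_prob a j b) = 1"
proof -
  have sets: "sets \<mu> = sets (states d K)" using \<mu> by (simp add: space_prob_algebra)
  interpret \<mu>: prob_space \<mu> using \<mu> by (simp add: space_prob_algebra)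
  note sp = sets_eq_imp_space_eq[OF sets]
  have rm: "(\<lambda>x. parent_cell x) \<in> \<mu> \<rightarrow>\<^sub>M count_space (state_grid d pset J)"
    using measurable_compose[OF measurable_state_restrict[OF pset_subset] measurable_state_quant[OF finite_parents]]
    by (simp only: measurable_cong_sets[OF sets refl])
  have km: "(\<lambda>x. node_cell j x) \<in> \<mu> \<rightarrow>\<^sub>M count_space (cube_grid (d (Suc m)) j)"
    using measurable_compose[OF measurable_state_component[of "Suc m" "{1..K}" d] measurable_cube_quant] m
    by (simp add: measurable_cong_sets[OF sets refl])
  let ?C = "\<lambda>a b. {x \<in> space (states d K). parent_cell x = a \<and> node_cell j x = b}"
  have Cs: "?C a b \<in> sets \<mu>" if "a \<in> state_grid d pset J" "b \<in> cube_grid (d (Suc m)) j" for a b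
  proof -
    have "((\<lambda>x. parent_cell x) -` {a} \<inter> space \<mu>) \<inter>
        ((\<lambda>x. node_cell j x) -` {b} \<inter> space \<mu>) \<in> sets \<mu>"
      using that by (intro sets.Int measurable_sets[OF rm] measurable_sets[OF km]) auto
    also have "((\<lambda>x. parent_cell x) -` {a} \<inter> space \<mu>) \<inter>
        ((\<lambda>x. node_cell j x) -` {b} \<inter> space \<mu>) = ?C a b"
      unfolding sp by blast
    finally show ?thesis .
  qed
  have "(\<Sum>a\<in>state_grid d pset J. \<Sum>b\<in>cube_grid (d (Suc m)) j. cell_prob a j b) =
      (\<Sum>z\<in>state_grid d pset J \<times> cube_grid (d (Suc m)) j. measure \<mu> (?C (fst z) (snd z)))"
    by (simp add: sum.cartesian_product cell_prob_def case_prod_beta)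
  also have "\<dots> = measure \<mu> (\<Union>z\<in>state_grid d pset J \<times> cube_grid (d (Suc m)) j. ?C (fst z) (snd z))"
    by (rule \<mu>.finite_measure_finite_Union[symmetric])
      (auto simp: finite_parents disjoint_family_on_def intro!: Cs)
  also have "(\<Union>z\<in>state_grid d pset J \<times> cube_grid (d (Suc m)) j. ?C (fst z) (snd z)) = space \<mu>"
    using measurable_space[OF rm] measurable_space[OF km] unfolding sp by force
  finally show ?thesis using \<mu>.prob_space by simp
qed

text \<open>A comparison of binary exponents. With \<open>max 2 (d (Suc m)) = 2 + M\<close>, passing
  from scale \<open>j\<close> to \<open>J\<close> adds \<open>(J - j) * (2 + M)\<close> to the
  exponent of the node grid bound, and \<open>(J - j) * 2\<close> has to be paid for the factor
  \<open>1 / 4 ^ j\<close>. That \<open>M\<close> is nonnegative is the effect of the maximum with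
  2.\<close>

lemma grid_card_bound:
  assumes D: "max 2 (d (Suc m)) + (\<Sum>l\<in>pset. d l) \<le> D" and n: "2 ^ (J * D) \<le> n" and j: "j \<le> J"
  shows "real (card (state_grid d pset J)) * real (card (cube_grid (d (Suc m)) j)) * (2 ^ J / (2 ^ j * 2 ^ j))
    \<le> 2 ^ D * real n / 2 ^ J"
proof -
  let ?p = "\<Sum>l\<in>pset. d l" and ?k = "d (Suc m)"
  obtain i where J: "J = j + i" using j by (metis le_add_diff_inverse)
  obtain M where M: "max 2 ?k = 2 + M" by (metis le_add_diff_inverse max.cobounded1)
  have k: "?k \<le> 2 + M" using M by linarith
  have "Suc J * ?p + Suc j * ?k + 2 * J \<le> D + J * D + 2 * j"
  proof -
    have "Suc J * ?p + Suc j * ?k + 2 * J \<le> Suc J * ?p + ?k + j * (2 + M) + 2 * J"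
      using mult_le_mono2[OF k, of j] by simp
    also have "\<dots> \<le> Suc J * ?p + (2 + M) + J * (2 + M) + 2 * j"
      using k by (simp add: J algebra_simps)
    also have "\<dots> = Suc J * (max 2 ?k + ?p) + 2 * j" unfolding M by (simp add: algebra_simps)
    also have "\<dots> \<le> Suc J * D + 2 * j" using mult_le_mono2[OF D, of "Suc J"] by simp
    finally show ?thesis by simp
  qed
  hence "(2::real) ^ (Suc J * ?p + Suc j * ?k + 2 * J) \<le> 2 ^ (D + J * D + 2 * j)"
    by (intro power_increasing) auto
  hence 1: "(2::real) ^ (Suc J * ?p) * 2 ^ (Suc j * ?k) * (2 ^ J * 2 ^ J) \<le> 2 ^ D * 2 ^ (J * D) * (2 ^ j * 2 ^ j)"
    by (simp only: power_add mult_2)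
  have "(2::real) ^ (J * D) \<le> real n" using n by (metis of_nat_le_iff of_nat_numeral of_nat_power)
  hence 2: "2 ^ D * 2 ^ (J * D) * (2 ^ j * 2 ^ j) \<le> 2 ^ D * real n * (2 ^ j * 2 ^ j)"
    by (intro mult_right_mono mult_left_mono) auto
  have c1: "real (card (state_grid d pset J)) \<le> 2 ^ (Suc J * ?p)"
    using card_state_grid[OF finite_parents, of d m J] by (metis of_nat_le_iff of_nat_numeral of_nat_power)
  have c2: "real (card (cube_grid ?k j)) \<le> 2 ^ (Suc j * ?k)"
    using card_cube_grid[of ?k j] by (metis of_nat_le_iff of_nat_numeral of_nat_power)
  have "real (card (state_grid d pset J)) * real (card (cube_grid ?k j)) * (2 ^ J * 2 ^ J)
      \<le> 2 ^ (Suc J * ?p) * 2 ^ (Suc j * ?k) * (2 ^ J * 2 ^ J)"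
    using c1 c2 by (intro mult_right_mono mult_mono) auto
  hence "real (card (state_grid d pset J)) * real (card (cube_grid ?k j)) * (2 ^ J * 2 ^ J) \<le> 2 ^ D * real n * (2 ^ j * 2 ^ j)"
    using 1 2 by linarith
  thus ?thesis by (simp add: field_simps)
qed

lemma deviation_sum_integrable:
  fixes n :: nat
  assumes "a \<in> state_grid d pset J" "b \<in> cube_grid (d (Suc m)) j"
  shows "integrable (Pi\<^sub>M {..<n} (\<lambda>_. \<mu>)) (\<lambda>X. \<bar>\<Sum>i<n. dev a j b (X i)\<bar>)"
proof -
  interpret \<mu>: prob_space \<mu> using \<mu> by (simp add: space_prob_algebra)
  show ?thesis
    by (rule \<mu>.iid_sum_integrable(1)[OF deviation_moments(1)[OF assms] deviation_moments(2)[OF assms]])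
qed

lemma total_deviation_integrable:
  fixes n :: nat
  shows   "integrable (Pi\<^sub>M {..<n} (\<lambda>_. \<mu>)) (\<lambda>X. total_deviation E d \<kappa> n J m X)"
  unfolding total_deviation_def cell_deviation_def
  by (intro Bochner_Integration.integrable_sum integrable_mult_right deviation_sum_integrable)

text \<open>At every scale the variance part sums to \<open>2 * n / 2 ^ J\<close> by
  \<open>sum_cell_prob\<close>, and the part proportional to the number of cells is at most
  \<open>2 ^ D * n / 2 ^ J\<close> by \<open>grid_card_bound\<close>. The factor
  \<open>Suc J\<close> is the number of scales.\<close>

lemma expected_total_deviation:
  assumes D: "max 2 (d (Suc m)) + (\<Sum>l\<in>pset. d l) \<le> D" and n: "2 ^ (J * D) \<le> n"
  shows "(\<integral>X. total_deviation E d \<kappa> n J m X \<partial>Pi\<^sub>M {..<n} (\<lambda>_. \<mu>)) \<le> real (Suc J) * ((2 + 2 ^ D) * real n / 2 ^ J)"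
proof -
  interpret \<mu>: prob_space \<mu> using \<mu> by (simp add: space_prob_algebra)
  let ?N = "Pi\<^sub>M {..<n} (\<lambda>_. \<mu>)"
  let ?Ga = "state_grid d pset J" and ?Gb = "\<lambda>j. cube_grid (d (Suc m)) j"
  let ?T = "\<lambda>a j b X. \<bar>\<Sum>i<n. dev a j b (X i)\<bar>"
  note ii = deviation_sum_integrable
  have "(\<integral>X. total_deviation E d \<kappa> n J m X \<partial>?N) = (\<Sum>a\<in>?Ga. \<Sum>j\<le>J. \<Sum>b\<in>?Gb j. 2 / 2 ^ j * (\<integral>X. ?T a j b X \<partial>?N))"
  proof -
    have "(\<integral>X. total_deviation E d \<kappa> n J m X \<partial>?N) = (\<Sum>a\<in>?Ga. \<integral>X. (\<Sum>j\<le>J. \<Sum>b\<in>?Gb j. 2 / 2 ^ j * ?T a j b X) \<partial>?N)"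
      unfolding total_deviation_def cell_deviation_def
      by (intro bochner_sums integrable_mult_right ii)
    also have "\<dots> = (\<Sum>a\<in>?Ga. \<Sum>j\<le>J. \<integral>X. (\<Sum>b\<in>?Gb j. 2 / 2 ^ j * ?T a j b X) \<partial>?N)"
      by (intro sum.cong refl bochner_sums integrable_mult_right ii)
    also have "\<dots> = (\<Sum>a\<in>?Ga. \<Sum>j\<le>J. \<Sum>b\<in>?Gb j. \<integral>X. 2 / 2 ^ j * ?T a j b X \<partial>?N)"
      by (intro sum.cong refl Bochner_Integration.integral_sum integrable_mult_right ii)
    finally show ?thesis by (simp only: integral_mult_right_zero)
  qed
  also have "\<dots> \<le> (\<Sum>a\<in>?Ga. \<Sum>j\<le>J. \<Sum>b\<in>?Gb j. 2 * real n / 2 ^ J * cell_prob a j b + 2 ^ J / (2 ^ j * 2 ^ j))"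
  proof (intro sum_mono)
    fix a j b assume ab: "a \<in> ?Ga" "b \<in> ?Gb j"
    \<comment> \<open>The free weight is \<open>2 ^ J / 2 ^ j\<close>. Multiplied by the chaining
      weight \<open>2 / 2 ^ j\<close>, it gives the variance part the factor
      \<open>1 / 2 ^ J\<close> at every scale, independently of \<open>j\<close>.\<close>
    have "(\<integral>X. ?T a j b X \<partial>?N) \<le> real n * (2 * cell_prob a j b) / (2 * (2 ^ J / 2 ^ j)) + (2 ^ J / 2 ^ j) / 2"
      by (rule \<mu>.integral_abs_iid_sum_le[OF deviation_moments(1)[OF ab] deviation_moments(2)[OF ab]
            deviation_moments(3)[OF ab] _ deviation_moments(4)[OF ab]]) simp_all
    from mult_left_mono[OF this, of "2 / 2 ^ j"]
    show "2 / 2 ^ j * (\<integral>X. ?T a j b X \<partial>?N) \<le> 2 * real n / 2 ^ J * cell_prob a j b + 2 ^ J / (2 ^ j * 2 ^ j)"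
      by (simp add: field_simps)
  qed
  also have "\<dots> = (\<Sum>j\<le>J. \<Sum>a\<in>?Ga. \<Sum>b\<in>?Gb j. 2 * real n / 2 ^ J * cell_prob a j b + 2 ^ J / (2 ^ j * 2 ^ j))"
    by (rule sum.swap)
  also have "\<dots> = (\<Sum>j\<le>J. 2 * real n / 2 ^ J + real (card ?Ga) * real (card (?Gb j)) * (2 ^ J / (2 ^ j * 2 ^ j)))"
  proof (rule sum.cong[OF refl])
    fix j
    have "(\<Sum>a\<in>?Ga. \<Sum>b\<in>?Gb j. 2 * real n / 2 ^ J * cell_prob a j b + 2 ^ J / (2 ^ j * 2 ^ j)) =
       2 * real n / 2 ^ J * (\<Sum>a\<in>?Ga. \<Sum>b\<in>?Gb j. cell_prob a j b) + real (card ?Ga) * (real (card (?Gb j)) * (2 ^ J / (2 ^ j * 2 ^ j)))"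
      by (simp only: sum.distrib sum_constant sum_distrib_left[symmetric])
    thus "(\<Sum>a\<in>?Ga. \<Sum>b\<in>?Gb j. 2 * real n / 2 ^ J * cell_prob a j b + 2 ^ J / (2 ^ j * 2 ^ j)) =
       2 * real n / 2 ^ J + real (card ?Ga) * real (card (?Gb j)) * (2 ^ J / (2 ^ j * 2 ^ j))"
      by (simp only: sum_cell_prob mult_1_right mult.assoc)
  qed
  also have "\<dots> \<le> (\<Sum>j\<le>J. 2 * real n / 2 ^ J + 2 ^ D * real n / 2 ^ J)"
    by (intro sum_mono add_left_mono grid_card_bound D n) simp
  also have "\<dots> = real (Suc J) * ((2 + 2 ^ D) * real n / 2 ^ J)"
    by (simp add: add_divide_distrib distrib_right)
  finally show ?thesis .
qed

end

end

section \<open>The minimax risk\<close>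

lemma plugin_sample_cong:
  assumes "\<And>i. i < n \<Longrightarrow> z i = z' i"
  shows "plugin E n z m = plugin E n z' m"
proof (induction m)
  case (Suc m)
  have M: "matches n z P s = matches n z' P s" for P s
    using assms by (auto simp: matches_def)
  have "(\<Sum>i\<in>matches n z P s. \<phi> (s(Suc m := z i (Suc m)))) = (\<Sum>i\<in>matches n z' P s. \<phi> (s(Suc m := z' i (Suc m))))"
    for P s and \<phi> :: "(nat \<Rightarrow> 'a) \<Rightarrow> real"
    by (rule sum.cong[OF M]) (use assms in \<open>simp add: matches_def\<close>)
  thus ?case using Suc M by (intro ext) simp
qed (simp add: fun_eq_iff)

lemma space_PiM_component: "x \<in> space (Pi\<^sub>M I (\<lambda>_. M)) \<Longrightarrow> i \<in> I \<Longrightarrow> x i \<in> space M"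
  by (auto simp: space_PiM PiE_iff)

text \<open>Restricting the rounded sample to the indices below \<open>n\<close> makes it range over
  a finite set. Measurability then reduces to that of a map with finitely many values, followed by
  an arbitrary map on a discrete space.\<close>

definition graph_estimator where
  "graph_estimator K E d n J x = plugin_measure K E d n J (\<lambda>i\<in>{..<n}. state_quant d {1..K} J (x i))"

lemma graph_estimator_eq:
  "graph_estimator K E d n J x = plugin_measure K E d n J (\<lambda>i. state_quant d {1..K} J (x i))"
proof -
  have "plugin E n (\<lambda>i\<in>{..<n}. state_quant d {1..K} J (x i)) K = plugin E n (\<lambda>i. state_quant d {1..K} J (x i)) K"
    by (rule plugin_sample_cong) simp
  thus ?thesis by (simp add: graph_estimator_def plugin_measure_def)
qed

lemma measurable_graph_estimator:
  assumes dag: "sorted_dag K E" and nc: "no_collider K E" and n: "0 < n"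
  shows "graph_estimator K E d n J \<in> Pi\<^sub>M {..<n} (\<lambda>_. states d K) \<rightarrow>\<^sub>M prob_algebra (states d K)"
proof -
  let ?M = "Pi\<^sub>M {..<n} (\<lambda>_. states d K)"
  let ?S = "state_grid d {1..K} J" and ?q = "state_quant d {1..K} J"
  let ?T = "PiE {..<n} (\<lambda>_. ?S)"
  have finT: "finite ?T" by (intro finite_PiE) auto
  have "(\<lambda>x. \<lambda>i\<in>{..<n}. ?q (x i)) \<in> ?M \<rightarrow>\<^sub>M count_space ?T"
  proof (subst measurable_count_space_eq2[OF finT], intro conjI ballI)
    have qS: "?q (x i) \<in> ?S" if "x \<in> space ?M" "i < n" for x i
      using that(2) by (intro state_quant_in_grid[OF space_PiM_component[OF that(1)]]) simp
    thus "(\<lambda>x. \<lambda>i\<in>{..<n}. ?q (x i)) \<in> space ?M \<rightarrow> ?T" by auto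
    fix t assume t: "t \<in> ?T"
    have "(\<lambda>x. \<lambda>i\<in>{..<n}. ?q (x i)) -` {t} \<inter> space ?M = {x \<in> space ?M. \<forall>i\<in>{..<n}. ?q (x i) = t i}"
      using restrict_eq_iff[of t "{..<n}"] t by (auto simp: PiE_def)
    also have "\<dots> \<in> sets ?M"
    proof (rule sets.sets_Collect_finite_All[OF _ finite_lessThan])
      fix i assume i: "i \<in> {..<n}"
      have "(\<lambda>x. ?q (x i)) \<in> ?M \<rightarrow>\<^sub>M count_space ?S"
        by (rule measurable_compose[OF measurable_component_singleton[of i "{..<n}" "\<lambda>_. states d K"] measurable_state_quant])
          (use i in simp_all)
      moreover have "{t i} \<in> sets (count_space ?S)" using t i by (auto simp: PiE_iff)
      ultimately have "(\<lambda>x. ?q (x i)) -` {t i} \<inter> space ?M \<in> sets ?M" by (rule measurable_sets)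
      thus "{x \<in> space ?M. ?q (x i) = t i} \<in> sets ?M" by (simp add: vimage_def Int_def conj_commute)
    qed
    finally show "(\<lambda>x. \<lambda>i\<in>{..<n}. ?q (x i)) -` {t} \<inter> space ?M \<in> sets ?M" .
  qed
  moreover have "plugin_measure K E d n J \<in> count_space ?T \<rightarrow>\<^sub>M prob_algebra (states d K)"
    unfolding measurable_count_space_eq1
  proof
    fix z assume "z \<in> ?T"
    thus "plugin_measure K E d n J z \<in> space (prob_algebra (states d K))"
      by (intro plugin_measure_prob dag nc n) (auto simp: PiE_iff)
  qed
  ultimately show ?thesis unfolding graph_estimator_def[abs_def] by (rule measurable_compose)
qed

text \<open>The leading 2 is the cost of rounding. Each of the \<open>K\<close> nodes contributes
  \<open>1 + L\<close> as bias and \<open>2 + 2 ^ D\<close> as fluctuation, amplified by the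
  Lipschitz growth \<open>(1 + L) ^ K\<close>. Terms of order \<open>1 / 2 ^ J\<close> are absorbed
  because \<open>Suc J\<close> is at least 1.\<close>

lemma (in lipschitz_model) risk_le:
  assumes nc: "no_collider K E" and n: "2 ^ (J * D) \<le> n"
    and D: "\<And>k. k \<in> {1..K} \<Longrightarrow> max 2 (d k) + (\<Sum>l\<in>parents E k. d l) \<le> D"
  shows "(\<integral>\<^sup>+X. wasserstein (state_dist d {1..K}) \<mu> (graph_estimator K E d n J X) \<partial>Pi\<^sub>M {..<n} (\<lambda>_. \<mu>))
    \<le> ennreal ((2 + (1 + L) ^ K * (real K * (3 + L + 2 ^ D))) * (real (Suc J) / 2 ^ J))"
proof -
  interpret \<mu>: prob_space \<mu> using \<mu> by (simp add: space_prob_algebra)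
  let ?N = "Pi\<^sub>M {..<n} (\<lambda>_. \<mu>)"
  interpret N: prob_space ?N by (intro prob_space_PiM \<mu>.prob_space_axioms)
  have sets: "sets \<mu> = sets (states d K)" using \<mu> by (simp add: space_prob_algebra)
  have n0: "0 < n" using n by (metis le_zero_eq neq0_conv power_eq_0_iff zero_neq_numeral)
  let ?T = "\<lambda>m X. total_deviation E d \<kappa> n J m X"
  let ?\<Phi> = "\<lambda>X. 2 / 2 ^ J + (1 + L) ^ K * (\<Sum>m<K. (1 + L) / 2 ^ J + ?T m X / n)"
  have Ti: "integrable ?N (?T m)" if "m < K" for m by (rule total_deviation_integrable[OF that])
  have si: "integrable ?N (\<lambda>X. \<Sum>m<K. (1 + L) / 2 ^ J + ?T m X / n)"
    using Ti by (intro Bochner_Integration.integrable_sum Bochner_Integration.integrable_add integrable_divide_zero) auto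
  hence \<Phi>i: "integrable ?N ?\<Phi>" by simp
  have "(\<integral>\<^sup>+X. wasserstein (state_dist d {1..K}) \<mu> (graph_estimator K E d n J X) \<partial>?N) \<le> (\<integral>\<^sup>+X. ennreal (?\<Phi> X) \<partial>?N)"
  proof (rule nn_integral_mono)
    fix X assume "X \<in> space ?N"
    hence "X i \<in> space (states d K)" if "i < n" for i
      using space_PiM_component[of X "{..<n}" \<mu> i] that sets_eq_imp_space_eq[OF sets] by simp
    thus "wasserstein (state_dist d {1..K}) \<mu> (graph_estimator K E d n J X) \<le> ennreal (?\<Phi> X)"
      unfolding graph_estimator_eq by (intro wasserstein_plugin_measure nc n0)
  qed
  also have "\<dots> = ennreal (\<integral>X. ?\<Phi> X \<partial>?N)"
  proof (intro nn_integral_eq_integral AE_I2 \<Phi>i)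
    show "0 \<le> ?\<Phi> X" for X
      using L by (auto simp: total_deviation_def intro!: add_nonneg_nonneg mult_nonneg_nonneg sum_nonneg divide_nonneg_nonneg cell_deviation_nonneg)
  qed
  also have "\<dots> \<le> ennreal ((2 + (1 + L) ^ K * (real K * (3 + L + 2 ^ D))) * (real (Suc J) / 2 ^ J))"
  proof (rule ennreal_leI)
    have "(\<integral>X. ?\<Phi> X \<partial>?N) = 2 / 2 ^ J + (1 + L) ^ K * (\<integral>X. (\<Sum>m<K. (1 + L) / 2 ^ J + ?T m X / n) \<partial>?N)"
      using si N.prob_space by simp
    also have "(\<integral>X. (\<Sum>m<K. (1 + L) / 2 ^ J + ?T m X / n) \<partial>?N) = (\<Sum>m<K. (1 + L) / 2 ^ J + (\<integral>X. ?T m X \<partial>?N) / n)"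
      using Ti N.prob_space by (subst Bochner_Integration.integral_sum) auto
    also have "\<dots> \<le> (\<Sum>m<K. (3 + L + 2 ^ D) * (real (Suc J) / 2 ^ J))"
    proof (rule sum_mono)
      fix m assume m: "m \<in> {..<K}"
      have "(\<integral>X. ?T m X \<partial>?N) \<le> real (Suc J) * ((2 + 2 ^ D) * real n / 2 ^ J)"
        using m by (intro expected_total_deviation D n) auto
      hence "(\<integral>X. ?T m X \<partial>?N) / n \<le> real (Suc J) * ((2 + 2 ^ D) * real n / 2 ^ J) / n"
        by (rule divide_right_mono) simp
      also have "\<dots> = (2 + 2 ^ D) * (real (Suc J) / 2 ^ J)" using n0 by simp
      finally have 1: "(\<integral>X. ?T m X \<partial>?N) / n \<le> (2 + 2 ^ D) * (real (Suc J) / 2 ^ J)" .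
      have "(1 + L) / 2 ^ J = (1 + L) * (1 / 2 ^ J)" by simp
      also have "\<dots> \<le> (1 + L) * (real (Suc J) / 2 ^ J)"
        using L by (intro mult_left_mono divide_right_mono) auto
      finally have 2: "(1 + L) / 2 ^ J \<le> (1 + L) * (real (Suc J) / 2 ^ J)" .
      have "(3 + L + 2 ^ D) * t = (1 + L) * t + (2 + 2 ^ D) * t" for t :: real by (simp add: algebra_simps)
      with 1 2 show "(1 + L) / 2 ^ J + (\<integral>X. ?T m X \<partial>?N) / n \<le> (3 + L + 2 ^ D) * (real (Suc J) / 2 ^ J)"
        by (metis add_mono)
    qed
    also have "\<dots> = real K * (3 + L + 2 ^ D) * (real (Suc J) / 2 ^ J)" by simp
    finally have A: "(\<integral>X. ?\<Phi> X \<partial>?N) \<le> 2 / 2 ^ J + (1 + L) ^ K * (real K * (3 + L + 2 ^ D) * (real (Suc J) / 2 ^ J))"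
      using L by simp
    have B: "2 / 2 ^ J \<le> 2 * (real (Suc J) / 2 ^ J)" by (simp add: divide_right_mono)
    show "(\<integral>X. ?\<Phi> X \<partial>?N) \<le> (2 + (1 + L) ^ K * (real K * (3 + L + 2 ^ D))) * (real (Suc J) / 2 ^ J)"
      using order_trans[OF A add_right_mono[OF B]] by (simp only: distrib_right mult.assoc)
  qed
  finally show ?thesis .
qed

text \<open>The upper bound on \<open>n\<close> gives
  \<open>1 / 2 ^ J \<le> 2 * n powr (- 1 / D)\<close>. The lower bound, with \<open>ln 2\<close> at
  least one half, gives \<open>J \<le> 2 * ln n\<close> and so
  \<open>Suc J \<le> 3 * max (ln n) 1\<close>. Hence the factor 6.\<close>

lemma scale_rate:
  assumes D: "1 \<le> D" and n: "2 ^ (J * D) \<le> n" "n < 2 ^ (Suc J * D)"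
  shows "real (Suc J) / 2 ^ J \<le> 6 * (max (ln (real n)) 1 * real n powr (- 1 / real D))"
proof -
  have n0: "0 < real n" using n(1) by (metis le_zero_eq neq0_conv of_nat_0_less_iff power_eq_0_iff zero_neq_numeral)
  have up: "real n \<le> 2 ^ (Suc J * D)"
    using n(2) by (metis less_imp_le of_nat_le_iff of_nat_numeral of_nat_power)
  have lo: "2 ^ (J * D) \<le> real n"
    using n(1) by (metis of_nat_le_iff of_nat_numeral of_nat_power)
  have "real n powr (1 / real D) \<le> (2 ^ (Suc J * D)) powr (1 / real D)"
    using up n0 by (intro powr_mono2) auto
  also have "\<dots> = (2 powr (real (Suc J * D))) powr (1 / real D)"
    by (simp only: powr_realpow[of 2] zero_less_numeral)
  also have "\<dots> = 2 powr real (Suc J)"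
  proof -
    have "real (Suc J * D) * (1 / real D) = real (Suc J)" 
      using D by (simp only: of_nat_mult times_divide_eq_right mult_1_right) (simp del: of_nat_Suc)
    thus ?thesis by (simp only: powr_powr)
  qed
  also have "\<dots> = 2 * 2 ^ J" by (simp only: powr_realpow[of 2] zero_less_numeral power_Suc)
  finally have "1 / (2 * 2 ^ J) \<le> 1 / real n powr (1 / real D)"
    using n0 by (intro divide_left_mono) auto
  also have "\<dots> = real n powr (- 1 / real D)" by (simp add: powr_minus_divide)
  finally have 1: "1 / 2 ^ J \<le> 2 * real n powr (- 1 / real D)" by simp
  have "J \<le> J * D" using D by simp
  hence JD: "real J \<le> real (J * D)" by (rule of_nat_mono)
  have "1 / 2 \<le> ln (2 :: real)" by (rule ln_ge_iff[THEN iffD2, OF _ exp_half_le2]) simp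
  hence "real J * (1 / 2) \<le> real (J * D) * ln 2"
    using JD by (intro mult_mono) auto
  also have "\<dots> = ln (2 ^ (J * D))" by (simp add: ln_realpow)
  also have "\<dots> \<le> ln (real n)" using lo n0 by (subst ln_le_cancel_iff) auto
  finally have 2: "real (Suc J) \<le> 3 * max (ln (real n)) 1" by simp
  have "real (Suc J) / 2 ^ J = real (Suc J) * (1 / 2 ^ J)" by simp
  also have "\<dots> \<le> (3 * max (ln (real n)) 1) * (2 * real n powr (- 1 / real D))"
    using 1 2 by (intro mult_mono) auto
  finally show ?thesis by simp
qed

theorem theorem1p3:
  fixes K :: nat and E :: "(nat \<times> nat) set" and L :: real and D :: nat
  assumes "K \<ge> 1"
    and "sorted_dag K E"
    and "no_collider K E"
    and "L > 0"
  shows "\<exists>C::real. \<forall>d :: nat \<Rightarrow> nat. (\<forall>k\<in>{1..K}. d k \<ge> 1) \<longrightarrow> d_loc K E d = D \<longrightarrow>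
           (\<forall>n::nat. n \<ge> 1 \<longrightarrow>
              minimax_risk (state_dist d {1..K}) (state_space d {1..K})
                  (lipschitz_graph_measures K E d L) n
                \<le> ennreal (C * max (ln (real n)) 1 * real n powr (- 1 / real D)))"
proof (intro exI[of _ "6 * (2 + (1 + L) ^ K * (real K * (3 + L + 2 ^ D)))"] allI impI)
  \<comment> \<open>\<open>?C\<close> comes from \<open>risk_le\<close> and the 6 from
    \<open>scale_rate\<close>. The node dimensions enter only through \<open>D\<close>, so the
    constant can be fixed before \<open>d\<close>.\<close>
  let ?C = "2 + (1 + L) ^ K * (real K * (3 + L + 2 ^ D))"
  fix d :: "nat \<Rightarrow> nat" and n :: nat
  assume "\<forall>k\<in>{1..K}. 1 \<le> d k" and D: "d_loc K E d = D" and n: "1 \<le> n"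
  have Dk: "max 2 (d k) + (\<Sum>l\<in>parents E k. d l) \<le> D" if "k \<in> {1..K}" for k
    using that unfolding D[symmetric] d_loc_def by (intro Max_ge) auto
  have D2: "2 \<le> D" using Dk[of 1] assms(1) by simp
  have "(2::nat) \<le> 2 ^ D" using power_increasing[of 1 D "2::nat"] D2 by simp
  \<comment> \<open>The base \<open>2 ^ D\<close> is at least 2, so \<open>n\<close> lies between
    two consecutive powers of it; the exponent of the lower one is the grid scale.\<close>
  from ex_power_ivl1[OF this n] obtain J where "(2 ^ D) ^ J \<le> n" "n < (2 ^ D) ^ (J + 1)" by blast
  hence J: "2 ^ (J * D) \<le> n" "n < 2 ^ (Suc J * D)"
    unfolding power_mult[symmetric] by (simp_all only: mult.commute Suc_eq_plus1)
  have n0: "0 < n" using n by simp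
  have "minimax_risk (state_dist d {1..K}) (state_space d {1..K}) (lipschitz_graph_measures K E d L) n
      \<le> ennreal (?C * (real (Suc J) / 2 ^ J))"
    unfolding minimax_risk_def
  proof (rule INF_lower2[OF measurable_graph_estimator[OF assms(2,3) n0, of d J]], rule SUP_least)
    fix \<mu> assume "\<mu> \<in> lipschitz_graph_measures K E d L"
    then obtain \<kappa> where "lipschitz_model K E d L \<mu> \<kappa>"
      by (rule lipschitz_graph_measures_model[OF assms(2,4)])
    then interpret lipschitz_model K E d L \<mu> \<kappa> .
    show "(\<integral>\<^sup>+ x. wasserstein (state_dist d {1..K}) \<mu> (graph_estimator K E d n J x) \<partial>Pi\<^sub>M {..<n} (\<lambda>_. \<mu>))
        \<le> ennreal (?C * (real (Suc J) / 2 ^ J))"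
      by (rule risk_le[OF assms(3) J(1) Dk])
  qed
  also have "\<dots> \<le> ennreal (?C * (6 * (max (ln (real n)) 1 * real n powr (- 1 / real D))))"
    using scale_rate[OF _ J] D2 assms(4) by (intro ennreal_leI mult_left_mono) auto
  finally show "minimax_risk (state_dist d {1..K}) (state_space d {1..K}) (lipschitz_graph_measures K E d L) n
      \<le> ennreal (6 * ?C * max (ln (real n)) 1 * real n powr (- 1 / real D))"
    by (simp only: ac_simps)
qed

end
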